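(* Let $\Lambda$ be an admissible sequence whose associated expansion has exactly one negative exponent, i.e. $\Theta(t)\sim\sum_{i\ge0}A_{k_i}t^{k_i}$ as $t\to0^+$ with $k_0<0$ and $k_i\ge0$ for all $i>0$, and put $\mu=-k_0$. Then the expected number of summands $m_\Lambda(n)=t_\Lambda^1(n)/t_\Lambda^0(n)$ satisfies, as $n\to\infty$: (i) If $\mu<1$, then $$m_\Lambda(n)=\zeta_\Lambda(1)\left(\frac{n}{\zeta_R(\mu+1)\mu A_{-\mu}}\right)^{\frac1{\mu+1}}[1+o(1)].$$ (ii) If $\mu=1$, then $$m_\Lambda(n)=\left(\frac{6n}{\pi^2A_{-1}}\right)^{\frac12}\left(\mathrm{FP}_{t=1}\zeta_\Lambda(t)-\frac{A_{-1}}{2}\log\frac{\pi^2A_{-1}}{6n}\right)[1+o(1)].$$ (iii) If $\mu>1$, then $$m_\Lambda(n)=\zeta_R(\mu)A_{-\mu}^{\frac1{\mu+1}}\left(\frac{n}{\zeta_R(\mu+1)\mu}\right)^{\frac{\mu}{\mu+1}}[1+o(1)].$$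
   Context: A sequence $\Lambda$ is called admissible if it is a nondecreasing sequence of positive integers (the same integer may occur finitely many times; all sums and products over $\lambda\in\Lambda$ count multiplicity) such that: (i) $1\in\Lambda$; (ii) $\Theta(t)=\sum_{\lambda\in\Lambda}e^{-\lambda t}$ converges for all $t>0$; (iii) as $t\to0^+$, $\Theta$ admits a full asymptotic expansion $\Theta(t)\sim\sum_{i\ge0}A_{k_i}t^{k_i}$ with real exponents $k_0<k_1<k_2<\cdots$, $k_i\to\infty$, $k_0<0$ and $A_{k_0}\neq0$. Thus $A_x$ is the coefficient of $t^x$ in the expansion. Let $\zeta_\Lambda(s)=\sum_{\lambda\in\Lambda}\lambda^{-s}$ for $\Re s>-k_0$, also denoting its meromorphic continuation to $\mathbb{C}$; $\mathrm{FP}_{t=1}\zeta_\Lambda(t)$ is the constant term of the Laurent expansion of $\zeta_\Lambda(t)$ about $t=1$. $\zeta_R$ is the Riemann zeta-function. Let $p_\Lambda(n,m)$ be the number of partitions of $n$ into $m$ summands from $\Lambda$, where repetition of summands is allowed and equal integers occupying different positions of $\Lambda$ are regarded as different; that is, $\prod_{\lambda\in\Lambda}(1-zx^\lambda)^{-1}=\sum_{n,m\ge0}p_\Lambda(n,m)x^nz^m$. For $n\ge1$ and $k\ge0$, $t_\Lambda^k(n)=\sum_{m\ge0}m^kp_\Lambda(n,m)$ (the $k$ in $t_\Lambda^k$ is an index; $t_\Lambda^0(n)=\sum_m p_\Lambda(n,m)$). *)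

theory Defs
  imports "HOL-Complex_Analysis.Complex_Analysis" "HOL-Library.Landau_Symbols"
    "HOL-Library.Multiset"
begin

text \<open>
  A sequence with multiplicities is a function \<open>\<Lambda> :: nat \<Rightarrow> nat\<close> on positions. It is
  necessarily infinite, because \<open>Theta\<close> is unbounded at \<open>0\<close> when the leading exponent is negative.
\<close>

definition Theta :: "(nat \<Rightarrow> nat) \<Rightarrow> real \<Rightarrow> real" where
  "Theta \<Lambda> t = (\<Sum>i. exp (- real (\<Lambda> i) * t))"

text \<open>
  \<open>A x\<close> is the coefficient of \<open>t\<^sup>x\<close>; its values off \<open>range k\<close> play no role. Only the leading
  coefficient has to be nonzero, so a terminating expansion is covered by padding with zeros.
\<close>

definition theta_expansion :: "(nat \<Rightarrow> nat) \<Rightarrow> (nat \<Rightarrow> real) \<Rightarrow> (real \<Rightarrow> real) \<Rightarrow> bool" where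
  "theta_expansion \<Lambda> k A \<longleftrightarrow>
     strict_mono k \<and> filterlim k at_top sequentially \<and> k 0 < 0 \<and> A (k 0) \<noteq> 0 \<and>
     (\<forall>N. (\<lambda>t. Theta \<Lambda> t - (\<Sum>i\<le>N. A (k i) * t powr k i)) \<in> o[at_right 0](\<lambda>t. t powr k N))"

definition admissible_seq :: "(nat \<Rightarrow> nat) \<Rightarrow> bool" where
  "admissible_seq \<Lambda> \<longleftrightarrow>
     mono \<Lambda> \<and> (\<forall>i. 0 < \<Lambda> i) \<and> (\<forall>l. finite {i. \<Lambda> i = l}) \<and>
     1 \<in> range \<Lambda> \<and>
     (\<forall>t>0. summable (\<lambda>i. exp (- real (\<Lambda> i) * t))) \<and>
     (\<exists>k A. theta_expansion \<Lambda> k A)"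

definition dirichlet_conv :: "(nat \<Rightarrow> nat) \<Rightarrow> complex \<Rightarrow> bool" where
  "dirichlet_conv \<Lambda> s \<longleftrightarrow> summable (\<lambda>i. norm (of_nat (\<Lambda> i) powr (- s) :: complex))"

definition dirichlet_sum :: "(nat \<Rightarrow> nat) \<Rightarrow> complex \<Rightarrow> complex" where
  "dirichlet_sum \<Lambda> s = (\<Sum>i. of_nat (\<Lambda> i) powr (- s))"

text \<open>
  For admissible \<open>\<Lambda>\<close>, \<open>dirichlet_conv \<Lambda> s\<close> holds exactly in the half-plane \<open>Re s > - k 0\<close>.
  Outside it, the value is that of the meromorphic continuation to the whole plane, which is
  unique because \<open>nicely_meromorphic_on\<close> fixes the values at removable singularities and
  sets the value at a pole to \<open>0\<close>.
\<close>

definition zeta_seq :: "(nat \<Rightarrow> nat) \<Rightarrow> complex \<Rightarrow> complex" where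
  "zeta_seq \<Lambda> s =
     (if dirichlet_conv \<Lambda> s then dirichlet_sum \<Lambda> s
      else (THE f. f nicely_meromorphic_on UNIV \<and>
                   (\<forall>w. dirichlet_conv \<Lambda> w \<longrightarrow> f w = dirichlet_sum \<Lambda> w)) s)"

definition finite_part :: "(complex \<Rightarrow> complex) \<Rightarrow> complex \<Rightarrow> complex" where
  "finite_part f z = fls_nth (laurent_expansion f z) 0"

text \<open>The Riemann zeta function, for real arguments greater than \<open>1\<close> only.\<close>

definition riemann_zeta :: "real \<Rightarrow> real" where
  "riemann_zeta s = (\<Sum>n. 1 / real (Suc n) powr s)"

text \<open>
  A partition is a finite multiset of positions of \<open>\<Lambda>\<close>, so equal integers at different positions
  are distinguished. For \<open>\<Lambda>\<close> admissible there are finitely many partitions of each \<open>n\<close>, and none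
  with more than \<open>n\<close> summands.
\<close>

definition partition_count :: "(nat \<Rightarrow> nat) \<Rightarrow> nat \<Rightarrow> nat \<Rightarrow> nat" where
  "partition_count \<Lambda> n m = card {M :: nat multiset. size M = m \<and> (\<Sum>i\<in>#M. \<Lambda> i) = n}"

definition partition_moment :: "(nat \<Rightarrow> nat) \<Rightarrow> nat \<Rightarrow> nat \<Rightarrow> real" where
  "partition_moment \<Lambda> k n = (\<Sum>m. real m ^ k * real (partition_count \<Lambda> n m))"

definition expected_summands :: "(nat \<Rightarrow> nat) \<Rightarrow> nat \<Rightarrow> real" where
  "expected_summands \<Lambda> n = partition_moment \<Lambda> 1 n / partition_moment \<Lambda> 0 n"

end

theory Submission
  imports Defs "HOL-Real_Asymp.Real_Asymp"
begin

text \<open>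
  Only the leading term \<open>\<Theta>(t) \<sim> A t\<^sup>-\<^sup>\<mu>\<close> and the monotonicity of the number \<open>p(n)\<close> of partitions, which
  follows from \<open>1 \<in> \<Lambda>\<close>, are used. The number of summands, summed over the partitions of \<open>n\<close>, is
  \<open>\<Sum>v\<le>n. d(v) p(n - v)\<close>, where \<open>d(v)\<close> counts the positions whose entry divides \<open>v\<close>. We show that it
  is asymptotic to \<open>D(\<tau>) p(n)\<close>, where \<open>D(t) = \<Sum>v. d(v) exp(- v t)\<close> and \<open>\<tau> = \<tau>(n)\<close> is the saddle point.

  The partition generating function need not be small away from \<open>1\<close> on the circle of radius
  \<open>exp(- \<tau>)\<close>, so the coefficients are first smoothed by taking partial sums \<open>J > 1 + \<mu>/2\<close> times. This
  contributes a factor \<open>(1 - x)\<^sup>-\<^sup>J\<close>, which makes the far part of the Cauchy integral negligible, and the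
  weight \<open>D\<close> is nearly constant on the remaining part. Monotonicity then allows one to descend from
  partial sums to summands, as all of them behave like \<open>exp(s \<tau>)\<close> under shifts \<open>n + s\<close> with
  \<open>s = O(1/\<tau>)\<close>.

  Finally \<open>D(t) = \<Sum>r\<ge>1. \<Theta>(r t) = \<Sum>\<lambda>. 1 / (exp(\<lambda> t) - 1)\<close>. For \<open>\<mu> > 1\<close> the first form gives
  \<open>A \<zeta>(\<mu>) t\<^sup>-\<^sup>\<mu>\<close>, for \<open>\<mu> < 1\<close> the second one gives \<open>(\<Sum>\<lambda>. 1/\<lambda>) / t\<close>, and for \<open>\<mu> = 1\<close> one gets
  \<open>(A / t) log (1/t)\<close>; in this case the finite part of the zeta function is of lower order.
\<close>

section \<open>Generating functions and their coefficients\<close>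

text \<open>No asymptotic formula for \<open>p(n)\<close> is derived. Only a quotient of two
  coefficients is wanted, so their Cauchy integrals are taken over one circle and the integrands are
  subtracted before integrating; it remains to bound this difference from above and one coefficient
  from below. Relative to the maximum of the integrand on the circle of radius
  \<open>exp(-t)\<close>, the Gaussian part of the arc gives at least a constant times
  \<open>t^(1 + \<mu>/2)\<close>. The remote part costs \<open>t^J\<close>, because the modulus of
  \<open>(1 - x)^(-J)\<close> is bounded there while its value at \<open>exp(-t)\<close> is about
  \<open>t^(-J)\<close>; this is the origin of \<open>J > 1 + \<mu>/2\<close>. On a central arc of
  half-width \<open>Y = t^(1 + a \<mu>)\<close> the weight and the shift vary by
  \<open>O(Y/t)\<close>, an error of order \<open>Y^2/t = t^(1 + 2 a \<mu>)\<close>, so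
  \<open>a > 1/4\<close>. The cubic term of the phase asks for \<open>a > 1/3\<close>, exponential
  smallness at the edge of the arc for \<open>a < 1/2\<close>. The value \<open>a = 2/5\<close>
  meets all three conditions. The saddle point belongs to the \<open>J\<close>-fold partial sums;
  smoothing adds only a logarithm to the exponent and leaves the leading order of
  \<open>\<tau>\<close> unchanged.\<close>

definition disc_summable :: "(nat \<Rightarrow> real) \<Rightarrow> bool" where
  "disc_summable f \<longleftrightarrow> (\<forall>r. 0 \<le> r \<longrightarrow> r < 1 \<longrightarrow> summable (\<lambda>n. \<bar>f n\<bar> * r ^ n))"

text \<open>The argument type is left open because the same series is evaluated at real radii, where
  it gives sizes, and at complex points of a circle, where it gives coefficients.\<close>

definition gf :: "(nat \<Rightarrow> real) \<Rightarrow> 'a \<Rightarrow> 'a::{real_normed_field,banach}" where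
  "gf f x = (\<Sum>n. of_real (f n) * x ^ n)"

definition conv :: "(nat \<Rightarrow> real) \<Rightarrow> (nat \<Rightarrow> real) \<Rightarrow> nat \<Rightarrow> real" where
  "conv f g n = (\<Sum>i\<le>n. f i * g (n - i))"

lemma disc_summableD:
  fixes x :: "'a::{real_normed_field,banach}"
  assumes "disc_summable f" "norm x < 1"
  shows "summable (\<lambda>n. norm (of_real (f n) * x ^ n))"
  using assms unfolding disc_summable_def by (simp add: norm_mult norm_power)

lemma gf_sums:
  fixes x :: "'a::{real_normed_field,banach}"
  assumes "disc_summable f" "norm x < 1"
  shows "(\<lambda>n. of_real (f n) * x ^ n) sums gf f x"
  unfolding gf_def using summable_norm_cancel[OF disc_summableD[OF assms]] by (simp add: summable_sums)

lemma gf_of_real: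
  assumes "disc_summable f" "\<bar>r\<bar> < 1"
  shows "gf f (of_real r) = (of_real (gf f r) :: 'a::{real_normed_field,banach})"
proof -
  have "(\<lambda>n. of_real (of_real (f n) * r ^ n) :: 'a) sums of_real (gf f r)"
    using gf_sums[OF assms(1), of r] assms(2) by (intro sums_of_real) auto
  then have "(\<lambda>n. of_real (f n) * of_real r ^ n :: 'a) sums of_real (gf f r)"
    by simp
  moreover have "(\<lambda>n. of_real (f n) * of_real r ^ n :: 'a) sums gf f (of_real r)"
    using gf_sums[OF assms(1), of "of_real r :: 'a"] assms(2) by auto
  ultimately show ?thesis using sums_unique2 by blast
qed

lemma norm_gf_le:
  fixes x :: "'a::{real_normed_field,banach}"
  assumes "disc_summable f" "\<And>n. f n \<ge> 0" "norm x < 1"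
  shows "norm (gf f x) \<le> gf f (norm x)"
proof -
  have "norm (gf f x) \<le> (\<Sum>n. norm (of_real (f n) * x ^ n))"
    unfolding gf_def by (rule summable_norm[OF disc_summableD[OF assms(1,3)]])
  also have "\<dots> = gf f (norm x)"
    unfolding gf_def using assms(2) by (simp add: norm_mult norm_power)
  finally show ?thesis .
qed

lemma gf_nonneg:
  assumes "disc_summable f" "\<And>n. f n \<ge> 0" "0 \<le> x" "x < (1::real)"
  shows "gf f x \<ge> 0"
  using norm_gf_le[OF assms(1,2), of x] assms(3,4) norm_ge_zero order_trans by fastforce

lemma disc_summable_add:
  assumes "disc_summable f" "disc_summable g"
  shows "disc_summable (\<lambda>n. f n + g n)"
  unfolding disc_summable_def
proof (intro allI impI)
  fix r :: real assume r: "0 \<le> r" "r < 1"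
  have "summable (\<lambda>n. \<bar>f n\<bar> * r ^ n + \<bar>g n\<bar> * r ^ n)"
    using assms r unfolding disc_summable_def by (intro summable_add) auto
  then show "summable (\<lambda>n. \<bar>f n + g n\<bar> * r ^ n)"
    by (rule summable_comparison_test') (use r in \<open>auto simp: abs_mult distrib_right[symmetric] intro!: mult_right_mono\<close>)
qed

lemma gf_add:
  fixes x :: "'a::{real_normed_field,banach}"
  assumes "disc_summable f" "disc_summable g" "norm x < 1"
  shows "gf (\<lambda>n. f n + g n) x = gf f x + gf g x"
  using sums_add[OF gf_sums[OF assms(1,3)] gf_sums[OF assms(2,3)]]
    gf_sums[OF disc_summable_add[OF assms(1,2)] assms(3)] sums_unique2
  by (fastforce simp: distrib_right)

lemma conv_term:
  fixes x :: "'a::{real_normed_field,banach}"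
  shows "(\<Sum>i\<le>k. (of_real (f i) * x ^ i) * (of_real (g (k - i)) * x ^ (k - i))) =
    of_real (conv f g k) * x ^ k"
proof -
  have "(\<Sum>i\<le>k. (of_real (f i) * x ^ i) * (of_real (g (k - i)) * x ^ (k - i)))
    = (\<Sum>i\<le>k. of_real (f i) * of_real (g (k - i)) * (x ^ i * x ^ (k - i)))"
    by (simp add: algebra_simps)
  also have "\<dots> = (\<Sum>i\<le>k. of_real (f i) * of_real (g (k - i)) * x ^ k)"
    by (intro sum.cong refl) (simp add: power_add[symmetric])
  also have "\<dots> = of_real (conv f g k) * x ^ k"
    by (simp add: conv_def sum_distrib_right)
  finally show ?thesis .
qed

lemma
  assumes "disc_summable f" "disc_summable g"
  shows disc_summable_conv: "disc_summable (conv f g)"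
    and gf_conv: "norm (x::'a::{real_normed_field,banach}) < 1 \<Longrightarrow> gf (conv f g) x = gf f x * gf g x"
proof -
  show *: "disc_summable (conv f g)"
    unfolding disc_summable_def
  proof (intro allI impI)
    fix r :: real assume r: "0 \<le> r" "r < 1"
    have "summable (\<lambda>k. \<Sum>i\<le>k. (\<bar>f i\<bar> * r ^ i) * (\<bar>g (k - i)\<bar> * r ^ (k - i)))"
      using assms r unfolding disc_summable_def by (intro summable_Cauchy_product) auto
    then have "summable (\<lambda>k. conv (\<lambda>i. \<bar>f i\<bar>) (\<lambda>i. \<bar>g i\<bar>) k * r ^ k)"
      using conv_term[where x = r and f = "\<lambda>i. \<bar>f i\<bar>" and g = "\<lambda>i. \<bar>g i\<bar>"] by simp
    then show "summable (\<lambda>n. \<bar>conv f g n\<bar> * r ^ n)"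
      by (rule summable_comparison_test')
        (use r in \<open>auto simp: abs_mult conv_def intro!: mult_right_mono order_trans[OF sum_abs]\<close>)
  qed
  show "gf (conv f g) x = gf f x * gf g x" if "norm x < 1"
    using Cauchy_product_sums[OF disc_summableD[OF assms(1) that] disc_summableD[OF assms(2) that]]
    unfolding conv_term gf_def[symmetric] using gf_sums[OF * that] sums_unique2 by blast
qed

lemma
  shows disc_summable_1: "disc_summable (\<lambda>_. 1)"
    and gf_1: "norm (x::'a::{real_normed_field,banach}) < 1 \<Longrightarrow> gf (\<lambda>_. 1) x = 1 / (1 - x)"
  unfolding disc_summable_def gf_def using suminf_geometric[of x]
  by (auto intro: summable_geometric)

section \<open>Coefficients as integrals over a circle\<close>

lemma has_integral_cis:
  "((\<lambda>y. cis (of_int k * y)) has_integral (if k = 0 then 2 * of_real pi else 0)) {-pi..pi}"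
proof (cases "k = 0")
  case True
  show ?thesis
    using has_integral_const_real[of "1::complex" "-pi" pi] True by (simp add: scaleR_conv_of_real)
next
  case False
  define F where "F = (\<lambda>y. cis (of_int k * y) / (\<i> * of_int k))"
  have "((\<lambda>y. cis (of_int k * y)) has_integral (F pi - F (-pi))) {-pi..pi}"
    unfolding F_def
  proof (rule fundamental_theorem_of_calculus)
    fix y :: real
    have "((\<lambda>z. exp (\<i> * (of_int k * z)) / (\<i> * of_int k)) has_field_derivative exp (\<i> * (of_int k * of_real y)))
        (at (of_real y))"
    proof -
      have *: "- (\<i> * (X * \<i>)) = X" for X
        by (simp add: complex_eq_iff)
      show ?thesis
        using False by (auto intro!: derivative_eq_intros simp: *)
    qed
    from has_vector_derivative_real_field[OF this, of "{-pi..pi}"]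
    show "((\<lambda>y. cis (of_int k * y) / (\<i> * of_int k)) has_vector_derivative cis (of_int k * y))
        (at y within {-pi..pi})"
      by (simp add: cis_conv_exp)
  qed simp
  moreover have "cis (of_int k * pi) = cis (- (of_int k * pi))"
    using sin_zero_iff_int2[of "of_int k * pi"] by (auto simp: complex_eq_iff)
  ultimately show ?thesis using False by (simp add: F_def)
qed

text \<open>Cauchy's coefficient formula in Fourier form: on a circle inside the unit disc the
  series converges uniformly, so it may be integrated term by term, and orthogonality leaves one
  term.\<close>

lemma gf_has_integral:
  assumes "disc_summable f" "0 \<le> r" "r < 1"
  shows "((\<lambda>y. gf f (of_real r * cis y) * cis (- (real n * y))) has_integral
            of_real (2 * pi * (f n * r ^ n))) {-pi..pi}"
proof -
  let ?h = "\<lambda>i y. of_real (f i * r ^ i) * cis (of_int (int i - int n) * y)"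
  have eq: "?h i y = of_real (f i) * (of_real r * cis y) ^ i * cis (- (real n * y))" for i y
  proof -
    have "of_int (int i - int n) * y = real i * y + - (real n * y)"
      by (simp add: algebra_simps)
    then have "cis (of_int (int i - int n) * y) = cis (real i * y) * cis (- (real n * y))"
      by (simp only: cis_mult)
    then show ?thesis
      by (simp add: power_mult_distrib Complex.DeMoivre)
  qed
  have ul: "uniform_limit {-pi..pi} (\<lambda>N y. \<Sum>i<N. ?h i y) (\<lambda>y. \<Sum>i. ?h i y) sequentially"
    by (rule Weierstrass_m_test[where M = "\<lambda>i. \<bar>f i\<bar> * r ^ i"])
      (use assms in \<open>auto simp: norm_mult norm_power disc_summable_def\<close>)
  have lim: "(\<Sum>i. ?h i y) = gf f (of_real r * cis y) * cis (- (real n * y))" for y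
  proof -
    have "(\<lambda>i. of_real (f i) * (of_real r * cis y) ^ i) sums gf f (of_real r * cis y)"
      using assms by (intro gf_sums) (auto simp: norm_mult)
    from sums_mult2[OF this, of "cis (- (real n * y))"] show ?thesis
      unfolding eq by (simp add: sums_iff)
  qed
  obtain I J where IJ: "\<And>N. ((\<lambda>y. \<Sum>i<N. ?h i y) has_integral I N) {-pi..pi}"
      "((\<lambda>y. \<Sum>i. ?h i y) has_integral J) {-pi..pi}" "I \<longlonglongrightarrow> J"
    by (rule uniform_limit_integral[OF ul]) (auto intro!: continuous_intros simp: cis_conv_exp)
  have "((\<lambda>y. \<Sum>i<N. ?h i y) has_integral (\<Sum>i<N. of_real (f i * r ^ i) * (if int i - int n = 0 then 2 * of_real pi else 0))) {-pi..pi}" for N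
    by (intro has_integral_sum finite_lessThan has_integral_mult_right has_integral_cis)
  then have I: "I N = (\<Sum>i<N. of_real (f i * r ^ i) * (if int i - int n = 0 then 2 * of_real pi else 0))" for N
    using IJ(1) has_integral_unique by blast
  have "I N = of_real (2 * pi * (f n * r ^ n))" if "N > n" for N
  proof -
    have "I N = (\<Sum>i<N. if i = n then of_real (f i * r ^ i) * (2 * of_real pi) else 0)"
      unfolding I by (intro sum.cong) auto
    also have "\<dots> = of_real (2 * pi * (f n * r ^ n))"
      using that by (simp add: sum.delta)
    finally show ?thesis .
  qed
  then have "I \<longlonglongrightarrow> of_real (2 * pi * (f n * r ^ n))"
    by (intro tendsto_eventually) (auto simp: eventually_at_top_dense)
  then have "J = of_real (2 * pi * (f n * r ^ n))"
    using IJ(3) LIMSEQ_unique by blast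
  then show ?thesis using IJ(2) unfolding lim by simp
qed

text \<open>This step function bounds the integrands: level \<open>B\<close> everywhere accounts for
  the remote arc, the extra \<open>M\<close> for the central arc of half-width \<open>Y\<close>.
  Pointwise bounds then suffice in the next two lemmas.\<close>

lemma has_integral_bump:
  assumes "0 \<le> Y" "Y \<le> pi"
  shows "((\<lambda>y. B + (if \<bar>y\<bar> \<le> Y then M else 0)) has_integral (2 * pi * B + 2 * Y * M)) {-pi..pi::real}"
proof -
  have "((\<lambda>y. if y \<in> {-Y..Y} then M else 0) has_integral (2 * Y * M)) {-pi..pi}"
    using has_integral_const_real[of M "-Y" Y] assms
    by (subst has_integral_restrict) auto
  moreover have "(y \<in> {-Y..Y}) = (\<bar>y\<bar> \<le> Y)" for y by auto
  ultimately have "((\<lambda>y. if \<bar>y\<bar> \<le> Y then M else 0) has_integral (2 * Y * M)) {-pi..pi}"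
    by simp
  moreover have "((\<lambda>y. B) has_integral (2 * pi * B)) {-pi..pi}"
    using has_integral_const_real[of B "-pi" pi] by simp
  ultimately show ?thesis by (rule has_integral_add[rotated])
qed

text \<open>Coefficients of different index are compared at one common radius, so that the
  difference of the integrands can be bounded pointwise. The term \<open>Y * M / pi\<close> is the
  mass \<open>2 * Y * M\<close> of the step divided by \<open>2 * pi\<close>.\<close>

lemma coeff_diff_bound:
  assumes "disc_summable f" "disc_summable g" "0 \<le> r" "r < 1" "0 \<le> Y" "Y \<le> pi"
    and "\<And>y. \<bar>y\<bar> \<le> pi \<Longrightarrow> norm (of_real a * (gf f (of_real r * cis y) * cis (- (real m * y)))
       - of_real b * (gf g (of_real r * cis y) * cis (- (real n * y)))) \<le> B + (if \<bar>y\<bar> \<le> Y then M else 0)"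
  shows "\<bar>a * (f m * r ^ m) - b * (g n * r ^ n)\<bar> \<le> B + Y * M / pi"
proof -
  have 1: "((\<lambda>y. of_real a * (gf f (of_real r * cis y) * cis (- (real m * y)))
       - of_real b * (gf g (of_real r * cis y) * cis (- (real n * y)))) has_integral
       of_real a * of_real (2 * pi * (f m * r ^ m)) - of_real b * of_real (2 * pi * (g n * r ^ n))) {-pi..pi}"
    by (intro has_integral_diff has_integral_mult_right gf_has_integral assms)
  note 2 = has_integral_bump[OF assms(5,6), of B M]
  have "norm (of_real a * of_real (2 * pi * (f m * r ^ m)) - of_real b * of_real (2 * pi * (g n * r ^ n)) :: complex)
     \<le> 2 * pi * B + 2 * Y * M"
    unfolding integral_unique[OF 1, symmetric] integral_unique[OF 2, symmetric]
    by (rule integral_norm_bound_integral[OF has_integral_integrable[OF 1] has_integral_integrable[OF 2]])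
      (rule assms(7), auto)
  also have "of_real a * of_real (2 * pi * (f m * r ^ m)) - of_real b * of_real (2 * pi * (g n * r ^ n))
     = (of_real (2 * pi * (a * (f m * r ^ m) - b * (g n * r ^ n))) :: complex)"
    by (simp add: algebra_simps)
  finally have "2 * pi * \<bar>a * (f m * r ^ m) - b * (g n * r ^ n)\<bar> \<le> 2 * pi * B + 2 * Y * M"
    by (simp only: norm_of_real abs_mult) simp
  then show ?thesis by (simp add: field_simps)
qed

lemma coeff_lower_bound:
  assumes "disc_summable f" "0 \<le> r" "r < 1" "0 \<le> Y" "Y \<le> pi"
    and "\<And>y. \<bar>y\<bar> \<le> pi \<Longrightarrow> Re (gf f (of_real r * cis y) * cis (- (real n * y))) \<ge> B + (if \<bar>y\<bar> \<le> Y then M else 0)"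
  shows "f n * r ^ n \<ge> B + Y * M / pi"
proof -
  have 1: "((\<lambda>y. Re (gf f (of_real r * cis y) * cis (- (real n * y)))) has_integral
       2 * pi * (f n * r ^ n)) {-pi..pi}"
    using has_integral_Re[OF gf_has_integral[OF assms(1-3), of n]] by simp
  have "2 * pi * B + 2 * Y * M \<le> 2 * pi * (f n * r ^ n)"
    by (rule has_integral_le[OF has_integral_bump[OF assms(4,5), of B M] 1]) (rule assms(6), auto)
  then show ?thesis by (simp add: field_simps)
qed

section \<open>Exponentials of power series\<close>

lemma disc_summable_fps:
  assumes "disc_summable f"
  shows "fps_conv_radius (Abs_fps (\<lambda>n. of_real (f n) :: complex)) \<ge> 1"
  unfolding fps_conv_radius_def
proof (rule conv_radius_geI_ex)
  fix r :: real assume r: "0 < r" "ereal r < 1"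
  then show "\<exists>z. norm z = r \<and> summable (\<lambda>n. fps_nth (Abs_fps (\<lambda>n. complex_of_real (f n))) n * z ^ n)"
    using gf_sums[OF assms, of "of_real r :: complex"]
    by (intro exI[of _ "of_real r"]) (auto simp: sums_iff one_ereal_def)
qed

text \<open>The recurrence says \<open>x F'(x) = x C'(x) F(x)\<close> for the two generating functions.\<close>

lemma
  assumes c: "disc_summable c" "c 0 = 0" and p0: "p 0 = 1"
    and rec: "\<And>n. real (Suc n) * p (Suc n) = (\<Sum>i\<le>n. p i * (real (Suc (n - i)) * c (Suc (n - i))))"
  shows disc_summable_exp: "disc_summable p"
    and gf_exp: "norm (x::complex) < 1 \<Longrightarrow> gf p x = exp (gf c x)"
proof -
  define C where "C = Abs_fps (\<lambda>n. of_real (c n) :: complex)"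
  have radC: "fps_conv_radius C \<ge> 1" unfolding C_def by (rule disc_summable_fps[OF c(1)])
  have evC: "eval_fps C z = gf c z" for z
    by (simp add: C_def eval_fps_def gf_def)
  have C0: "fps_nth C 0 = 0" by (simp add: C_def c)
  have posC: "fps_conv_radius C > 0" using radC by (auto intro: less_le_trans[of 0 1])
  define G where "G = (\<lambda>z. exp (eval_fps C z))"
  define F where "F = fps_exp (1::complex) oo C"
  have hG: "G has_fps_expansion F"
    using has_fps_expansion_compose[OF has_fps_expansion_exp[of 1] eval_fps_has_fps_expansion[OF posC] C0]
    by (simp add: G_def F_def o_def)
  have hol: "G holomorphic_on eball 0 1"
  proof -
    have "ereal (norm z) < fps_conv_radius C" if "norm z < 1" for z :: complex
      by (rule less_le_trans[OF _ radC]) (use that in \<open>simp add: one_ereal_def\<close>)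
    then show ?thesis
      unfolding G_def by (intro holomorphic_intros) (auto simp: one_ereal_def)
  qed
  \<comment> \<open>\<open>F\<close> is a formal composition. As the Taylor series of a function
    holomorphic in the unit disc it has radius of convergence at least \<open>1\<close>.\<close>
  have F: "F = fps_expansion G 0"
    using hG fps_expansion_unique_complex has_fps_expansion_fps_expansion[OF _ _ hol] by force
  have radF: "fps_conv_radius F \<ge> 1" unfolding F by (rule conv_radius_fps_expansion[OF hol])
  have evF: "eval_fps F z = G z" if "norm z < 1" for z
    unfolding F using eval_fps_expansion'[OF hol, of z] that by (simp add: one_ereal_def)
  have derF: "fps_deriv F = F * fps_deriv C"
    unfolding F_def by (simp add: fps_compose_deriv[OF C0] fps_exp_deriv)
  \<comment> \<open>Comparing coefficients in \<open>fps_deriv F = F * fps_deriv C\<close> gives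
    exactly the recurrence \<open>rec\<close>, which determines each coefficient from the earlier
    ones.\<close>
  have Fp: "fps_nth F n = of_real (p n)" for n
  proof (induction n rule: less_induct)
    case (less n)
    show ?case
    proof (cases n)
      case 0
      then show ?thesis by (simp add: F_def fps_compose_nth_0 p0)
    next
      case (Suc m)
      have "of_nat (Suc m) * fps_nth F (Suc m) = fps_nth (fps_deriv F) m" by simp
      also have "\<dots> = (\<Sum>i\<le>m. fps_nth F i * (of_nat (Suc (m - i)) * of_real (c (Suc (m - i)))))"
        unfolding derF fps_mult_nth atMost_atLeast0[symmetric] by (simp add: C_def)
      also have "\<dots> = (\<Sum>i\<le>m. of_real (p i * (real (Suc (m - i)) * c (Suc (m - i)))))"
        by (intro sum.cong refl) (use Suc less in \<open>simp\<close>)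
      also have "\<dots> = of_real (real (Suc m) * p (Suc m))"
        unfolding rec by simp
      finally have "of_nat (Suc m) * fps_nth F (Suc m) = of_nat (Suc m) * complex_of_real (p (Suc m))"
        by simp
      then show ?thesis unfolding Suc by (simp del: of_nat_Suc)
    qed
  qed
  show ds: "disc_summable p"
    unfolding disc_summable_def
  proof (intro allI impI)
    fix r :: real assume r: "0 \<le> r" "r < 1"
    have "ereal r < fps_conv_radius F"
      by (rule less_le_trans[OF _ radF]) (use r in \<open>simp add: one_ereal_def\<close>)
    then have "summable (\<lambda>n. norm (fps_nth F n * complex_of_real r ^ n))"
      using r by (intro abs_summable_in_conv_radius) (auto simp: fps_conv_radius_def)
    then show "summable (\<lambda>n. \<bar>p n\<bar> * r ^ n)"
      using r by (simp add: Fp norm_mult norm_power)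
  qed
  show "gf p x = exp (gf c x)" if "norm x < 1"
    using evF[OF that] unfolding G_def evC by (simp add: eval_fps_def Fp gf_def)
qed

section \<open>Exponential sums with power growth\<close>

definition lap :: "(nat \<Rightarrow> real) \<Rightarrow> real \<Rightarrow> real" where
  "lap f t = gf f (exp (- t))"

lemma lap_sums:
  assumes "disc_summable f" "t > 0"
  shows "(\<lambda>n. f n * exp (- (real n * t))) sums lap f t"
proof -
  have "(\<lambda>n. f n * exp (- t) ^ n) sums lap f t"
    using gf_sums[OF assms(1), of "exp (- t)"] assms(2) by (simp add: lap_def)
  moreover have "exp (- t) ^ n = exp (- (real n * t))" for n
    by (simp add: exp_of_nat_mult[symmetric])
  ultimately show ?thesis by simp
qed

lemma disc_summableI:
  assumes "\<And>t. t > 0 \<Longrightarrow> summable (\<lambda>n. \<bar>f n\<bar> * exp (- (real n * t)))"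
  shows "disc_summable f"
  unfolding disc_summable_def
proof (intro allI impI)
  fix r :: real assume r: "0 \<le> r" "r < 1"
  show "summable (\<lambda>n. \<bar>f n\<bar> * r ^ n)"
  proof (cases "r = 0")
    case True
    then show ?thesis by simp
  next
    case False
    have "exp (- (real n * (- ln r))) = r ^ n" for n
    proof -
      have "exp (- (real n * (- ln r))) = exp (ln r) ^ n"
        by (simp add: exp_of_nat_mult[symmetric])
      then show ?thesis using r False by simp
    qed
    then show ?thesis
      using assms[of "- ln r"] r False by (simp add: ln_less_zero)
  qed
qed

lemma lap_nonneg:
  assumes "disc_summable f" "\<And>n. f n \<ge> 0" "t > 0"
  shows "lap f t \<ge> 0"
  unfolding lap_def using assms by (intro gf_nonneg) auto

text \<open>A single term of the series of \<open>exp (x / 2)\<close> gives the bound. Spending only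
  half of the decay of \<open>exp (- x)\<close> on the power leaves the other half for convergence,
  which is why moments at \<open>t\<close> are bounded by \<open>lap f (t / 2)\<close>
  below.\<close>

lemma power_le_exp_half:
  assumes "x \<ge> (0::real)"
  shows "x ^ k \<le> 2 ^ k * fact k * exp (x / 2)"
proof -
  have *: "(\<lambda>n. (x / 2) ^ n / fact n) sums exp (x / 2)"
    using exp_converges[of "x / 2"] by (simp only: real_scaleR_def divide_inverse_commute)
  have "(\<Sum>n\<in>{k}. (x / 2) ^ n / fact n) \<le> (\<Sum>n. (x / 2) ^ n / fact n)"
    by (rule sum_le_suminf) (use assms * in \<open>auto simp: sums_iff\<close>)
  then have "(x / 2) ^ k / fact k \<le> exp (x / 2)"
    using * by (simp add: sums_iff)
  then have "(x / 2) ^ k \<le> fact k * exp (x / 2)"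
    by (simp add: divide_le_eq mult.commute)
  then have "2 ^ k * (x / 2) ^ k \<le> 2 ^ k * (fact k * exp (x / 2))"
    by (intro mult_left_mono) auto
  then show ?thesis by (simp add: power_divide mult.assoc)
qed

lemma
  assumes "disc_summable f" "\<And>n. f n \<ge> 0"
  shows disc_summable_moment: "disc_summable (\<lambda>n. real n ^ k * f n)"
    and lap_moment_le: "t > 0 \<Longrightarrow> t ^ k * lap (\<lambda>n. real n ^ k * f n) t \<le> 2 ^ k * fact k * lap f (t / 2)"
proof -
  have tm: "t ^ k * (real n ^ k * f n * exp (- (real n * t))) \<le> 2 ^ k * fact k * (f n * exp (- (real n * (t / 2))))"
    if "t > 0" for n t
  proof -
    have "(real n * t) ^ k * exp (- (real n * t)) \<le> 2 ^ k * fact k * exp (real n * t / 2) * exp (- (real n * t))"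
      using power_le_exp_half[of "real n * t" k] that by (intro mult_right_mono) auto
    also have "\<dots> = 2 ^ k * fact k * exp (- (real n * (t / 2)))"
      by (simp add: mult.assoc exp_add[symmetric])
    finally have "f n * ((real n * t) ^ k * exp (- (real n * t))) \<le> f n * (2 ^ k * fact k * exp (- (real n * (t / 2))))"
      by (rule mult_left_mono[OF _ assms(2)])
    then show ?thesis by (simp add: power_mult_distrib algebra_simps)
  qed
  have sm: "summable (\<lambda>n. 2 ^ k * fact k * (f n * exp (- (real n * (t / 2)))))" if "t > 0" for t
    using lap_sums[OF assms(1), of "t / 2"] that by (intro summable_mult) (auto simp: sums_iff)
  show *: "disc_summable (\<lambda>n. real n ^ k * f n)"
  proof (rule disc_summableI)
    fix t :: real assume t: "t > 0"
    have "summable (\<lambda>n. t ^ k * (real n ^ k * f n * exp (- (real n * t))))"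
      by (rule summable_comparison_test'[OF sm[OF t]]) (use tm[OF t] assms(2) t in auto)
    then show "summable (\<lambda>n. \<bar>real n ^ k * f n\<bar> * exp (- (real n * t)))"
      using t assms(2) by (simp add: summable_cmult_iff abs_mult)
  qed
  show "t ^ k * lap (\<lambda>n. real n ^ k * f n) t \<le> 2 ^ k * fact k * lap f (t / 2)" if t: "t > 0"
  proof -
    have "t / 2 > 0" using t by simp
    note 1 = sums_mult[OF lap_sums[OF * t], of "t ^ k"]
      and 2 = sums_mult[OF lap_sums[OF assms(1) this], of "2 ^ k * fact k"]
    show ?thesis by (rule sums_le[OF _ 1 2]) (rule tm[OF t])
  qed
qed

section \<open>Trigonometric inequalities\<close>

lemma sin_ge_two_pi:
  assumes "0 \<le> x" "x \<le> pi / 2"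
  shows "2 / pi * x \<le> sin x"
proof -
  \<comment> \<open>Sine is concave on \<open>{0..pi}\<close>, so its graph lies above the chord
    from \<open>0\<close> to \<open>pi / 2\<close> (Jordan's inequality).\<close>
  have "convex_on {0..pi} (\<lambda>x. - sin x)"
    by (rule f''_ge0_imp_convex[where f' = "\<lambda>x. - cos x" and f'' = sin])
      (auto intro!: derivative_eq_intros sin_ge_zero)
  from convex_onD[OF this, of "2 / pi * x" 0 "pi / 2"]
  show ?thesis using assms by (simp add: field_simps)
qed

lemma one_minus_cos_eq: "1 - cos x = 2 * sin (x / 2) ^ 2" for x :: real
  using cos_double_sin[of "x / 2"] by simp

lemma one_minus_cos_ge:
  assumes "\<bar>x\<bar> \<le> pi"
  shows "2 / pi ^ 2 * x ^ 2 \<le> 1 - cos x"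
proof -
  have "2 / pi * (\<bar>x\<bar> / 2) \<le> sin (\<bar>x\<bar> / 2)"
    by (rule sin_ge_two_pi) (use assms in auto)
  then have "(2 / pi * (\<bar>x\<bar> / 2)) ^ 2 \<le> sin (\<bar>x\<bar> / 2) ^ 2"
    by (intro power_mono) auto
  moreover have "1 - cos x = 2 * sin (\<bar>x\<bar> / 2) ^ 2"
    using one_minus_cos_eq[of "\<bar>x\<bar>"] by simp
  ultimately show ?thesis by (simp add: power_mult_distrib power_divide)
qed

lemma one_minus_cos_le: "1 - cos x \<le> x ^ 2 / 2" for x :: real
proof -
  have "\<bar>sin (x / 2)\<bar> ^ 2 \<le> \<bar>x / 2\<bar> ^ 2"
    by (intro power_mono abs_sin_x_le_abs_x) auto
  then show ?thesis unfolding one_minus_cos_eq by (simp add: power_divide)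
qed

lemma abs_sin_minus_le: "\<bar>sin x - x\<bar> \<le> \<bar>x\<bar> ^ 3" for x :: real
proof -
  have "\<bar>sin x - x\<bar> \<le> inverse (fact 3) * \<bar>x\<bar> ^ 3"
    using Maclaurin_sin_bound[of x 3] by (simp add: sin_coeff_def numeral_3_eq_3)
  also have "\<dots> \<le> 1 * \<bar>x\<bar> ^ 3"
    by (intro mult_right_mono) (auto simp: fact_numeral)
  finally show ?thesis by simp
qed

abbreviation circ :: "real \<Rightarrow> real \<Rightarrow> complex" where
  "circ t y \<equiv> of_real (exp (- t)) * cis y"

lemma gf_Re_Im_sums:
  assumes "disc_summable f" "t > 0"
  shows "(\<lambda>n. f n * exp (- (real n * t)) * cos (real n * y)) sums Re (gf f (circ t y))"
    and "(\<lambda>n. f n * exp (- (real n * t)) * sin (real n * y)) sums Im (gf f (circ t y))"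
proof -
  have *: "(\<lambda>n. of_real (f n) * (circ t y) ^ n) sums gf f (circ t y)"
    using assms by (intro gf_sums) (auto simp: norm_mult)
  have eq: "of_real (f n) * (circ t y) ^ n
      = of_real (f n * exp (- (real n * t))) * cis (real n * y)" for n
  proof -
    have "(circ t y) ^ n = of_real (exp (- t) ^ n) * cis (real n * y)"
      by (simp only: power_mult_distrib Complex.DeMoivre of_real_power)
    also have "exp (- t) ^ n = exp (- (real n * t))"
      by (simp add: exp_of_nat_mult[symmetric])
    finally show ?thesis by simp
  qed
  show "(\<lambda>n. f n * exp (- (real n * t)) * cos (real n * y)) sums Re (gf f (circ t y))"
    using sums_Re[OF *] unfolding eq by simp
  show "(\<lambda>n. f n * exp (- (real n * t)) * sin (real n * y)) sums Im (gf f (circ t y))"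
    using sums_Im[OF *] unfolding eq by simp
qed

section \<open>Size and phase of a power series with power growth near 1\<close>

locale exp_growth =
  fixes c :: "nat \<Rightarrow> real" and \<mu> B :: real
  assumes c_nonneg: "\<And>v. c v \<ge> 0" and c_summable: "disc_summable c"
    and mu_pos: "\<mu> > 0" and B_pos: "B > 0"
    and lap_asymp: "((\<lambda>t. t powr \<mu> * lap c t) \<longlongrightarrow> B) (at_right 0)"
begin

lemma lap_bounds: "eventually (\<lambda>t. B / 2 * t powr (-\<mu>) \<le> lap c t \<and> lap c t \<le> 2 * B * t powr (-\<mu>)) (at_right 0)"
proof -
  have "eventually (\<lambda>t. B / 2 < t powr \<mu> * lap c t) (at_right 0)"
    by (rule order_tendstoD(1)[OF lap_asymp]) (use B_pos in simp)
  moreover have "eventually (\<lambda>t. t powr \<mu> * lap c t < 2 * B) (at_right 0)"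
    by (rule order_tendstoD(2)[OF lap_asymp]) (use B_pos in simp)
  moreover have "eventually (\<lambda>t::real. t > 0) (at_right 0)"
    by (simp add: eventually_at_right_less)
  ultimately show ?thesis
    by eventually_elim (auto simp: powr_minus field_simps)
qed

lemma lap_bounds_ex:
  "\<exists>t0>0. \<forall>t. 0 < t \<and> t \<le> t0 \<longrightarrow> B / 2 * t powr (-\<mu>) \<le> lap c t \<and> lap c t \<le> 2 * B * t powr (-\<mu>)"
proof -
  obtain b where b: "b > 0" "\<forall>t. 0 < t \<longrightarrow> t < b \<longrightarrow> B / 2 * t powr (-\<mu>) \<le> lap c t \<and> lap c t \<le> 2 * B * t powr (-\<mu>)"
    using lap_bounds unfolding eventually_at_right_field by auto
  then show ?thesis by (intro exI[of _ "b / 2"]) auto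
qed

lemma moment_bound:
  "\<exists>K>0. eventually (\<lambda>t. lap (\<lambda>n. real n ^ k * c n) t \<le> K * t powr (- \<mu> - real k)) (at_right 0)"
proof -
  obtain t0 where t0_pos: "t0 > 0" and t0_bd: "\<forall>t. 0 < t \<and> t \<le> t0 \<longrightarrow>
      B / 2 * t powr (-\<mu>) \<le> lap c t \<and> lap c t \<le> 2 * B * t powr (-\<mu>)"
    using lap_bounds_ex by blast
  have t0: "t0 > 0"
    "\<And>t. 0 < t \<Longrightarrow> t \<le> t0 \<Longrightarrow> B / 2 * t powr (-\<mu>) \<le> lap c t"
    "\<And>t. 0 < t \<Longrightarrow> t \<le> t0 \<Longrightarrow> lap c t \<le> 2 * B * t powr (-\<mu>)"
    using t0_pos t0_bd by auto
  define K where "K = 2 ^ k * fact k * 2 * B * 2 powr \<mu>"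
  have "lap (\<lambda>n. real n ^ k * c n) t \<le> K * t powr (- \<mu> - real k)" if t: "0 < t" "t < t0" for t
  proof -
    have "t ^ k * lap (\<lambda>n. real n ^ k * c n) t \<le> 2 ^ k * fact k * lap c (t / 2)"
      by (rule lap_moment_le[OF c_summable c_nonneg t(1)])
    also have "\<dots> \<le> 2 ^ k * fact k * (2 * B * (t / 2) powr (-\<mu>))"
      using t by (intro mult_left_mono t0) auto
    also have "\<dots> = K * t powr (- \<mu>)"
      using t by (simp add: K_def powr_divide powr_minus field_simps)
    finally show ?thesis
      using t by (simp add: powr_diff powr_realpow field_simps)
  qed
  moreover have "K > 0" using B_pos by (simp add: K_def)
  ultimately show ?thesis
    using t0(1) unfolding eventually_at_right_field by blast
qed

text \<open>The limit is the logarithm of the factor by which the modulus of the exponential of the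
  series drops when the point leaves the positive axis. Each term is nonnegative, so bounds can be
  found index by index.\<close>

lemma decay_sums:
  assumes "t > 0"
  shows "(\<lambda>n. c n * exp (- (real n * t)) * (1 - cos (real n * y))) sums
     (lap c t - Re (gf c (circ t y)))"
  using sums_diff[OF lap_sums[OF c_summable assms] gf_Re_Im_sums(1)[OF c_summable assms, of y]]
  by (simp add: algebra_simps)

lemma decay_nonneg:
  assumes "t > 0"
  shows "lap c t - Re (gf c (circ t y)) \<ge> 0"
  by (rule sums_le[OF _ sums_zero decay_sums[OF assms]]) (simp add: c_nonneg)

lemma decay_upper:
  assumes "t > 0"
  shows "lap c t - Re (gf c (circ t y)) \<le> y ^ 2 / 2 * lap (\<lambda>n. real n ^ 2 * c n) t"
proof (rule sums_le[OF _ decay_sums[OF assms] sums_mult[OF lap_sums[OF disc_summable_moment[OF c_summable c_nonneg] assms]]])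
  fix n
  have "c n * exp (- (real n * t)) * (1 - cos (real n * y)) \<le> c n * exp (- (real n * t)) * ((real n * y) ^ 2 / 2)"
    by (intro mult_left_mono one_minus_cos_le) (simp add: c_nonneg)
  then show "c n * exp (- (real n * t)) * (1 - cos (real n * y)) \<le> y ^ 2 / 2 * ((real n)\<^sup>2 * c n * exp (- (real n * t)))"
    by (simp add: power_mult_distrib algebra_simps)
qed

text \<open>The linear part of the phase is split off because the choice of the saddle point cancels
  it against the phase of the \<open>n\<close>-th power; what remains is governed by the third
  moment.\<close>

lemma phase_bound:
  assumes "t > 0"
  shows "\<bar>Im (gf c (circ t y)) - y * lap (\<lambda>n. real n * c n) t\<bar>
     \<le> \<bar>y\<bar> ^ 3 * lap (\<lambda>n. real n ^ 3 * c n) t"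
proof -
  have 1: "(\<lambda>n. c n * exp (- (real n * t)) * (sin (real n * y) - real n * y)) sums
      (Im (gf c (circ t y)) - y * lap (\<lambda>n. real n * c n) t)"
    using sums_diff[OF gf_Re_Im_sums(2)[OF c_summable assms, of y]
        sums_mult[OF lap_sums[OF disc_summable_moment[OF c_summable c_nonneg, of 1] assms], of y]]
    by (simp add: algebra_simps)
  note 2 = sums_mult[OF lap_sums[OF disc_summable_moment[OF c_summable c_nonneg, of 3] assms], of "\<bar>y\<bar> ^ 3"]
  have le: "norm (c n * exp (- (real n * t)) * (sin (real n * y) - real n * y))
     \<le> \<bar>y\<bar> ^ 3 * (real n ^ 3 * c n * exp (- (real n * t)))" for n
  proof -
    have "c n * exp (- (real n * t)) * \<bar>sin (real n * y) - real n * y\<bar> \<le> c n * exp (- (real n * t)) * \<bar>real n * y\<bar> ^ 3"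
      by (intro mult_left_mono abs_sin_minus_le) (simp add: c_nonneg)
    then show ?thesis
      unfolding real_norm_def abs_mult power_mult_distrib abs_exp_cancel using c_nonneg[of n]
      by (simp add: mult_ac)
  qed
  have "norm (\<Sum>n. c n * exp (- (real n * t)) * (sin (real n * y) - real n * y))
      \<le> (\<Sum>n. \<bar>y\<bar> ^ 3 * (real n ^ 3 * c n * exp (- (real n * t))))"
    by (rule norm_suminf_le[OF le sums_summable[OF 2]])
  then show ?thesis using 1 2 by (simp add: sums_iff)
qed

text \<open>
  With \<open>s\<close> the larger of \<open>t\<close> and \<open>\<bar>y\<bar>\<close>, only the indices of order \<open>1 / s\<close> are used; they
  carry a positive proportion of \<open>lap c s\<close>.
\<close>

lemma decay_lower:
  "\<exists>\<kappa>>0. \<exists>s0>0. \<forall>t y s. 0 < t \<and> t \<le> s \<and> \<bar>y\<bar> \<le> s \<and> s \<le> s0 \<longrightarrow>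
       \<kappa> * s powr (-\<mu>) * (y / s) ^ 2 \<le> lap c t - Re (gf c (circ t y))"
proof -
  obtain t0 where t0_pos: "t0 > 0" and t0_bd: "\<forall>t. 0 < t \<and> t \<le> t0 \<longrightarrow>
      B / 2 * t powr (-\<mu>) \<le> lap c t \<and> lap c t \<le> 2 * B * t powr (-\<mu>)"
    using lap_bounds_ex by blast
  have t0: "t0 > 0"
    "\<And>t. 0 < t \<Longrightarrow> t \<le> t0 \<Longrightarrow> B / 2 * t powr (-\<mu>) \<le> lap c t"
    "\<And>t. 0 < t \<Longrightarrow> t \<le> t0 \<Longrightarrow> lap c t \<le> 2 * B * t powr (-\<mu>)"
    using t0_pos t0_bd by auto
  \<comment> \<open>The constants \<open>\<delta>\<close> and \<open>K\<close> cut off the indices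
    with \<open>n * u < \<delta>\<close> and \<open>n * u > K\<close>. Each tail may cost an eighth
    of \<open>B * u powr (-\<mu>)\<close>; since \<open>lap c u\<close> is at least
    \<open>B / 2\<close> times the power, a quarter is left over.\<close>
  define \<delta> :: real where "\<delta> = (1 / (16 * exp 1)) powr (1 / \<mu>)"
  have "1 \<le> 16 * exp (1::real)" using exp_ge_add_one_self[of 1] by linarith
  then have "1 / (16 * exp 1) \<le> (1::real)" by (simp add: field_simps)
  then have \<delta>: "0 < \<delta>" "\<delta> \<le> 1" "2 * exp 1 * \<delta> powr \<mu> \<le> 1 / 8"
    using mu_pos by (auto simp: \<delta>_def powr_powr intro!: powr_le1)
  define K where "K = 2 * ln (32 * 2 powr \<mu>)"
  have "exp (- K / 2) = 1 / (32 * 2 powr \<mu>)"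
    by (simp add: K_def exp_minus field_simps)
  moreover have "K \<ge> 1"
  proof -
    have "exp (1 / 2) \<le> exp (1::real)" by simp
    also have "\<dots> \<le> 32 * 1" using exp_le by simp
    also have "\<dots> \<le> 32 * 2 powr \<mu>" using mu_pos by (intro mult_left_mono ge_one_powr_ge_zero) auto
    finally have "1 / 2 \<le> ln (32 * 2 powr \<mu>)" by (subst ln_ge_iff) auto
    then show ?thesis by (simp add: K_def)
  qed
  ultimately have K: "K \<ge> 1" "2 * 2 powr \<mu> * exp (- K / 2) < 1 / 8"
    by auto
  define \<kappa>1 where "\<kappa>1 = 2 / pi ^ 2 * (\<delta> / K) ^ 2"
  define \<kappa> where "\<kappa> = \<kappa>1 * (B / 4 * K powr (-\<mu>))"
  have \<kappa>1: "\<kappa>1 > 0" using \<delta> K by (simp add: \<kappa>1_def)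
  have main: "\<kappa> * s powr (-\<mu>) * (y / s) ^ 2 \<le> lap c t - Re (gf c (circ t y))"
    if ty: "0 < t" "t \<le> s" "\<bar>y\<bar> \<le> s" "s \<le> t0 * \<delta> / K" for t y s
  proof -
    have s: "s > 0" using ty by simp
    \<comment> \<open>With this scale the retained indices satisfy \<open>n * s \<le> 1\<close>,
      hence \<open>\<bar>n * y\<bar> \<le> 1\<close>, where the quadratic lower bound for
      \<open>1 - cos\<close> is available; and \<open>u \<ge> t\<close> allows
      \<open>exp (- (n * t))\<close> to be bounded below by \<open>exp (- (n * u))\<close>.\<close>
    define u where "u = K * s"
    have u: "u > 0" "u \<le> t0 * \<delta>" "s \<le> u" using s K ty by (auto simp: u_def field_simps)
    have u1: "u / \<delta> \<le> t0" using u(2) \<delta> by (simp add: field_simps)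
    have "t0 * \<delta> \<le> t0 * 1" using \<delta> t0(1) by (intro mult_left_mono) auto
    with u1 u(2) have u': "u / \<delta> \<le> t0" "u \<le> t0" by auto
    \<comment> \<open>The truncation is done by subtraction, so that only values of
      \<open>lap c\<close> occur: for \<open>n * u < \<delta>\<close> the term at
      \<open>u / \<delta>\<close>, and for \<open>n * u > K\<close> the term at
      \<open>u / 2\<close>, outweighs \<open>exp (- (n * u))\<close>, and the left side is not
      positive there.\<close>
    have le: "\<kappa>1 * (y / s) ^ 2 * (c n * exp (- (real n * u)) - exp 1 * (c n * exp (- (real n * (u / \<delta>))))
        - exp (- K / 2) * (c n * exp (- (real n * (u / 2)))))
        \<le> c n * exp (- (real n * t)) * (1 - cos (real n * y))" (is "?l * (c n * ?a - exp 1 * (c n * ?b) - ?e * (c n * ?d)) \<le> ?r") for n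
    proof -
      have l: "?l \<ge> 0" using \<kappa>1 by simp
      have r: "?r \<ge> 0" by (simp add: c_nonneg)
      have eq: "?l * (c n * ?a - exp 1 * (c n * ?b) - ?e * (c n * ?d)) = (?l * c n) * (?a - exp 1 * ?b - ?e * ?d)"
        by (simp add: algebra_simps)
      consider "real n * u < \<delta>" | "real n * u > K" | "\<delta> \<le> real n * u" "real n * u \<le> K" by linarith
      then show ?thesis
      proof cases
        case 1
        have "?a \<le> exp 1 * ?b"
          unfolding exp_add[symmetric]
        proof -
          have "real n * (u / \<delta>) \<le> 1" using 1 \<delta> by (simp add: field_simps)
          moreover have "0 \<le> real n * u" using u by simp
          ultimately show "exp (- (real n * u)) \<le> exp (1 + - (real n * (u / \<delta>)))" by simp
        qed
        then have "?a - exp 1 * ?b - ?e * ?d \<le> 0" using exp_ge_zero[of "- K / 2"]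
          by (smt (verit) exp_ge_zero mult_nonneg_nonneg)
        then show ?thesis unfolding eq using l r c_nonneg[of n]
          by (meson mult_nonneg_nonneg mult_nonneg_nonpos order_trans)
      next
        case 2
        have "?a \<le> ?e * ?d"
          unfolding exp_add[symmetric] using 2 by (simp add: field_simps)
        then have "?a - exp 1 * ?b - ?e * ?d \<le> 0"
          by (smt (verit) exp_ge_zero mult_nonneg_nonneg)
        then show ?thesis unfolding eq using l r c_nonneg[of n]
          by (meson mult_nonneg_nonneg mult_nonneg_nonpos order_trans)
      next
        case 3
        have ns: "real n * s \<le> 1" "\<delta> / K \<le> real n * s"
          using 3 K by (auto simp: u_def field_simps)
        have "real n * \<bar>y\<bar> \<le> real n * s" using ty by (intro mult_left_mono) auto
        then have ny: "\<bar>real n * y\<bar> \<le> pi" using ns pi_gt3 by (simp add: abs_mult)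
        have "?l = 2 / pi ^ 2 * ((\<delta> / K) ^ 2 * (y / s) ^ 2)" by (simp add: \<kappa>1_def)
        also have "\<dots> \<le> 2 / pi ^ 2 * ((real n * s) ^ 2 * (y / s) ^ 2)"
          using ns \<delta> K by (intro mult_left_mono mult_right_mono power_mono) auto
        also have "\<dots> = 2 / pi ^ 2 * (real n * y) ^ 2"
          using s by (simp add: power_mult_distrib power_divide)
        also have "\<dots> \<le> 1 - cos (real n * y)" by (rule one_minus_cos_ge[OF ny])
        finally have l': "?l \<le> 1 - cos (real n * y)" .
        have "?a - exp 1 * ?b - ?e * ?d \<le> ?a"
          by (smt (verit) exp_ge_zero mult_nonneg_nonneg)
        also have "\<dots> \<le> exp (- (real n * t))"
          using ty u by (auto intro!: mult_left_mono)
        finally have "(?l * c n) * (?a - exp 1 * ?b - ?e * ?d) \<le> (?l * c n) * exp (- (real n * t))"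
          using l c_nonneg by (intro mult_left_mono) auto
        also have "\<dots> \<le> ((1 - cos (real n * y)) * c n) * exp (- (real n * t))"
          using l' c_nonneg by (intro mult_right_mono) auto
        finally show ?thesis unfolding eq by (simp add: algebra_simps)
      qed
    qed
    have "\<kappa>1 * (y / s) ^ 2 * (lap c u - exp 1 * lap c (u / \<delta>) - exp (- K / 2) * lap c (u / 2))
       \<le> lap c t - Re (gf c (circ t y))"
      by (rule sums_le[OF le _ decay_sums[OF ty(1)]], intro sums_mult sums_diff lap_sums c_summable)
        (use u \<delta> in auto)
    moreover have "lap c u - exp 1 * lap c (u / \<delta>) - exp (- K / 2) * lap c (u / 2) \<ge> B / 4 * u powr (-\<mu>)"
    proof -
      have "exp 1 * lap c (u / \<delta>) \<le> exp 1 * (2 * B * (u / \<delta>) powr (-\<mu>))"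
        using u u' \<delta> by (intro mult_left_mono t0) auto
      also have "\<dots> = 2 * exp 1 * \<delta> powr \<mu> * (B * u powr (-\<mu>))"
        using u \<delta> by (simp add: powr_divide powr_minus field_simps)
      also have "\<dots> \<le> 1 / 8 * (B * u powr (-\<mu>))"
        using \<delta> B_pos by (intro mult_right_mono) auto
      finally have 1: "exp 1 * lap c (u / \<delta>) \<le> 1 / 8 * (B * u powr (-\<mu>))" .
      have "exp (- K / 2) * lap c (u / 2) \<le> exp (- K / 2) * (2 * B * (u / 2) powr (-\<mu>))"
        using u u' by (intro mult_left_mono t0) auto
      also have "\<dots> = 2 * 2 powr \<mu> * exp (- K / 2) * (B * u powr (-\<mu>))"
        using u by (simp add: powr_divide powr_minus field_simps)
      also have "\<dots> \<le> 1 / 8 * (B * u powr (-\<mu>))"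
        using K B_pos by (intro mult_right_mono) auto
      finally have 2: "exp (- K / 2) * lap c (u / 2) \<le> 1 / 8 * (B * u powr (-\<mu>))" .
      have "B / 2 * u powr (-\<mu>) \<le> lap c u" using u u' by (intro t0) auto
      with 1 2 show ?thesis by (simp add: algebra_simps)
    qed
    then have "\<kappa>1 * (y / s) ^ 2 * (B / 4 * u powr (-\<mu>)) \<le>
       \<kappa>1 * (y / s) ^ 2 * (lap c u - exp 1 * lap c (u / \<delta>) - exp (- K / 2) * lap c (u / 2))"
      using \<kappa>1 by (intro mult_left_mono) auto
    moreover have "\<kappa>1 * (y / s) ^ 2 * (B / 4 * u powr (-\<mu>)) = \<kappa> * s powr (-\<mu>) * (y / s) ^ 2"
      using s K by (simp add: u_def \<kappa>_def powr_mult)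
    ultimately show "\<kappa> * s powr (-\<mu>) * (y / s) ^ 2 \<le> lap c t - Re (gf c (circ t y))"
      by linarith
  qed
  have "\<kappa> > 0" "t0 * \<delta> / K > 0"
    using \<kappa>1 K B_pos t0 \<delta> by (auto simp: \<kappa>_def)
  with main show ?thesis by blast
qed

end

section \<open>Tauberian descent from partial sums\<close>

lemma at_right_0_pos: "eventually (\<lambda>t::real. 0 < t) (at_right 0)"
  by (rule eventually_at_right_less)

text \<open>A squeeze with an auxiliary step \<open>h\<close>: for fixed \<open>h\<close> the bounds
  converge to \<open>u h\<close> and \<open>l h\<close>, and only afterwards does \<open>h\<close>
  tend to \<open>0\<close>. No uniformity in \<open>h\<close> is asked of the functions
  \<open>U\<close>.\<close>

lemma tendsto_squeeze_family:
  fixes f :: "'a \<Rightarrow> real" and u l :: "real \<Rightarrow> real"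
  assumes up: "eventually (\<lambda>h. \<exists>U. eventually (\<lambda>x. f x \<le> U x) F \<and> (U \<longlongrightarrow> u h) F) (at_right 0)"
    and lo: "eventually (\<lambda>h. \<exists>U. eventually (\<lambda>x. U x \<le> f x) F \<and> (U \<longlongrightarrow> l h) F) (at_right 0)"
    and u: "(u \<longlongrightarrow> L) (at_right 0)" and l: "(l \<longlongrightarrow> L) (at_right 0)"
  shows "(f \<longlongrightarrow> L) F"
proof (rule order_tendstoI)
  fix a assume "a < L"
  then have "eventually (\<lambda>h. a < l h \<and> (\<exists>U. eventually (\<lambda>x. U x \<le> f x) F \<and> (U \<longlongrightarrow> l h) F)) (at_right 0)"
    using lo order_tendstoD(1)[OF l] by (auto intro: eventually_conj)
  from eventually_happens'[OF trivial_limit_at_right_real this]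
  obtain h U where hU: "a < l h" "eventually (\<lambda>x. U x \<le> f x) F" "(U \<longlongrightarrow> l h) F"
    by blast
  from order_tendstoD(1)[OF hU(3,1)] hU(2) show "eventually (\<lambda>x. a < f x) F"
    by eventually_elim auto
next
  fix a assume "L < a"
  then have "eventually (\<lambda>h. u h < a \<and> (\<exists>U. eventually (\<lambda>x. f x \<le> U x) F \<and> (U \<longlongrightarrow> u h) F)) (at_right 0)"
    using up order_tendstoD(2)[OF u] by (auto intro: eventually_conj)
  from eventually_happens'[OF trivial_limit_at_right_real this]
  obtain h U where hU: "u h < a" "eventually (\<lambda>x. f x \<le> U x) F" "(U \<longlongrightarrow> u h) F"
    by blast
  from order_tendstoD(2)[OF hU(3,1)] hU(2) show "eventually (\<lambda>x. f x < a) F"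
    by eventually_elim auto
qed

lemma has_derivative_quotient_right:
  fixes f :: "real \<Rightarrow> real"
  assumes "(f has_real_derivative D) (at a)"
  shows "((\<lambda>h. (f (a + h) - f a) / h) \<longlongrightarrow> D) (at_right 0)"
    and "((\<lambda>h. (f a - f (a - h)) / h) \<longlongrightarrow> D) (at_right 0)"
proof -
  have *: "((\<lambda>h. (f (a + h) - f a) / h) \<longlongrightarrow> D) (at 0)"
    using assms by (simp add: DERIV_def)
  then show "((\<lambda>h. (f (a + h) - f a) / h) \<longlongrightarrow> D) (at_right 0)"
    by (rule tendsto_mono[rotated]) (rule at_le, simp)
  have "((\<lambda>h. (f (a + (- h)) - f a) / (- h)) \<longlongrightarrow> D) (at_right 0)"
    by (rule filterlim_compose[OF *]) (auto simp: filterlim_at eventually_at_right_field intro!: tendsto_eq_intros exI[of _ 1])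
  then show "((\<lambda>h. (f a - f (a - h)) / h) \<longlongrightarrow> D) (at_right 0)"
    by (rule Lim_transform_eventually) (auto simp: divide_simps)
qed

lemma lap_continuous:
  assumes "disc_summable f"
  shows "continuous_on {0<..} (lap f)"
proof (rule continuous_at_imp_continuous_on, rule ballI)
  fix t :: real assume "t \<in> {0<..}"
  then have t: "t > 0" by simp
  have "isCont (\<lambda>x. \<Sum>n. f n * x ^ n) (exp (- t))"
  proof (rule isCont_powser)
    have "exp (- (t / 2)) < 1" using t by simp
    then show "summable (\<lambda>n. f n * exp (- (t / 2)) ^ n)"
      using gf_sums[OF assms, of "exp (- (t / 2))"] by (simp add: sums_iff)
    show "norm (exp (- t)) < norm (exp (- (t / 2)))" using t by simp
  qed
  then have "isCont (\<lambda>t. \<Sum>n. f n * exp (- t) ^ n) t"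
    by (rule isCont_o2[rotated]) (auto intro!: continuous_intros)
  then show "isCont (lap f) t" by (simp add: lap_def[abs_def] gf_def)
qed

lemma lap_antimono:
  assumes "disc_summable f" "\<And>n. f n \<ge> 0" "0 < s" "s \<le> t"
  shows "lap f t \<le> lap f s"
  by (rule sums_le[OF _ lap_sums[OF assms(1)] lap_sums[OF assms(1)]])
    (use assms in \<open>auto intro!: mult_left_mono\<close>)

text \<open>Termwise \<open>1 + x \<le> exp x\<close>: each \<open>exp (- (n * t))\<close> is convex
  in \<open>t\<close>, so the slope of a chord lies between the slopes at its ends.\<close>

lemma lap_convex:
  assumes "disc_summable f" "\<And>n. f n \<ge> 0" "0 < s" "s < t"
  shows "(t - s) * lap (\<lambda>n. real n * f n) t \<le> lap f s - lap f t"
    and "lap f s - lap f t \<le> (t - s) * lap (\<lambda>n. real n * f n) s"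
proof -
  have t: "t > 0" using assms by simp
  have d: "disc_summable (\<lambda>n. real n * f n)"
    using disc_summable_moment[OF assms(1,2), of 1] by simp
  note df = sums_diff[OF lap_sums[OF assms(1,3)] lap_sums[OF assms(1) t]]
  show "(t - s) * lap (\<lambda>n. real n * f n) t \<le> lap f s - lap f t"
  proof (rule sums_le[OF _ sums_mult[OF lap_sums[OF d t]] df])
    fix n
    have "exp (- (real n * t)) * (1 + real n * (t - s)) \<le> exp (- (real n * t)) * exp (real n * (t - s))"
      by (intro mult_left_mono exp_ge_add_one_self) auto
    also have "\<dots> = exp (- (real n * s))" by (simp add: exp_add[symmetric] algebra_simps)
    finally have "f n * (exp (- (real n * t)) * (1 + real n * (t - s))) \<le> f n * exp (- (real n * s))"
      by (rule mult_left_mono[OF _ assms(2)])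
    then show "(t - s) * (real n * f n * exp (- (real n * t))) \<le> f n * exp (- (real n * s)) - f n * exp (- (real n * t))"
      by (simp add: algebra_simps)
  qed
  show "lap f s - lap f t \<le> (t - s) * lap (\<lambda>n. real n * f n) s"
  proof (rule sums_le[OF _ df sums_mult[OF lap_sums[OF d assms(3)]]])
    fix n
    have "exp (- (real n * s)) * (1 + - (real n * (t - s))) \<le> exp (- (real n * s)) * exp (- (real n * (t - s)))"
      by (intro mult_left_mono exp_ge_add_one_self) auto
    also have "\<dots> = exp (- (real n * t))" by (simp add: exp_add[symmetric] algebra_simps)
    finally have "f n * (exp (- (real n * s)) * (1 + - (real n * (t - s)))) \<le> f n * exp (- (real n * t))"
      by (rule mult_left_mono[OF _ assms(2)])
    then show "f n * exp (- (real n * s)) - f n * exp (- (real n * t)) \<le> (t - s) * (real n * f n * exp (- (real n * s)))"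
      by (simp add: algebra_simps)
  qed
qed

lemma filterlim_mult_at_right_0:
  assumes "(k::real) > 0"
  shows "filterlim (\<lambda>t. k * t) (at_right 0) (at_right 0)"
  unfolding filterlim_at using assms
  by (auto intro!: tendsto_eq_intros simp: eventually_at_right_field intro: exI[of _ 1])

lemma (in exp_growth) lap_asymp_scale:
  assumes "k > 0"
  shows "((\<lambda>t. t powr \<mu> * lap c (k * t)) \<longlongrightarrow> B * k powr (-\<mu>)) (at_right 0)"
proof -
  have "((\<lambda>t. (k * t) powr \<mu> * lap c (k * t)) \<longlongrightarrow> B) (at_right 0)"
    by (rule filterlim_compose[OF lap_asymp filterlim_mult_at_right_0[OF assms]])
  then have "((\<lambda>t. (k * t) powr \<mu> * lap c (k * t) * k powr (-\<mu>)) \<longlongrightarrow> B * k powr (-\<mu>)) (at_right 0)"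
    by (intro tendsto_intros)
  then show ?thesis
    by (rule Lim_transform_eventually)
      (use assms in \<open>auto simp: eventually_at_right_field powr_mult powr_minus field_simps intro!: exI[of _ 1]\<close>)
qed

text \<open>Asymptotics cannot be differentiated in general, but here convexity traps the derivative
  between the difference quotients of \<open>lap c\<close> from \<open>(1 - h) * t\<close> to
  \<open>t\<close> and from \<open>t\<close> to \<open>(1 + h) * t\<close>, whose limits are
  known.\<close>

lemma (in exp_growth) lap_deriv_asymp:
  "((\<lambda>t. t powr (\<mu> + 1) * lap (\<lambda>n. real n * c n) t) \<longlongrightarrow> \<mu> * B) (at_right 0)"
proof -
  have pos: "eventually (\<lambda>t::real. t > 0) (at_right 0)"
    by (simp add: eventually_at_right_less)
  have small: "eventually (\<lambda>h::real. 0 < h \<and> h < 1) (at_right 0)"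
    by (auto simp: eventually_at_right_field intro!: exI[of _ 1])
  \<comment> \<open>\<open>f x\<close> is the limit of
    \<open>- (t powr \<mu> * lap c (x * t))\<close>; its derivative at \<open>1\<close> is the
    claimed limit.\<close>
  define f where "f = (\<lambda>x::real. - (B * x powr (-\<mu>)))"
  have df: "(f has_real_derivative \<mu> * B) (at 1)"
    unfolding f_def by (auto intro!: derivative_eq_intros)
  show ?thesis
  proof (rule tendsto_squeeze_family[OF _ _ has_derivative_quotient_right(2,1)[OF df]])
    show "eventually (\<lambda>h. \<exists>U. eventually (\<lambda>t. t powr (\<mu> + 1) * lap (\<lambda>n. real n * c n) t \<le> U t) (at_right 0) \<and>
        (U \<longlongrightarrow> (f 1 - f (1 - h)) / h) (at_right 0)) (at_right 0)"
      using small
    proof eventually_elim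
      case (elim h)
      define U where "U = (\<lambda>t. (t powr \<mu> * lap c ((1 - h) * t) - t powr \<mu> * lap c (1 * t)) / h)"
      have "(U \<longlongrightarrow> (B * (1 - h) powr (-\<mu>) - B * 1 powr (-\<mu>)) / h) (at_right 0)"
        unfolding U_def using elim by (intro tendsto_intros lap_asymp_scale) auto
      moreover have "eventually (\<lambda>t. t powr (\<mu> + 1) * lap (\<lambda>n. real n * c n) t \<le> U t) (at_right 0)"
        using pos
      proof eventually_elim
        case t: (elim t)
        have "(1 - h) * t < 1 * t" using t elim by (intro mult_strict_right_mono) auto
        then have "(t - (1 - h) * t) * lap (\<lambda>n. real n * c n) t \<le> lap c ((1 - h) * t) - lap c t"
          using t elim by (intro lap_convex c_summable c_nonneg) auto
        then have "t powr \<mu> * ((h * t) * lap (\<lambda>n. real n * c n) t) \<le> t powr \<mu> * (lap c ((1 - h) * t) - lap c t)"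
          by (intro mult_left_mono) (auto simp: algebra_simps)
        then show ?case using t elim by (simp add: U_def powr_add field_simps)
      qed
      ultimately show ?case by (intro exI[of _ U]) (auto simp: f_def)
    qed
    show "eventually (\<lambda>h. \<exists>U. eventually (\<lambda>t. U t \<le> t powr (\<mu> + 1) * lap (\<lambda>n. real n * c n) t) (at_right 0) \<and>
        (U \<longlongrightarrow> (f (1 + h) - f 1) / h) (at_right 0)) (at_right 0)"
      using small
    proof eventually_elim
      case (elim h)
      define U where "U = (\<lambda>t. (t powr \<mu> * lap c (1 * t) - t powr \<mu> * lap c ((1 + h) * t)) / h)"
      have "(U \<longlongrightarrow> (B * 1 powr (-\<mu>) - B * (1 + h) powr (-\<mu>)) / h) (at_right 0)"
        unfolding U_def using elim by (intro tendsto_intros lap_asymp_scale) auto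
      moreover have "eventually (\<lambda>t. U t \<le> t powr (\<mu> + 1) * lap (\<lambda>n. real n * c n) t) (at_right 0)"
        using pos
      proof eventually_elim
        case t: (elim t)
        have "1 * t < (1 + h) * t" using t elim by (intro mult_strict_right_mono) auto
        then have "lap c t - lap c ((1 + h) * t) \<le> ((1 + h) * t - t) * lap (\<lambda>n. real n * c n) t"
          using t elim by (intro lap_convex c_summable c_nonneg) auto
        then have "t powr \<mu> * (lap c t - lap c ((1 + h) * t)) \<le> t powr \<mu> * ((h * t) * lap (\<lambda>n. real n * c n) t)"
          by (intro mult_left_mono) (auto simp: algebra_simps)
        then show ?case using t elim by (simp add: U_def powr_add field_simps)
      qed
      ultimately show ?case by (intro exI[of _ U]) (auto simp: f_def)
    qed
  qed
qed

section \<open>Iterated partial sums and shifted indices\<close>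

definition psum :: "(nat \<Rightarrow> real) \<Rightarrow> nat \<Rightarrow> real" where
  "psum f n = (\<Sum>i\<le>n. f i)"

lemma
  assumes "disc_summable f"
  shows disc_summable_psum_pow: "disc_summable ((psum ^^ j) f)"
    and gf_psum_pow: "norm (x::'a::{real_normed_field,banach}) < 1 \<Longrightarrow> gf ((psum ^^ j) f) x = gf f x / (1 - x) ^ j"
proof -
  have psum: "psum f = conv f (\<lambda>_. 1)" for f
    by (auto simp: psum_def conv_def)
  have *: "disc_summable ((psum ^^ j) f)" for j
    by (induction j) (auto simp: assms psum intro: disc_summable_conv disc_summable_1)
  then show "disc_summable ((psum ^^ j) f)" .
  show "gf ((psum ^^ j) f) x = gf f x / (1 - x) ^ j" if "norm x < 1"
  proof (induction j)
    case (Suc j)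
    have "gf ((psum ^^ Suc j) f) x = gf ((psum ^^ j) f) x * gf (\<lambda>_. 1) x"
      by (simp add: psum gf_conv[OF * disc_summable_1 that])
    then show ?case using Suc by (simp add: gf_1[OF that])
  qed auto
qed

lemma psum_pow_mono_nonneg:
  assumes "mono f" "\<And>n. f n \<ge> 0"
  shows "mono ((psum ^^ j) f) \<and> (\<forall>n. (psum ^^ j) f n \<ge> 0)"
proof (induction j)
  case (Suc j)
  have "mono (psum g) \<and> (\<forall>n. psum g n \<ge> 0)" if "\<forall>n. g n \<ge> 0" for g
    unfolding psum_def using that by (auto intro!: monoI sum_mono2 sum_nonneg)
  with Suc have "mono (psum ((psum ^^ j) f))" "psum ((psum ^^ j) f) n \<ge> 0" for n
    by auto
  then show ?case by simp
qed (use assms in auto)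

text \<open>The shift \<open>a\<close> is measured in units of \<open>1 / \<tau> n\<close>, the
  distance over which the coefficients change by a constant factor. For positive
  \<open>\<tau> n\<close> the conversion by \<open>nat\<close> cuts something off only while
  \<open>n * \<tau> n < - a\<close>.\<close>

definition shifted :: "(nat \<Rightarrow> real) \<Rightarrow> real \<Rightarrow> nat \<Rightarrow> nat" where
  "shifted \<tau> a n = nat \<lfloor>real n + a / \<tau> n\<rfloor>"

lemma shifted_0 [simp]: "shifted \<tau> 0 n = n"
  by (simp add: shifted_def)

lemma shifted_bound:
  assumes "\<tau> n > 0" "real n * \<tau> n \<ge> - a"
  shows "\<bar>(real (shifted \<tau> a n) - real n) * \<tau> n - a\<bar> \<le> \<tau> n"
proof -
  have "real n + a / \<tau> n \<ge> 0" using assms by (simp add: field_simps)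
  then have "\<lfloor>real n + a / \<tau> n\<rfloor> \<ge> 0" by (simp only: zero_le_floor)
  then have "real (shifted \<tau> a n) = of_int \<lfloor>real n + a / \<tau> n\<rfloor>"
    unfolding shifted_def by (rule of_nat_nat)
  then have "\<bar>real (shifted \<tau> a n) - real n - a / \<tau> n\<bar> \<le> 1" by linarith
  then have "\<bar>real (shifted \<tau> a n) - real n - a / \<tau> n\<bar> * \<tau> n \<le> 1 * \<tau> n"
    using assms by (intro mult_right_mono) auto
  then have "\<bar>(real (shifted \<tau> a n) - real n - a / \<tau> n) * \<tau> n\<bar> \<le> \<tau> n"
    using assms by (simp add: abs_mult)
  then show ?thesis using assms by (simp add: algebra_simps)
qed

text \<open>Both limits serve the shifts: \<open>tau_0\<close> makes the rounding error negligible
  in units of \<open>1 / \<tau> n\<close>, and \<open>n_tau\<close> leaves room to the left for any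
  fixed number of such units.\<close>

locale saddle_sequence =
  fixes \<tau> :: "nat \<Rightarrow> real"
  assumes tau_pos: "eventually (\<lambda>n. \<tau> n > 0) sequentially"
    and tau_0: "\<tau> \<longlonglongrightarrow> 0"
    and n_tau: "filterlim (\<lambda>n. real n * \<tau> n) at_top sequentially"
begin

abbreviation sh :: "real \<Rightarrow> nat \<Rightarrow> nat" where
  "sh \<equiv> shifted \<tau>"

lemma shifted_tendsto: "(\<lambda>n. (real (sh a n) - real n) * \<tau> n) \<longlonglongrightarrow> a"
proof -
  have "eventually (\<lambda>n. \<bar>(real (sh a n) - real n) * \<tau> n - a\<bar> \<le> \<tau> n) sequentially"
    using tau_pos n_tau[unfolded filterlim_at_top, rule_format, of "- a"]
    by eventually_elim (rule shifted_bound)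
  then have "(\<lambda>n. (real (sh a n) - real n) * \<tau> n - a) \<longlonglongrightarrow> 0"
    by (intro Lim_null_comparison[OF _ tau_0]) (auto elim: eventually_mono)
  then show ?thesis by (simp add: Lim_null[symmetric])
qed

lemma psum_sandwich:
  assumes "mono f" "m \<le> k"
  shows "(real k - real m) * f m \<le> psum f k - psum f m" "psum f k - psum f m \<le> (real k - real m) * f k"
proof -
  have "psum f k - psum f m = (\<Sum>i\<in>{m<..k}. f i)"
  proof -
    have "{..k} = {..m} \<union> {m<..k}" using assms by auto
    then have "psum f k = psum f m + (\<Sum>i\<in>{m<..k}. f i)"
      unfolding psum_def by (simp only:) (rule sum.union_disjoint, auto)
    then show ?thesis by simp
  qed
  moreover have "(\<Sum>i\<in>{m<..k}. f m) \<le> (\<Sum>i\<in>{m<..k}. f i)" "(\<Sum>i\<in>{m<..k}. f i) \<le> (\<Sum>i\<in>{m<..k}. f k)"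
    by (intro sum_mono monoD[OF assms(1)]; simp)+
  ultimately show "(real k - real m) * f m \<le> psum f k - psum f m" "psum f k - psum f m \<le> (real k - real m) * f k"
    using assms by (auto simp: of_nat_diff)
qed

text \<open>The difference is divided by the true integer length of the interval, as the sandwich
  for partial sums requires; multiplied by \<open>\<tau> n\<close> this length tends to
  \<open>b - a\<close>, so rounding leaves no trace in the limit.\<close>

lemma difference_quotient_tendsto:
  assumes lim: "\<And>a. (\<lambda>n. F (sh a n) / H n) \<longlonglongrightarrow> exp a" and "a < b"
  shows "(\<lambda>n. (F (sh b n) - F (sh a n)) / ((real (sh b n) - real (sh a n)) * (\<tau> n * H n)))
     \<longlonglongrightarrow> (exp b - exp a) / (b - a)"
    and "eventually (\<lambda>n. sh a n < sh b n) sequentially"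
proof -
  have d: "(\<lambda>n. (real (sh b n) - real (sh a n)) * \<tau> n) \<longlonglongrightarrow> b - a"
    using tendsto_diff[OF shifted_tendsto[of b] shifted_tendsto[of a]] by (simp add: algebra_simps)
  have "(\<lambda>n. (F (sh b n) / H n - F (sh a n) / H n) / ((real (sh b n) - real (sh a n)) * \<tau> n))
     \<longlonglongrightarrow> (exp b - exp a) / (b - a)"
    using \<open>a < b\<close> by (intro tendsto_intros lim d) auto
  then show "(\<lambda>n. (F (sh b n) - F (sh a n)) / ((real (sh b n) - real (sh a n)) * (\<tau> n * H n)))
     \<longlonglongrightarrow> (exp b - exp a) / (b - a)"
    by (simp add: diff_divide_distrib[symmetric] mult_ac)
  have "eventually (\<lambda>n. (real (sh b n) - real (sh a n)) * \<tau> n > 0) sequentially"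
    using order_tendstoD(1)[OF d] \<open>a < b\<close> by simp
  then show "eventually (\<lambda>n. sh a n < sh b n) sequentially"
    using tau_pos by eventually_elim (auto simp: zero_less_mult_iff)
qed

text \<open>
  By monotonicity \<open>f\<close> lies between the difference quotients of its partial sums to the left and
  to the right, which tend to difference quotients of \<open>exp\<close>; then the step is shrunk.
\<close>

lemma descend_partial_sums:
  assumes f: "mono f" and H: "eventually (\<lambda>n. H n > 0) sequentially"
    and lim: "\<And>a. (\<lambda>n. psum f (sh a n) / H n) \<longlonglongrightarrow> exp a"
  shows "(\<lambda>n. f (sh a n) / (\<tau> n * H n)) \<longlonglongrightarrow> exp a"
proof -
  have small: "eventually (\<lambda>h::real. 0 < h) (at_right 0)"
    by (simp add: eventually_at_right_less)
  show ?thesis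
  proof (rule tendsto_squeeze_family[OF _ _ has_derivative_quotient_right(1,2)[OF DERIV_exp]])
    show "eventually (\<lambda>h. \<exists>U. eventually (\<lambda>n. f (sh a n) / (\<tau> n * H n) \<le> U n) sequentially \<and>
        U \<longlonglongrightarrow> (exp (a + h) - exp a) / h) (at_right 0)"
      using small
    proof eventually_elim
      case (elim h)
      then have ah: "a < a + h" by simp
      note dq = difference_quotient_tendsto[OF lim ah]
      show ?case
      proof (intro exI conjI)
        show "(\<lambda>n. (psum f (sh (a + h) n) - psum f (sh a n)) / ((real (sh (a + h) n) - real (sh a n)) * (\<tau> n * H n)))
          \<longlonglongrightarrow> (exp (a + h) - exp a) / h" using dq(1) by simp
        show "eventually (\<lambda>n. f (sh a n) / (\<tau> n * H n) \<le>
          (psum f (sh (a + h) n) - psum f (sh a n)) / ((real (sh (a + h) n) - real (sh a n)) * (\<tau> n * H n))) sequentially"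
          using dq(2) tau_pos H
        proof eventually_elim
          case (elim n)
          have "f (sh a n) \<le> (psum f (sh (a + h) n) - psum f (sh a n)) / (real (sh (a + h) n) - real (sh a n))"
            using psum_sandwich(1)[OF f less_imp_le[OF elim(1)]] elim by (simp add: field_simps)
          from divide_right_mono[OF this, of "\<tau> n * H n"] elim show ?case by simp
        qed
      qed
    qed
    show "eventually (\<lambda>h. \<exists>U. eventually (\<lambda>n. U n \<le> f (sh a n) / (\<tau> n * H n)) sequentially \<and>
        U \<longlonglongrightarrow> (exp a - exp (a - h)) / h) (at_right 0)"
      using small
    proof eventually_elim
      case (elim h)
      then have ah: "a - h < a" by simp
      note dq = difference_quotient_tendsto[OF lim ah]
      show ?case
      proof (intro exI conjI)
        show "(\<lambda>n. (psum f (sh a n) - psum f (sh (a - h) n)) / ((real (sh a n) - real (sh (a - h) n)) * (\<tau> n * H n)))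
          \<longlonglongrightarrow> (exp a - exp (a - h)) / h" using dq(1) by simp
        show "eventually (\<lambda>n. (psum f (sh a n) - psum f (sh (a - h) n)) / ((real (sh a n) - real (sh (a - h) n)) * (\<tau> n * H n))
           \<le> f (sh a n) / (\<tau> n * H n)) sequentially"
          using dq(2) tau_pos H
        proof eventually_elim
          case (elim n)
          have "(psum f (sh a n) - psum f (sh (a - h) n)) / (real (sh a n) - real (sh (a - h) n)) \<le> f (sh a n)"
            using psum_sandwich(2)[OF f less_imp_le[OF elim(1)]] elim by (simp add: field_simps)
          from divide_right_mono[OF this, of "\<tau> n * H n"] elim show ?case by simp
        qed
      qed
    qed
  qed
qed

text \<open>Induction on \<open>j\<close> with the normalization \<open>H\<close> generalized: each
  descent multiplies it by \<open>\<tau> n\<close>. The limit is carried along for every shift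
  \<open>a\<close>, since one descent at \<open>a\<close> uses nearby shifts on both sides; only the
  end takes \<open>a = 0\<close>.\<close>

lemma descend_iterated_partial_sums:
  assumes f: "mono f" "\<And>n. f n \<ge> 0" and H: "eventually (\<lambda>n. H n > 0) sequentially"
    and lim: "\<And>a. (\<lambda>n. (psum ^^ j) f (shifted \<tau> a n) / H n) \<longlonglongrightarrow> exp a"
  shows "(\<lambda>n. f n / (\<tau> n ^ j * H n)) \<longlonglongrightarrow> 1"
proof -
  have "(\<lambda>n. f (shifted \<tau> a n) / (\<tau> n ^ j * H n)) \<longlonglongrightarrow> exp a" for a
    using H lim
  proof (induction j arbitrary: H a)
    case (Suc j)
    have "eventually (\<lambda>n. \<tau> n * H n > 0) sequentially"
      using Suc.prems(1) tau_pos by eventually_elim auto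
    moreover have "(\<lambda>n. (psum ^^ j) f (shifted \<tau> a n) / (\<tau> n * H n)) \<longlonglongrightarrow> exp a" for a
      using psum_pow_mono_nonneg[OF f, of j] Suc.prems by (intro descend_partial_sums) auto
    ultimately have "(\<lambda>n. f (shifted \<tau> a n) / (\<tau> n ^ j * (\<tau> n * H n))) \<longlonglongrightarrow> exp a"
      by (rule Suc.IH)
    then show ?case by (simp add: mult_ac)
  qed simp
  from this[of 0] show ?thesis by simp
qed

end

section \<open>The saddle point\<close>

text \<open>The series is \<open>- j * Ln (1 - x)\<close>. Its exponential is what enters the
  generating function, and the real logarithm is read off from the exponential at
  \<open>x = exp (- t)\<close>.\<close>

lemma
  shows disc_summable_harmonic: "disc_summable (\<lambda>v. real j / real v)"
    and exp_gf_harmonic: "norm (x::complex) < 1 \<Longrightarrow> exp (gf (\<lambda>v. real j / real v) x) = 1 / (1 - x) ^ j"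
    and lap_harmonic: "t > 0 \<Longrightarrow> lap (\<lambda>v. real j / real v) t = - real j * ln (1 - exp (- t))"
proof -
  show d: "disc_summable (\<lambda>v. real j / real v)"
    unfolding disc_summable_def
  proof (intro allI impI)
    fix r :: real assume r: "0 \<le> r" "r < 1"
    have "summable (\<lambda>n. real j * r ^ n)" using r by (intro summable_mult summable_geometric) auto
    then show "summable (\<lambda>n. \<bar>real j / real n\<bar> * r ^ n)"
    proof (rule summable_comparison_test')
      fix n show "norm (\<bar>real j / real n\<bar> * r ^ n) \<le> real j * r ^ n"
        using r mult_right_mono[of 1 "real n" "r ^ n"]
        by (cases "n = 0") (auto simp: field_simps intro!: mult_left_mono)
    qed
  qed
  show e: "exp (gf (\<lambda>v. real j / real v) x) = 1 / (1 - x) ^ j" if "norm x < 1" for x :: complex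
  proof -
    have "(\<lambda>n. - of_nat j * (- ((- (- x)) ^ n) / of_nat n)) sums (- of_nat j * ln (1 + - x))"
      by (intro sums_mult Ln_series') (use that in simp)
    moreover have "(\<lambda>n. - of_nat j * (- ((- (- x)) ^ n) / of_nat n)) = (\<lambda>n. of_real (real j / real n) * x ^ n)"
      by (simp add: field_simps)
    ultimately have "gf (\<lambda>v. real j / real v) x = of_nat j * (- ln (1 - x))"
      using gf_sums[OF d that] sums_unique2 by fastforce
    moreover have "1 - x \<noteq> 0" using that by auto
    ultimately show ?thesis
      by (simp only: exp_of_nat_mult exp_minus exp_Ln) (simp add: field_simps)
  qed
  show "lap (\<lambda>v. real j / real v) t = - real j * ln (1 - exp (- t))" if "t > 0"
  proof -
    have "complex_of_real (exp (lap (\<lambda>v. real j / real v) t)) = of_real (1 / (1 - exp (- t)) ^ j)"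
      using e[of "of_real (exp (- t))"] gf_of_real[OF d, of "exp (- t)", where ?'a = complex] that
      by (simp add: lap_def exp_of_real[symmetric])
    then have "exp (lap (\<lambda>v. real j / real v) t) = 1 / (1 - exp (- t)) ^ j"
      by (simp only: of_real_eq_iff)
    then have "lap (\<lambda>v. real j / real v) t = ln (1 / (1 - exp (- t)) ^ j)"
      by (metis ln_exp)
    also have "\<dots> = - real j * ln (1 - exp (- t))"
      using that by (simp add: ln_div ln_realpow)
    finally show ?thesis .
  qed
qed

section \<open>Estimates on circles about the origin\<close>

lemma norm_one_minus_cis_ge:
  assumes "\<bar>y\<bar> \<le> pi" "1 / 4 \<le> r"
  shows "\<bar>y\<bar> / pi \<le> norm (1 - of_real r * cis y)"
proof -
  have "(norm (1 - of_real r * cis y)) ^ 2 = (1 - r * cos y) ^ 2 + (r * sin y) ^ 2"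
    by (simp add: cmod_power2)
  also have "\<dots> = (1 - r) ^ 2 + 2 * r * (1 - cos y)"
    using sin_cos_squared_add[of y] by algebra
  \<comment> \<open>The bound \<open>1 / 4 \<le> r\<close> is matched to the constant in the
    estimate of \<open>1 - cos y\<close>: the product is exactly
    \<open>(\<bar>y\<bar> / pi) ^ 2\<close>.\<close>
  also have "\<dots> \<ge> 0 + 2 * (1 / 4) * (2 / pi ^ 2 * y ^ 2)"
    using assms by (intro add_mono mult_mono one_minus_cos_ge) auto
  finally have "(\<bar>y\<bar> / pi) ^ 2 \<le> (norm (1 - of_real r * cis y)) ^ 2"
    by (simp add: power_divide)
  then show ?thesis by (rule power2_le_imp_le) simp
qed

lemma norm_cis_minus_1_le: "norm (cis a - 1) \<le> \<bar>a\<bar>"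
proof -
  have "(norm (cis a - 1)) ^ 2 = (cos a - 1) ^ 2 + sin a ^ 2"
    by (simp add: cmod_power2)
  also have "\<dots> = 2 * (1 - cos a)"
    using sin_cos_squared_add[of a] by algebra
  also have "\<dots> \<le> \<bar>a\<bar> ^ 2" using one_minus_cos_le[of a] by simp
  finally show ?thesis by (rule power2_le_imp_le) simp
qed

lemma exp_minus_powr_le_power:
  assumes "\<kappa> > 0" "a > 0"
  shows "eventually (\<lambda>t::real. exp (- (\<kappa> * t powr (- a))) \<le> t ^ j) (at_right 0)"
proof -
  have "((\<lambda>t::real. exp (- (\<kappa> * t powr (- a))) * t powr (- real j)) \<longlongrightarrow> 0) (at_right 0)"
    using assms by real_asymp
  then have "eventually (\<lambda>t::real. exp (- (\<kappa> * t powr (- a))) * t powr (- real j) < 1) (at_right 0)"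
    by (rule order_tendstoD) simp
  then show ?thesis using at_right_0_pos
    by eventually_elim (auto simp: powr_minus powr_realpow field_simps)
qed

text \<open>The rotation changes the \<open>n\<close>-th term by at most
  \<open>n * \<bar>y\<bar>\<close> times its size, and the first moment costs a factor
  \<open>1 / t\<close> and a halving of \<open>t\<close>. For a doubling weight this is a relative
  error of order \<open>\<bar>y\<bar> / t\<close>.\<close>

lemma gf_lipschitz:
  assumes e: "disc_summable e" "\<And>n. e n \<ge> 0" and "t > 0"
  shows "norm (gf e (circ t y) - of_real (lap e t)) \<le> \<bar>y\<bar> / t * (2 * lap e (t / 2))"
proof -
  have r: "exp (- t) < 1" using \<open>t > 0\<close> by simp
  have 1: "(\<lambda>n. of_real (e n) * (circ t y) ^ n - of_real (e n) * of_real (exp (- t)) ^ n) sums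
     (gf e (circ t y) - of_real (lap e t))"
    unfolding lap_def gf_of_real[OF e(1), of "exp (- t)", symmetric, where ?'a = complex, unfolded abs_exp_cancel, OF r]
    by (intro sums_diff gf_sums e) (use r in \<open>auto simp: norm_mult\<close>)
  note 2 = sums_mult[OF lap_sums[OF disc_summable_moment[OF e, of 1] \<open>t > 0\<close>], of "\<bar>y\<bar>"]
  have le: "norm (of_real (e n) * (circ t y) ^ n - of_real (e n) * of_real (exp (- t)) ^ n)
     \<le> \<bar>y\<bar> * (real n ^ 1 * e n * exp (- (real n * t)))" for n
  proof -
    have "of_real (e n) * (circ t y) ^ n - of_real (e n) * of_real (exp (- t)) ^ n
      = of_real (e n * exp (- t) ^ n) * (cis (real n * y) - 1)"
      by (simp add: power_mult_distrib Complex.DeMoivre algebra_simps)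
    also have "norm \<dots> = e n * exp (- t) ^ n * norm (cis (real n * y) - 1)"
      by (simp only: norm_mult norm_of_real) (simp add: e)
    also have "\<dots> \<le> e n * exp (- t) ^ n * \<bar>real n * y\<bar>"
      by (intro mult_left_mono norm_cis_minus_1_le) (simp add: e)
    also have "exp (- t) ^ n = exp (- (real n * t))"
      by (simp add: exp_of_nat_mult[symmetric])
    finally show ?thesis by (simp add: abs_mult mult_ac)
  qed
  have "norm (gf e (circ t y) - of_real (lap e t)) \<le> \<bar>y\<bar> * lap (\<lambda>n. real n ^ 1 * e n) t"
    using norm_suminf_le[OF le sums_summable[OF 2]] 1 2 by (simp add: sums_iff)
  also have "\<dots> \<le> \<bar>y\<bar> * (2 * lap e (t / 2) / t)"
    using lap_moment_le[OF e \<open>t > 0\<close>, of 1] \<open>t > 0\<close> by (intro mult_left_mono) (auto simp: field_simps)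
  finally show ?thesis by (simp add: field_simps)
qed

section \<open>Major and minor arcs of the smoothed generating function\<close>

locale exp_gf = exp_growth +
  fixes p :: "nat \<Rightarrow> real" and J :: nat
  assumes c0: "c 0 = 0" and p0: "p 0 = 1"
    and rec: "\<And>n. real (Suc n) * p (Suc n) = (\<Sum>i\<le>n. p i * (real (Suc (n - i)) * c (Suc (n - i))))"
    and mono_p: "mono p"
    and J: "real J > 1 + \<mu> / 2"
begin

text \<open>
  Since \<open>1 / (1 - x)\<^sup>J\<close> is the exponential of \<open>\<Sum>v. (J / v) x\<^sup>v\<close>, the \<open>J\<close>-fold partial sums of \<open>p\<close>
  have the logarithmic coefficients \<open>cJ\<close>; at \<open>v = 0\<close> the quotient is \<open>0\<close>.
\<close>

definition cJ :: "nat \<Rightarrow> real" where "cJ v = c v + real J / real v"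

lemma p_nonneg: "p n \<ge> 0"
  using monoD[OF mono_p, of 0 n] p0 by simp

lemma disc_summable_p: "disc_summable p"
  by (rule disc_summable_exp[OF c_summable c0 p0 rec])

lemma gf_p: "norm (x::complex) < 1 \<Longrightarrow> gf p x = exp (gf c x)"
  by (rule gf_exp[OF c_summable c0 p0 rec])

lemma disc_summable_cJ: "disc_summable cJ"
  unfolding cJ_def[abs_def] by (intro disc_summable_add c_summable disc_summable_harmonic)

text \<open>The smoothing adds \<open>- J * ln (1 - exp (- t))\<close>, which is logarithmic and
  vanishes against \<open>t powr \<mu>\<close>. Hence \<open>cJ\<close> has the same exponent and
  constant as \<open>c\<close>, and the estimates of size and phase apply to it as well.\<close>

sublocale J: exp_growth cJ \<mu> B
proof
  show "0 \<le> cJ v" for v by (simp add: cJ_def c_nonneg)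
  have "((\<lambda>t. t powr \<mu> * lap c t - real J * (t powr \<mu> * ln (1 - exp (- t)))) \<longlongrightarrow> B - real J * 0) (at_right 0)"
  proof (intro tendsto_intros lap_asymp)
    show "((\<lambda>t. t powr \<mu> * ln (1 - exp (- t))) \<longlongrightarrow> 0) (at_right 0)"
      using mu_pos by real_asymp
  qed
  then have "((\<lambda>t. t powr \<mu> * lap c t - real J * (t powr \<mu> * ln (1 - exp (- t)))) \<longlongrightarrow> B) (at_right 0)" by simp
  then show "((\<lambda>t. t powr \<mu> * lap cJ t) \<longlongrightarrow> B) (at_right 0)"
  proof (rule Lim_transform_eventually)
    show "eventually (\<lambda>t. t powr \<mu> * lap c t - real J * (t powr \<mu> * ln (1 - exp (- t))) = t powr \<mu> * lap cJ t) (at_right 0)"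
      using at_right_0_pos
    proof eventually_elim
      case (elim t)
      then have "lap cJ t = lap c t + lap (\<lambda>v. real J / real v) t"
        unfolding lap_def cJ_def[abs_def] by (intro gf_add c_summable disc_summable_harmonic) auto
      then show ?case unfolding lap_harmonic[OF elim] by (simp only:) (simp add: algebra_simps)
    qed
  qed
qed (fact disc_summable_cJ mu_pos B_pos)+

definition G :: "nat \<Rightarrow> real" where "G = (psum ^^ J) p"

lemma disc_summable_G: "disc_summable G"
  unfolding G_def by (rule disc_summable_psum_pow[OF disc_summable_p])

text \<open>Two readings of one function: as a single exponential it has one saddle point and one
  phase, which suits the major arc; with the factor \<open>(1 - x) ^ J\<close> isolated it shows the
  decay used on the minor arc.\<close>

lemma
  assumes "norm (x::complex) < 1"
  shows gf_G: "gf G x = exp (gf cJ x)" and gf_G': "gf G x = exp (gf c x) / (1 - x) ^ J"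
proof -
  show *: "gf G x = exp (gf c x) / (1 - x) ^ J"
    unfolding G_def by (simp add: gf_psum_pow[OF disc_summable_p assms] gf_p[OF assms])
  have "gf cJ x = gf c x + gf (\<lambda>v. real J / real v) x"
    unfolding cJ_def[abs_def] by (intro gf_add c_summable disc_summable_harmonic assms)
  then show "gf G x = exp (gf cJ x)"
    using exp_gf_harmonic[OF assms, of J] * by (simp add: exp_add)
qed

lemma exp_lap_cJ: "t > 0 \<Longrightarrow> exp (lap cJ t) = exp (lap c t) / (1 - exp (- t)) ^ J"
proof -
  assume t: "t > 0"
  have n: "norm (complex_of_real (exp (- t))) < 1" using t by simp
  have "complex_of_real (exp (lap cJ t)) = of_real (exp (lap c t) / (1 - exp (- t)) ^ J)"
    using gf_G[OF n] gf_G'[OF n] gf_of_real[OF disc_summable_cJ, of "exp (- t)", where ?'a = complex]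
      gf_of_real[OF c_summable, of "exp (- t)", where ?'a = complex] t
    by (simp add: lap_def exp_of_real[symmetric])
  then show ?thesis by (simp only: of_real_eq_iff)
qed

text \<open>Minus the derivative of \<open>lap cJ\<close>. Thus \<open>N t = n\<close> is the saddle
  point equation for \<open>exp (lap cJ t + n * t)\<close>, that is, for the coefficients of
  \<open>G\<close> and not of \<open>p\<close>.\<close>

definition N :: "real \<Rightarrow> real" where "N t = lap (\<lambda>n. real n * cJ n) t"

text \<open>
  At the saddle point the linear term of the phase cancels, and the cubic remainder is small for
  \<open>\<bar>y\<bar> \<le> t powr (1 + 2 * \<mu> / 5)\<close>, a range that still exceeds the Gaussian width \<open>t powr (1 + \<mu> / 2)\<close>.
\<close>

lemma major_arc:
  "\<exists>\<kappa>>0. eventually (\<lambda>t. \<forall>y. \<bar>y\<bar> \<le> t powr (1 + 2 * \<mu> / 5) \<longrightarrow>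
      0 \<le> Re (gf G (circ t y) * cis (- (N t * y))) \<and>
      (\<bar>y\<bar> \<le> t powr (1 + \<mu> / 2) \<longrightarrow>
        \<kappa> * exp (lap cJ t) \<le> Re (gf G (circ t y) * cis (- (N t * y))))) (at_right 0)"
proof -
  obtain K2 where K2: "K2 > 0" "eventually (\<lambda>t. lap (\<lambda>n. real n ^ 2 * cJ n) t \<le> K2 * t powr (- \<mu> - real 2)) (at_right 0)"
    using J.moment_bound[of 2] by blast
  obtain K3 where K3: "K3 > 0" "eventually (\<lambda>t. lap (\<lambda>n. real n ^ 3 * cJ n) t \<le> K3 * t powr (- \<mu> - real 3)) (at_right 0)"
    using J.moment_bound[of 3] by blast
  \<comment> \<open>The half is the lower bound for the cosine of the residual phase;
    \<open>exp (- K2 / 2)\<close> bounds the loss of modulus across the Gaussian width.\<close>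
  define \<kappa> where "\<kappa> = exp (- K2 / 2) / 2"
  have "((\<lambda>t. K3 * t powr (\<mu> / 5)) \<longlongrightarrow> 0) (at_right 0)" using mu_pos by real_asymp
  then have ev: "eventually (\<lambda>t. K3 * t powr (\<mu> / 5) < 1) (at_right 0)"
    by (rule order_tendstoD) simp
  have "eventually (\<lambda>t. \<forall>y. \<bar>y\<bar> \<le> t powr (1 + 2 * \<mu> / 5) \<longrightarrow>
      0 \<le> Re (gf G (circ t y) * cis (- (N t * y))) \<and>
      (\<bar>y\<bar> \<le> t powr (1 + \<mu> / 2) \<longrightarrow>
        \<kappa> * exp (lap cJ t) \<le> Re (gf G (circ t y) * cis (- (N t * y))))) (at_right 0)"
    using K2(2) K3(2) ev at_right_0_pos
  proof eventually_elim
    case (elim t)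
    show ?case
    proof (intro allI impI)
      fix y :: real assume y: "\<bar>y\<bar> \<le> t powr (1 + 2 * \<mu> / 5)"
      define w where "w = gf cJ (circ t y)"
      have n: "norm (circ t y) < 1" using elim by (simp add: norm_mult)
      have Re: "Re (gf G (circ t y) * cis (- (N t * y))) = exp (Re w) * cos (Im w - y * N t)"
        unfolding gf_G[OF n] w_def[symmetric] by (simp add: Re_exp Im_exp cos_diff algebra_simps)
      have "\<bar>Im w - y * N t\<bar> \<le> \<bar>y\<bar> ^ 3 * lap (\<lambda>n. real n ^ 3 * cJ n) t"
        unfolding w_def N_def by (rule J.phase_bound[OF elim(4)])
      also have "\<dots> \<le> (t powr (1 + 2 * \<mu> / 5)) ^ 3 * (K3 * t powr (- \<mu> - real 3))"
        by (intro mult_mono power_mono y elim lap_nonneg disc_summable_moment disc_summable_cJ)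
          (auto simp: J.c_nonneg)
      also have "\<dots> = K3 * t powr (\<mu> / 5)"
      proof -
        have "(t powr (1 + 2 * \<mu> / 5)) ^ 3 = t powr (real 3 * (1 + 2 * \<mu> / 5))"
          using elim by (subst powr_realpow[symmetric]) (auto simp: powr_powr mult.commute)
        then have "(t powr (1 + 2 * \<mu> / 5)) ^ 3 * t powr (- \<mu> - real 3) = t powr (real 3 * (1 + 2 * \<mu> / 5) + (- \<mu> - real 3))"
          by (simp only: powr_add)
        also have "real 3 * (1 + 2 * \<mu> / 5) + (- \<mu> - real 3) = \<mu> / 5" by simp
        finally show ?thesis by simp
      qed
      also have "\<dots> \<le> 1" using elim by simp
      \<comment> \<open>A residual phase of at most \<open>1\<close> keeps the cosine at least
        \<open>1 / 2\<close>, since \<open>1 - cos x \<le> x ^ 2 / 2\<close>; so the integrand has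
        nonnegative real part on the whole major arc.\<close>
      finally have "\<bar>Im w - y * N t\<bar> ^ 2 \<le> 1 ^ 2" by (intro power_mono) auto
      then have cos: "cos (Im w - y * N t) \<ge> 1 / 2"
        using one_minus_cos_le[of "Im w - y * N t"] by simp
      show "0 \<le> Re (gf G (circ t y) * cis (- (N t * y))) \<and>
      (\<bar>y\<bar> \<le> t powr (1 + \<mu> / 2) \<longrightarrow>
        \<kappa> * exp (lap cJ t) \<le> Re (gf G (circ t y) * cis (- (N t * y))))"
      proof (intro conjI impI)
        show "0 \<le> Re (gf G (circ t y) * cis (- (N t * y)))"
          unfolding Re using cos by simp
        assume y': "\<bar>y\<bar> \<le> t powr (1 + \<mu> / 2)"
        have "lap cJ t - Re w \<le> y ^ 2 / 2 * lap (\<lambda>n. real n ^ 2 * cJ n) t"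
          unfolding w_def by (rule J.decay_upper[OF elim(4)])
        also have "\<dots> \<le> (t powr (1 + \<mu> / 2)) ^ 2 / 2 * (K2 * t powr (- \<mu> - real 2))"
          using power_mono[OF y' abs_ge_zero, of 2]
          by (intro mult_mono elim lap_nonneg disc_summable_moment disc_summable_cJ)
            (auto simp: J.c_nonneg elim)
        also have "(t powr (1 + \<mu> / 2)) ^ 2 = t powr (real 2 * (1 + \<mu> / 2))"
          using elim by (subst powr_realpow[symmetric]) (auto simp: powr_powr mult.commute)
        also have "t powr (real 2 * (1 + \<mu> / 2)) / 2 * (K2 * t powr (- \<mu> - real 2))
            = K2 / 2 * (t powr (real 2 * (1 + \<mu> / 2)) * t powr (- \<mu> - real 2))" by simp
        also have "t powr (real 2 * (1 + \<mu> / 2)) * t powr (- \<mu> - real 2) = t powr (real 2 * (1 + \<mu> / 2) + (- \<mu> - real 2))"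
          by (simp only: powr_add)
        also have "real 2 * (1 + \<mu> / 2) + (- \<mu> - real 2) = 0" by simp
        finally have "lap cJ t - Re w \<le> K2 / 2" using elim by simp
        then have "exp (- K2 / 2) * exp (lap cJ t) \<le> exp (Re w)"
          unfolding exp_add[symmetric] by simp
        then have "exp (- K2 / 2) * exp (lap cJ t) * (1 / 2) \<le> exp (Re w) * cos (Im w - y * N t)"
          using cos by (intro mult_mono) auto
        then show "\<kappa> * exp (lap cJ t) \<le> Re (gf G (circ t y) * cis (- (N t * y)))"
          unfolding Re by (simp add: \<kappa>_def)
      qed
    qed
  qed
  moreover have "\<kappa> > 0" by (simp add: \<kappa>_def)
  ultimately show ?thesis by blast
qed

lemma norm_gf_G_le:
  assumes "t > 0"
  shows "norm (gf G (circ t y)) \<le> exp (lap cJ t)"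
proof -
  have n: "norm (circ t y) < 1" using assms by (simp add: norm_mult)
  show ?thesis using J.decay_nonneg[OF assms, of y] by (simp add: gf_G[OF n] norm_exp_eq_Re)
qed

text \<open>
  For \<open>\<bar>y\<bar>\<close> bounded below nothing is known about the partition generating function (parts may share
  a common factor), and the bound comes from the factor \<open>1 / (1 - x)\<^sup>J\<close> alone.
\<close>

lemma minor_arc:
  "\<exists>C>0. eventually (\<lambda>t. \<forall>y. t powr (1 + 2 * \<mu> / 5) \<le> \<bar>y\<bar> \<and> \<bar>y\<bar> \<le> pi \<longrightarrow>
      norm (gf G (circ t y)) \<le> C * t ^ J * exp (lap cJ t)) (at_right 0)"
proof -
  obtain \<kappa> s0 where \<kappa>: "\<kappa> > 0" "s0 > 0" and dl: "\<forall>t y s. 0 < t \<and> t \<le> s \<and> \<bar>y\<bar> \<le> s \<and> s \<le> s0 \<longrightarrow>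
       \<kappa> * s powr (-\<mu>) * (y / s) ^ 2 \<le> lap c t - Re (gf c (circ t y))"
    using decay_lower by blast
  obtain b where b: "b > 0" "\<forall>t. 0 < t \<longrightarrow> t < b \<longrightarrow> exp (- (\<kappa> * t powr (- \<mu>))) \<le> t ^ J"
    using exp_minus_powr_le_power[OF \<kappa>(1) mu_pos, of J] unfolding eventually_at_right_field by auto
  define s1 where "s1 = Min {s0, b / 2, 1}"
  have s1: "s1 > 0" "s1 \<le> s0" "s1 < b" "s1 \<le> 1" using \<kappa> b by (auto simp: s1_def)
  define C where "C = 1 + pi ^ J + (pi / s1) ^ J"
  have C: "1 \<le> C" "pi ^ J \<le> C" "(pi / s1) ^ J \<le> C"
    using s1 by (auto simp: C_def)
  then have "C > 0" by linarith
  have ev2: "eventually (\<lambda>t. exp (- (\<kappa> * t powr (- (\<mu> / 5)))) \<le> t ^ J) (at_right 0)"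
    by (rule exp_minus_powr_le_power) (use \<kappa> mu_pos in auto)
  have ev3: "eventually (\<lambda>t. t < s1 \<and> exp (- t) \<ge> 1 / 4) (at_right (0::real))"
  proof -
    have "((\<lambda>t::real. exp (- t)) \<longlongrightarrow> exp (- 0)) (at_right 0)" by (intro tendsto_intros)
    then have "eventually (\<lambda>t::real. exp (- t) > 1 / 4) (at_right 0)" by (rule order_tendstoD) simp
    moreover have "eventually (\<lambda>t. t < s1) (at_right (0::real))"
      using s1 by (auto simp: eventually_at_right_field)
    ultimately show ?thesis by eventually_elim auto
  qed
  have "eventually (\<lambda>t. \<forall>y. t powr (1 + 2 * \<mu> / 5) \<le> \<bar>y\<bar> \<and> \<bar>y\<bar> \<le> pi \<longrightarrow>
      norm (gf G (circ t y)) \<le> C * t ^ J * exp (lap cJ t)) (at_right 0)"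
    using ev2 ev3 at_right_0_pos
  proof eventually_elim
    case (elim t)
    show ?case
    proof (intro allI impI)
      fix y assume y: "t powr (1 + 2 * \<mu> / 5) \<le> \<bar>y\<bar> \<and> \<bar>y\<bar> \<le> pi"
      have t: "t > 0" using elim by simp
      have y0: "\<bar>y\<bar> > 0" using y t by (smt (verit) powr_gt_zero)
      define x where "x = circ t y"
      \<comment> \<open>\<open>W\<close> measures the loss in the exponential of the series of
        \<open>c\<close>, \<open>q\<close> the loss in one factor \<open>1 / (1 - x)\<close>;
        \<open>exp (- W) * q ^ J\<close> is the total loss against the value at
        \<open>exp (- t)\<close>.\<close>
      define W where "W = lap c t - Re (gf c x)"
      define q where "q = (1 - exp (- t)) / norm (1 - x)"
      have n: "norm x < 1" unfolding x_def using t by (simp add: norm_mult)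
      have x1: "norm (1 - x) > 0" using n by auto
      have W: "W \<ge> 0" unfolding W_def x_def by (rule decay_nonneg[OF t])
      have eq: "norm (gf G x) = exp (- W) * q ^ J * exp (lap cJ t)"
      proof -
        have "norm (gf G x) = exp (Re (gf c x)) / norm (1 - x) ^ J"
          unfolding gf_G'[OF n] by (simp add: norm_divide norm_power norm_exp_eq_Re)
        also have "exp (Re (gf c x)) = exp (- W) * exp (lap c t)"
          by (simp add: W_def exp_add[symmetric])
        finally show ?thesis
          using t x1 by (simp add: exp_lap_cJ q_def power_divide)
      qed
      have q0: "q \<ge> 0" using t by (simp add: q_def)
      have "1 - norm x \<le> norm (1 - x)"
        using norm_triangle_ineq2[of 1 x] by simp
      then have "1 - exp (- t) \<le> norm (1 - x)" by (simp add: x_def norm_mult)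
      then have q1: "q \<le> 1" using x1 by (simp add: q_def)
      have q2: "q \<le> pi * t / \<bar>y\<bar>"
      proof -
        have "1 - exp (- t) \<le> t" using exp_ge_add_one_self[of "- t"] by simp
        moreover have "\<bar>y\<bar> / pi \<le> norm (1 - x)"
          unfolding x_def using elim y by (intro norm_one_minus_cis_ge) auto
        ultimately have "q \<le> t / (\<bar>y\<bar> / pi)"
          unfolding q_def using y0 t by (intro frac_le) auto
        then show ?thesis by (simp add: mult.commute)
      qed
      \<comment> \<open>Close to the axis \<open>exp (- W)\<close> alone is below
        \<open>t ^ J\<close>. In the middle range \<open>exp (- W) \<le> \<bar>y\<bar> ^ J\<close>
        compensates the denominator in \<open>q \<le> pi * t / \<bar>y\<bar>\<close>. Beyond
        \<open>s1\<close> the bound rests on \<open>q\<close> alone.\<close>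
      consider "\<bar>y\<bar> \<le> t" | "t \<le> \<bar>y\<bar>" "\<bar>y\<bar> \<le> s1" | "s1 \<le> \<bar>y\<bar>" by linarith
      then have "exp (- W) * q ^ J \<le> C * t ^ J"
      proof cases
        case 1
        have "\<kappa> * t powr (-\<mu>) * (y / t) ^ 2 \<le> W"
          unfolding W_def x_def using dl[rule_format, of t t y] 1 t s1 elim by auto
        moreover have "\<kappa> * t powr (- (\<mu> / 5)) \<le> \<kappa> * t powr (-\<mu>) * (y / t) ^ 2"
        proof -
          have "t powr (2 * \<mu> / 5) \<le> \<bar>y\<bar> / t"
          proof -
            have "t powr (1 + 2 * \<mu> / 5) = t powr (2 * \<mu> / 5) * t"
              using t by (simp only: powr_add) simp
            then show ?thesis using y t by (simp add: pos_le_divide_eq)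
          qed
          then have "(t powr (2 * \<mu> / 5)) ^ 2 \<le> (\<bar>y\<bar> / t) ^ 2"
            by (intro power_mono) auto
          moreover have "(t powr (2 * \<mu> / 5)) ^ 2 = t powr (real 2 * (2 * \<mu> / 5))"
            using t by (subst powr_realpow[symmetric]) (auto simp: powr_powr mult.commute)
          ultimately have "t powr (-\<mu>) * t powr (real 2 * (2 * \<mu> / 5)) \<le> t powr (-\<mu>) * (y / t) ^ 2"
            by (intro mult_left_mono) (auto simp: power_divide)
          moreover have "t powr (-\<mu>) * t powr (real 2 * (2 * \<mu> / 5)) = t powr (- (\<mu> / 5))"
            unfolding powr_add[symmetric] by simp
          ultimately show ?thesis using \<kappa> by simp
        qed
        ultimately have "exp (- W) \<le> exp (- (\<kappa> * t powr (- (\<mu> / 5))))" by simp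
        also have "\<dots> \<le> t ^ J" by (rule elim)
        finally have "exp (- W) * q ^ J \<le> t ^ J * 1"
          using q0 q1 t by (intro mult_mono power_le_one) auto
        also have "\<dots> \<le> C * t ^ J" using C(1) t mult_right_mono[of 1 C "t ^ J"] by simp
        finally show ?thesis .
      next
        case 2
        have "\<kappa> * \<bar>y\<bar> powr (-\<mu>) * (y / \<bar>y\<bar>) ^ 2 \<le> W"
          unfolding W_def x_def using dl[rule_format, of t "\<bar>y\<bar>" y] 2 t s1 by auto
        moreover have "(y / \<bar>y\<bar>) ^ 2 = 1" using y0 by (simp add: power_divide)
        ultimately have "exp (- W) \<le> exp (- (\<kappa> * \<bar>y\<bar> powr (- \<mu>)))" by simp
        also have "\<dots> \<le> \<bar>y\<bar> ^ J" using b(2) y0 2 s1 by auto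
        finally have "exp (- W) * q ^ J \<le> \<bar>y\<bar> ^ J * (pi * t / \<bar>y\<bar>) ^ J"
          using q0 q2 by (intro mult_mono power_mono) auto
        also have "\<dots> = pi ^ J * t ^ J" using y0 by (simp add: power_divide power_mult_distrib)
        also have "\<dots> \<le> C * t ^ J" using C t by (intro mult_right_mono) auto
        finally show ?thesis .
      next
        case 3
        have "q \<le> pi * t / s1"
          by (rule order_trans[OF q2], rule divide_left_mono) (use 3 s1 t in auto)
        then have "exp (- W) * q ^ J \<le> 1 * (pi * t / s1) ^ J"
          using q0 W by (intro mult_mono power_mono) auto
        also have "\<dots> = (pi / s1) ^ J * t ^ J" by (simp add: power_divide power_mult_distrib)
        also have "\<dots> \<le> C * t ^ J" using C t by (intro mult_right_mono) auto
        finally show ?thesis .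
      qed
      then have "exp (- W) * q ^ J * exp (lap cJ t) \<le> C * t ^ J * exp (lap cJ t)"
        by (intro mult_right_mono) auto
      then show "norm (gf G (circ t y)) \<le> C * t ^ J * exp (lap cJ t)"
        using eq by (simp add: x_def)
    qed
  qed
  with \<open>C > 0\<close> show ?thesis by blast
qed

text \<open>\<open>N\<close> is continuous, antitone and unbounded at \<open>0\<close>, so
  \<open>N s = n\<close> is solvable for large \<open>n\<close>. Monotonicity of \<open>N\<close>
  forces the solutions to \<open>0\<close>, and the asymptotics of \<open>N\<close> then give their
  size.\<close>

lemma saddle_exists:
  "\<exists>\<tau>. saddle_sequence \<tau> \<and> eventually (\<lambda>n. N (\<tau> n) = real n) sequentially \<and>
     (\<lambda>n. real n * \<tau> n powr (\<mu> + 1)) \<longlonglongrightarrow> \<mu> * B"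
proof -
  have dN: "disc_summable (\<lambda>n. real n * cJ n)"
    using disc_summable_moment[OF disc_summable_cJ J.c_nonneg, of 1] by simp
  have N_anti: "N t \<le> N s" if "0 < s" "s \<le> t" for s t
    unfolding N_def by (rule lap_antimono[OF dN]) (use that J.c_nonneg in auto)
  have Nas: "((\<lambda>t. t powr (\<mu> + 1) * N t) \<longlongrightarrow> \<mu> * B) (at_right 0)"
    unfolding N_def by (rule J.lap_deriv_asymp)
  have N_top: "filterlim N at_top (at_right 0)"
  proof -
    have "filterlim (\<lambda>t::real. t powr (- (\<mu> + 1))) at_top (at_right 0)"
      using mu_pos by real_asymp
    then have fl: "filterlim (\<lambda>t. t powr (\<mu> + 1) * N t * t powr (- (\<mu> + 1))) at_top (at_right 0)"
      by (rule filterlim_tendsto_pos_mult_at_top[OF Nas, rotated]) (use mu_pos B_pos in simp)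
    have "eventually (\<lambda>t. t powr (\<mu> + 1) * N t * t powr (- (\<mu> + 1)) = N t) (at_right 0)"
      using at_right_0_pos
      by eventually_elim (subst powr_minus, simp)
    from iffD1[OF filterlim_cong[OF refl refl this] fl] show ?thesis .
  qed
  have ex: "\<exists>s>0. N s = real n" if n: "real n \<ge> N 1" for n
  proof -
    have "eventually (\<lambda>t. N t \<ge> real n \<and> 0 < t \<and> t < 1) (at_right 0)"
      using N_top[unfolded filterlim_at_top, rule_format, of "real n"] eventually_at_right_real[OF zero_less_one]
      by eventually_elim auto
    then obtain a where a: "N a \<ge> real n" "0 < a" "a < 1"
      using eventually_happens'[OF trivial_limit_at_right_real] by blast
    have "continuous_on {a..1} N"
      unfolding N_def by (rule continuous_on_subset[OF lap_continuous[OF dN]]) (use a in auto)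
    then obtain s where "a \<le> s" "s \<le> 1" "N s = real n"
      using IVT2'[of N 1 "real n" a] n a by auto
    then show ?thesis using a by (intro exI[of _ s]) auto
  qed
  \<comment> \<open>Solvability is known only for \<open>n\<close> at least \<open>N 1\<close>, so
    the choice is uncontrolled at finitely many indices and every property of \<open>\<tau>\<close>
    is stated eventually.\<close>
  define \<tau> where "\<tau> n = (SOME s. s > 0 \<and> N s = real n)" for n
  have \<tau>: "\<tau> n > 0 \<and> N (\<tau> n) = real n" if "real n \<ge> N 1" for n
    unfolding \<tau>_def using someI_ex[OF ex[OF that]] by simp
  have ev: "eventually (\<lambda>n. real n \<ge> x) sequentially" for x
    using filterlim_real_sequentially by (simp add: filterlim_at_top)
  have ev1: "eventually (\<lambda>n. \<tau> n > 0) sequentially" and ev2: "eventually (\<lambda>n. N (\<tau> n) = real n) sequentially"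
    using ev[of "N 1"] by (eventually_elim, use \<tau> in blast)+
  have lim0: "\<tau> \<longlonglongrightarrow> 0"
  proof (rule order_tendstoI)
    fix a :: real assume a: "a < 0"
    show "eventually (\<lambda>n. a < \<tau> n) sequentially"
      using ev1 by eventually_elim (use a in auto)
  next
    fix a :: real assume a: "0 < a"
    show "eventually (\<lambda>n. \<tau> n < a) sequentially"
      using ev[of "N a + 1"] ev2
    proof eventually_elim
      case (elim n)
      show ?case
      proof (rule ccontr)
        assume "\<not> \<tau> n < a"
        then have "N (\<tau> n) \<le> N a" using a by (intro N_anti) auto
        then show False using elim by simp
      qed
    qed
  qed
  have flim: "filterlim \<tau> (at_right 0) sequentially"
    using lim0 ev1 by (auto simp: filterlim_at elim: eventually_mono)
  have "(\<lambda>n. \<tau> n powr (\<mu> + 1) * N (\<tau> n)) \<longlonglongrightarrow> \<mu> * B"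
    by (rule filterlim_compose[OF Nas flim])
  then have lim: "(\<lambda>n. real n * \<tau> n powr (\<mu> + 1)) \<longlonglongrightarrow> \<mu> * B"
    by (rule Lim_transform_eventually) (use ev2 in eventually_elim, simp)
  have "filterlim (\<lambda>t::real. t powr (- \<mu>)) at_top (at_right 0)"
    using mu_pos by real_asymp
  from filterlim_compose[OF this flim]
  have fl: "filterlim (\<lambda>n. real n * \<tau> n powr (\<mu> + 1) * \<tau> n powr (- \<mu>)) at_top sequentially"
    by (rule filterlim_tendsto_pos_mult_at_top[OF lim, rotated]) (use mu_pos B_pos in simp)
  have "eventually (\<lambda>n. real n * \<tau> n powr (\<mu> + 1) * \<tau> n powr (- \<mu>) = real n * \<tau> n) sequentially"
    using ev1 by eventually_elim (simp add: powr_add powr_minus field_simps)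
  from iffD1[OF filterlim_cong[OF refl refl this] fl]
  have "filterlim (\<lambda>n. real n * \<tau> n) at_top sequentially" .
  then have "saddle_sequence \<tau>" using ev1 lim0 by unfold_locales
  with ev2 lim show ?thesis by blast
qed

end

section \<open>Weighted convolutions\<close>

text \<open>Doubling turns the bound of \<open>gf_lipschitz\<close> into one relative to
  \<open>lap e t\<close>. It covers power growth, logarithmic factors and the unit of convolution
  alike.\<close>

definition doubling_weight :: "(nat \<Rightarrow> real) \<Rightarrow> bool" where
  "doubling_weight e \<longleftrightarrow> disc_summable e \<and> (\<forall>n. e n \<ge> 0) \<and>
     (\<exists>K. eventually (\<lambda>t. 0 < lap e t \<and> lap e (t / 2) \<le> K * lap e t) (at_right 0))"

context exp_gf
begin

lemma disc_summable_weighted: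
  assumes "disc_summable e"
  shows "disc_summable ((psum ^^ J) (conv e p))"
  by (intro disc_summable_psum_pow disc_summable_conv assms disc_summable_p)

lemma gf_weighted:
  assumes "disc_summable e" "norm (x::complex) < 1"
  shows "gf ((psum ^^ J) (conv e p)) x = gf e x * gf G x"
  unfolding G_def
  by (simp add: gf_psum_pow disc_summable_conv gf_conv assms disc_summable_p)

text \<open>The Gaussian width contributes positively, the rest of the major arc not negatively, and
  the minor arc costs at most half of the main contribution; hence \<open>2 * pi\<close> in place of
  \<open>pi\<close>.\<close>

lemma coefficient_lower:
  assumes t: "0 < t" "t < 1" and \<kappa>: "\<kappa> > 0" and C: "C > 0"
    and major: "\<forall>y. \<bar>y\<bar> \<le> t powr (1 + 2 * \<mu> / 5) \<longrightarrow>
      0 \<le> Re (gf G (circ t y) * cis (- (N t * y))) \<and>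
      (\<bar>y\<bar> \<le> t powr (1 + \<mu> / 2) \<longrightarrow>
        \<kappa> * exp (lap cJ t) \<le> Re (gf G (circ t y) * cis (- (N t * y))))"
    and minor: "\<forall>y. t powr (1 + 2 * \<mu> / 5) \<le> \<bar>y\<bar> \<and> \<bar>y\<bar> \<le> pi \<longrightarrow>
      norm (gf G (circ t y)) \<le> C * t ^ J * exp (lap cJ t)"
    and n: "N t = real n"
    and small: "C * t ^ J \<le> \<kappa> * t powr (1 + \<mu> / 2) / (2 * pi)"
  shows "\<kappa> * t powr (1 + \<mu> / 2) / (2 * pi) * exp (lap cJ t) \<le> G n * exp (- t) ^ n"
proof -
  define Q where "Q = exp (lap cJ t)"
  have Q: "Q > 0" by (simp add: Q_def)
  define \<epsilon> where "\<epsilon> = C * t ^ J * Q"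
  have \<epsilon>: "\<epsilon> > 0" using C t Q by (simp add: \<epsilon>_def)
  have Y_le: "t powr (1 + \<mu> / 2) \<le> t powr (1 + 2 * \<mu> / 5)"
    using t mu_pos by (intro powr_mono') auto
  have "t powr (1 + \<mu> / 2) \<le> 1" using t mu_pos by (intro powr_le1) auto
  then have Y_pi: "t powr (1 + \<mu> / 2) \<le> pi" using pi_gt3 by linarith
  have "- \<epsilon> + t powr (1 + \<mu> / 2) * (\<kappa> * Q) / pi \<le> G n * exp (- t) ^ n"
  proof (rule coeff_lower_bound[OF disc_summable_G _ _ _ Y_pi])
    fix y :: real assume y: "\<bar>y\<bar> \<le> pi"
    let ?R = "Re (gf G (circ t y) * cis (- (real n * y)))"
    show "- \<epsilon> + (if \<bar>y\<bar> \<le> t powr (1 + \<mu> / 2) then \<kappa> * Q else 0) \<le> ?R"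
    proof (cases "\<bar>y\<bar> \<le> t powr (1 + 2 * \<mu> / 5)")
      case True
      then have "0 \<le> ?R" "\<bar>y\<bar> \<le> t powr (1 + \<mu> / 2) \<longrightarrow> \<kappa> * Q \<le> ?R"
        using major unfolding n Q_def by blast+
      then show ?thesis using \<epsilon> by auto
    next
      case False
      have "norm (gf G (circ t y) * cis (- (real n * y))) \<le> \<epsilon>"
        using minor y False by (simp add: norm_mult \<epsilon>_def Q_def)
      then have "- \<epsilon> \<le> ?R" using abs_Re_le_cmod[of "gf G (circ t y) * cis (- (real n * y))"] by linarith
      then show ?thesis using False Y_le by auto
    qed
  qed (use t in auto)
  moreover have "\<epsilon> \<le> \<kappa> * t powr (1 + \<mu> / 2) / (2 * pi) * Q"
    unfolding \<epsilon>_def using small Q by (intro mult_right_mono) auto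
  ultimately show ?thesis unfolding Q_def by (simp add: field_simps)
qed

text \<open>The weight and the shift from \<open>n\<close> to \<open>m\<close> enter the integrand
  as one factor \<open>1 + h\<close>. On the minor arc \<open>h\<close> is bounded and
  \<open>G\<close> is small; on the major arc \<open>h\<close> is of order
  \<open>\<bar>y\<bar> / t\<close>. Integration over the half-width
  \<open>t powr (1 + 2 * \<mu> / 5)\<close> then produces the exponent
  \<open>1 + 4 * \<mu> / 5\<close>.\<close>

lemma coefficient_difference:
  assumes t: "0 < t" "t < 1" and C: "C > 0"
    and e: "disc_summable e" "\<And>n. e n \<ge> 0" "lap e t > 0" "lap e (t / 2) \<le> K * lap e t"
    and minor: "\<forall>y. t powr (1 + 2 * \<mu> / 5) \<le> \<bar>y\<bar> \<and> \<bar>y\<bar> \<le> pi \<longrightarrow>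
      norm (gf G (circ t y)) \<le> C * t ^ J * exp (lap cJ t)"
    and mn: "\<bar>real m - real n\<bar> * t \<le> b"
  shows "\<bar>1 / lap e t * ((psum ^^ J) (conv e p) m * exp (- t) ^ m) - 1 * (G n * exp (- t) ^ n)\<bar>
      \<le> (4 * C * t ^ J + (2 * K + b) * t powr (1 + 4 * \<mu> / 5) / pi) * exp (lap cJ t)"
proof -
  define Q where "Q = exp (lap cJ t)"
  have Q: "Q > 0" by (simp add: Q_def)
  define r where "r = exp (- t)"
  have r: "0 \<le> r" "r < 1" using t by (auto simp: r_def)
  define Y where "Y = t powr (1 + 2 * \<mu> / 5)"
  have "Y \<le> 1" unfolding Y_def using t mu_pos by (intro powr_le1) auto
  then have Y: "0 \<le> Y" "Y \<le> pi" using pi_gt3 by (simp add: Y_def, linarith)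
  define M where "M = (2 * K + b) * t powr (2 * \<mu> / 5) * Q"
  have K0: "K * lap e t \<ge> 0" using lap_nonneg[OF e(1,2), of "t / 2"] t e(4) by linarith
  then have K: "K \<ge> 0" using e(3) by (simp add: zero_le_mult_iff)
  have b: "b \<ge> 0" using mn t by (smt (verit) mult_nonneg_nonneg abs_ge_zero)
  have M: "M \<ge> 0" using K b Q by (simp add: M_def)
  have "\<bar>1 / lap e t * ((psum ^^ J) (conv e p) m * r ^ m) - 1 * (G n * r ^ n)\<bar> \<le> 4 * C * t ^ J * Q + Y * M / pi"
  proof (rule coeff_diff_bound[OF disc_summable_weighted[OF e(1)] disc_summable_G r Y])
    fix y :: real assume y: "\<bar>y\<bar> \<le> pi"
    define x where "x = of_real r * cis y"
    have n: "norm x < 1" using r by (simp add: x_def norm_mult)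
    define h where "h = gf e x / of_real (lap e t) * cis (- ((real m - real n) * y)) - 1"
    have eq: "of_real (1 / lap e t) * (gf ((psum ^^ J) (conv e p)) x * cis (- (real m * y)))
       - of_real 1 * (gf G x * cis (- (real n * y))) = gf G x * cis (- (real n * y)) * h"
    proof -
      have "- (real m * y) = - (real n * y) + - ((real m - real n) * y)" by (simp add: algebra_simps)
      then have "cis (- (real m * y)) = cis (- (real n * y)) * cis (- ((real m - real n) * y))"
        by (simp only: cis_mult)
      then show ?thesis unfolding gf_weighted[OF e(1) n] h_def by (simp add: algebra_simps)
    qed
    have h4: "norm h \<le> 4"
    proof -
      have "norm (gf e x) \<le> gf e (norm x)" by (rule norm_gf_le[OF e(1,2) n])
      also have "\<dots> = lap e t" using r by (simp add: x_def norm_mult lap_def r_def)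
      finally have "norm (gf e x / of_real (lap e t) * cis (- ((real m - real n) * y))) \<le> 1"
        using e(3) by (simp add: norm_mult norm_divide)
      then show ?thesis unfolding h_def by (smt (verit) norm_triangle_ineq4 norm_one)
    qed
    have hy: "norm h \<le> (2 * K + b) * (\<bar>y\<bar> / t)"
    proof -
      have "h = (gf e x - of_real (lap e t)) / of_real (lap e t) * cis (- ((real m - real n) * y))
         + (cis (- ((real m - real n) * y)) - 1)"
        using e(3) by (simp add: h_def field_simps)
      also have "norm \<dots> \<le> norm (gf e x - of_real (lap e t)) / lap e t + \<bar>(real m - real n) * y\<bar>"
        using norm_cis_minus_1_le[of "- ((real m - real n) * y)"] e(3)
        by (intro order_trans[OF norm_triangle_ineq] add_mono) (auto simp: norm_mult norm_divide)
      also have "\<dots> \<le> (\<bar>y\<bar> / t * (2 * (K * lap e t))) / lap e t + b * (\<bar>y\<bar> / t)"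
      proof (intro add_mono divide_right_mono)
        have "norm (gf e x - of_real (lap e t)) \<le> \<bar>y\<bar> / t * (2 * lap e (t / 2))"
          unfolding x_def r_def by (rule gf_lipschitz[OF e(1,2) t(1)])
        also have "\<dots> \<le> \<bar>y\<bar> / t * (2 * (K * lap e t))"
          using e(4) t by (intro mult_left_mono) auto
        finally show "norm (gf e x - of_real (lap e t)) \<le> \<bar>y\<bar> / t * (2 * (K * lap e t))" .
        have "\<bar>real m - real n\<bar> * t * (\<bar>y\<bar> / t) \<le> b * (\<bar>y\<bar> / t)"
          using mn t by (intro mult_right_mono) auto
        then show "\<bar>(real m - real n) * y\<bar> \<le> b * (\<bar>y\<bar> / t)"
          using t by (simp add: abs_mult)
      qed (use e in auto)
      also have "\<dots> = (2 * K + b) * (\<bar>y\<bar> / t)" using e(3) t by (simp add: field_simps)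
      finally show ?thesis .
    qed
    show "norm (of_real (1 / lap e t) * (gf ((psum ^^ J) (conv e p)) (of_real r * cis y) * cis (- (real m * y)))
       - of_real 1 * (gf G (of_real r * cis y) * cis (- (real n * y)))) \<le> 4 * C * t ^ J * Q + (if \<bar>y\<bar> \<le> Y then M else 0)"
      unfolding x_def[symmetric] eq
    proof (cases "\<bar>y\<bar> \<le> Y")
      case True
      have "norm (gf G x * cis (- (real n * y)) * h) \<le> Q * ((2 * K + b) * (\<bar>y\<bar> / t))"
        unfolding norm_mult norm_cis mult_1_right using hy norm_gf_G_le[OF t(1), of y] Q
        by (intro mult_mono) (auto simp: x_def r_def Q_def)
      also have "\<dots> \<le> Q * ((2 * K + b) * (Y / t))"
        using True Q K b t by (intro mult_left_mono divide_right_mono) auto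
      also have "Y / t = t powr (2 * \<mu> / 5)"
        unfolding Y_def powr_add using t by simp
      finally show "norm (gf G x * cis (- (real n * y)) * h) \<le> 4 * C * t ^ J * Q + (if \<bar>y\<bar> \<le> Y then M else 0)"
        using True C t Q by (simp add: M_def mult_ac add_nonneg_nonneg add_increasing)
    next
      case False
      have "norm (gf G x) \<le> C * t ^ J * Q"
        using minor y False unfolding Y_def Q_def x_def r_def by auto
      then have "norm (gf G x * cis (- (real n * y)) * h) \<le> C * t ^ J * Q * 4"
        unfolding norm_mult norm_cis mult_1_right using h4 C t Q by (intro mult_mono) auto
      then show "norm (gf G x * cis (- (real n * y)) * h) \<le> 4 * C * t ^ J * Q + (if \<bar>y\<bar> \<le> Y then M else 0)"
        using False by simp
    qed
  qed
  also have "Y * M = (2 * K + b) * t powr (1 + 4 * \<mu> / 5) * Q"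
  proof -
    have "1 + 4 * \<mu> / 5 = (1 + 2 * \<mu> / 5) + 2 * \<mu> / 5" by simp
    then have "t powr (1 + 4 * \<mu> / 5) = t powr ((1 + 2 * \<mu> / 5) + 2 * \<mu> / 5)" by (simp only:)
    also have "\<dots> = Y * t powr (2 * \<mu> / 5)" unfolding Y_def by (rule powr_add)
    finally show ?thesis by (simp add: M_def)
  qed
  finally show ?thesis unfolding Q_def r_def by (simp add: algebra_simps)
qed

text \<open>Dividing the bound on the difference by the lower bound on the coefficient cancels
  \<open>exp (lap cJ t)\<close>. The factor \<open>exp a\<close> comes from the radius:
  \<open>exp (- \<tau> n)\<close> is raised to the power \<open>m n\<close> in one coefficient and
  to \<open>n\<close> in the other.\<close>

lemma weighted_partial_sums_asymp:
  assumes sad: "saddle_sequence \<tau>" and N\<tau>: "eventually (\<lambda>n. N (\<tau> n) = real n) sequentially"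
    and e: "doubling_weight e" and m: "(\<lambda>n. (real (m n) - real n) * \<tau> n) \<longlonglongrightarrow> a"
  shows "(\<lambda>n. (psum ^^ J) (conv e p) (m n) / (lap e (\<tau> n) * G n)) \<longlonglongrightarrow> exp a"
    and "eventually (\<lambda>n. lap e (\<tau> n) * G n > 0) sequentially"
proof -
  interpret saddle_sequence \<tau> by (rule sad)
  have flim: "filterlim \<tau> (at_right 0) sequentially"
    using tau_0 tau_pos by (auto simp: filterlim_at elim: eventually_mono)
  note ev = filterlim_iff[THEN iffD1, OF flim, rule_format]
  have e_ds: "disc_summable e" and e_nn: "\<And>n. e n \<ge> 0" using e by (auto simp: doubling_weight_def)
  obtain K where K: "eventually (\<lambda>t. 0 < lap e t \<and> lap e (t / 2) \<le> K * lap e t) (at_right 0)"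
    using e by (auto simp: doubling_weight_def)
  obtain \<kappa> where \<kappa>: "\<kappa> > 0" and major: "eventually (\<lambda>t. \<forall>y. \<bar>y\<bar> \<le> t powr (1 + 2 * \<mu> / 5) \<longrightarrow>
      0 \<le> Re (gf G (circ t y) * cis (- (N t * y))) \<and>
      (\<bar>y\<bar> \<le> t powr (1 + \<mu> / 2) \<longrightarrow>
        \<kappa> * exp (lap cJ t) \<le> Re (gf G (circ t y) * cis (- (N t * y))))) (at_right 0)"
    using major_arc by blast
  obtain C where C: "C > 0" and minor: "eventually (\<lambda>t. \<forall>y. t powr (1 + 2 * \<mu> / 5) \<le> \<bar>y\<bar> \<and> \<bar>y\<bar> \<le> pi \<longrightarrow>
      norm (gf G (circ t y)) \<le> C * t ^ J * exp (lap cJ t)) (at_right 0)"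
    using minor_arc by blast
  define \<kappa>' where "\<kappa>' = \<kappa> / (2 * pi)"
  have \<kappa>': "\<kappa>' > 0" using \<kappa> by (simp add: \<kappa>'_def)
  define b where "b = \<bar>a\<bar> + 1"
  have Jlim: "((\<lambda>t. L * t powr (real J - (1 + \<mu> / 2))) \<longlongrightarrow> 0) (at_right 0)" for L
  proof -
    have "real J - (1 + \<mu> / 2) > 0" using J by simp
    then show ?thesis by real_asymp
  qed
  have small: "eventually (\<lambda>t. C * t ^ J \<le> \<kappa> * t powr (1 + \<mu> / 2) / (2 * pi)) (at_right 0)"
    using order_tendstoD(2)[OF Jlim[of C] \<kappa>'] at_right_0_pos
  proof eventually_elim
    case (elim t)
    have "t ^ J = t powr (real J - (1 + \<mu> / 2)) * t powr (1 + \<mu> / 2)"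
      using elim by (simp add: powr_add[symmetric] powr_realpow)
    then have "C * t ^ J = (C * t powr (real J - (1 + \<mu> / 2))) * t powr (1 + \<mu> / 2)" by simp
    also have "\<dots> \<le> \<kappa>' * t powr (1 + \<mu> / 2)" using elim by (intro mult_right_mono) auto
    finally show ?case by (simp add: \<kappa>'_def)
  qed
  have t1: "eventually (\<lambda>t. t < 1) (at_right (0::real))"
    by (auto simp: eventually_at_right_field intro!: exI[of _ 1])
  have mb: "eventually (\<lambda>n. \<bar>real (m n) - real n\<bar> * \<tau> n \<le> b) sequentially"
  proof -
    have "eventually (\<lambda>n. \<bar>(real (m n) - real n) * \<tau> n\<bar> < b) sequentially"
      by (rule order_tendstoD(2)[OF tendsto_rabs[OF m]]) (simp add: b_def)
    with tau_pos show ?thesis by eventually_elim (simp add: abs_mult)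
  qed
  define F where "F = (psum ^^ J) (conv e p)"
  \<comment> \<open>The relative error: the exponents \<open>J\<close> and
    \<open>1 + 4 * \<mu> / 5\<close> are reduced by the exponent \<open>1 + \<mu> / 2\<close> of the
    lower bound, and both differences are positive.\<close>
  define \<delta> where "\<delta> t = (4 * C * t powr (real J - (1 + \<mu> / 2)) + (2 * K + b) / pi * t powr (3 * \<mu> / 10)) / \<kappa>'" for t
  have lower: "eventually (\<lambda>n. \<kappa>' * \<tau> n powr (1 + \<mu> / 2) * exp (lap cJ (\<tau> n)) \<le> G n * exp (- \<tau> n) ^ n) sequentially"
    using tau_pos ev[OF t1] ev[OF major] ev[OF minor] N\<tau> ev[OF small]
  proof eventually_elim
    case (elim n)
    from coefficient_lower[OF elim(1,2) \<kappa> C elim(3,4,5,6)] show ?case by (simp add: \<kappa>'_def)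
  qed
  then have Gpos: "eventually (\<lambda>n. G n > 0) sequentially"
    using tau_pos
  proof eventually_elim
    case (elim n)
    have "0 < \<kappa>' * \<tau> n powr (1 + \<mu> / 2) * exp (lap cJ (\<tau> n))" using \<kappa>' elim by simp
    with elim(1) have "0 < G n * exp (- \<tau> n) ^ n" by linarith
    then show ?case by (simp add: zero_less_mult_iff)
  qed
  then show "eventually (\<lambda>n. lap e (\<tau> n) * G n > 0) sequentially"
    using ev[OF K] by eventually_elim simp
  have "eventually (\<lambda>n. norm (F (m n) / (lap e (\<tau> n) * G n) * exp (- ((real (m n) - real n) * \<tau> n)) - 1) \<le> \<delta> (\<tau> n)) sequentially"
    using tau_pos ev[OF t1] ev[OF minor] ev[OF K] mb lower Gpos
  proof eventually_elim
    case (elim n)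
    define t where "t = \<tau> n"
    define Q where "Q = exp (lap cJ t)"
    define D where "D = G n * exp (- t) ^ n"
    have Dpos: "D > 0" using elim by (simp add: D_def)
    have Ddiv: "\<kappa>' * t powr (1 + \<mu> / 2) * Q \<le> D" using elim by (simp add: D_def t_def Q_def)
    have "\<bar>1 / lap e t * (F (m n) * exp (- t) ^ (m n)) - 1 * D\<bar>
      \<le> (4 * C * t ^ J + (2 * K + b) * t powr (1 + 4 * \<mu> / 5) / pi) * Q"
      unfolding F_def D_def Q_def t_def using elim
      by (intro coefficient_difference C e_ds e_nn) auto
    also have "\<dots> = \<delta> t * (\<kappa>' * t powr (1 + \<mu> / 2) * Q)"
    proof -
      have "t ^ J = t powr (real J - (1 + \<mu> / 2)) * t powr (1 + \<mu> / 2)"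
        using elim by (simp add: powr_add[symmetric] powr_realpow t_def)
      moreover have "t powr (1 + 4 * \<mu> / 5) = t powr (3 * \<mu> / 10) * t powr (1 + \<mu> / 2)"
      proof -
        have "1 + 4 * \<mu> / 5 = 3 * \<mu> / 10 + (1 + \<mu> / 2)" by simp
        then show ?thesis unfolding powr_add[symmetric] by (simp only:)
      qed
      ultimately show ?thesis unfolding \<delta>_def using \<kappa>' by (simp add: field_simps)
    qed
    also have "\<dots> \<le> \<delta> t * D"
    proof (rule mult_left_mono[OF Ddiv])
      have "0 \<le> lap e (t / 2)" using elim by (intro lap_nonneg e_ds e_nn) (simp add: t_def)
      then have "0 \<le> K * lap e t" using elim by (simp add: t_def)
      then have "K \<ge> 0" using elim by (simp add: t_def zero_le_mult_iff)
      then show "\<delta> t \<ge> 0" using C \<kappa>' by (simp add: \<delta>_def b_def)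
    qed
    finally have "\<bar>1 / lap e t * (F (m n) * exp (- t) ^ (m n)) - D\<bar> / D \<le> \<delta> t"
      using Dpos by (simp add: pos_divide_le_eq)
    also have "\<bar>1 / lap e t * (F (m n) * exp (- t) ^ (m n)) - D\<bar> / D =
        \<bar>(1 / lap e t * (F (m n) * exp (- t) ^ (m n)) - D) / D\<bar>" using Dpos by simp
    also have "(1 / lap e t * (F (m n) * exp (- t) ^ (m n)) - D) / D =
        F (m n) / (lap e t * G n) * (exp (- t) ^ m n / exp (- t) ^ n) - 1"
      using Dpos elim by (simp add: D_def diff_divide_distrib)
    also have "exp (- t) ^ m n / exp (- t) ^ n = exp (- ((real (m n) - real n) * t))"
      by (simp add: exp_of_nat_mult[symmetric] exp_diff[symmetric] algebra_simps)
    finally show ?case by (simp add: t_def)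
  qed
  moreover have "(\<lambda>n. \<delta> (\<tau> n)) \<longlonglongrightarrow> 0"
  proof (rule filterlim_compose[OF _ flim])
    have "((\<lambda>t. (4 * C * t powr (real J - (1 + \<mu> / 2)) + (2 * K + b) / pi * t powr (3 * \<mu> / 10)) / \<kappa>') \<longlongrightarrow> (0 + 0) / \<kappa>') (at_right 0)"
    proof (intro tendsto_divide tendsto_add Jlim tendsto_const)
      show "((\<lambda>t. (2 * K + b) / pi * t powr (3 * \<mu> / 10)) \<longlongrightarrow> 0) (at_right 0)"
        using mu_pos by real_asymp
    qed (use \<kappa>' in simp)
    then show "(\<delta> \<longlongrightarrow> 0) (at_right 0)" by (simp add: \<delta>_def[abs_def])
  qed
  ultimately have "(\<lambda>n. F (m n) / (lap e (\<tau> n) * G n) * exp (- ((real (m n) - real n) * \<tau> n)) - 1) \<longlonglongrightarrow> 0"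
    by (rule Lim_null_comparison)
  then have "(\<lambda>n. F (m n) / (lap e (\<tau> n) * G n) * exp (- ((real (m n) - real n) * \<tau> n))) \<longlonglongrightarrow> 1"
    by (simp add: Lim_null[symmetric])
  from tendsto_mult[OF this tendsto_exp[OF m]]
  show "(\<lambda>n. (psum ^^ J) (conv e p) (m n) / (lap e (\<tau> n) * G n)) \<longlonglongrightarrow> exp a"
    by (simp add: mult.assoc exp_add[symmetric] F_def)
qed

text \<open>The descent works with monotone sequences. Convolution with a nonnegative weight
  preserves monotonicity: as \<open>n\<close> grows, the old terms grow with \<open>p\<close> and
  the new ones are nonnegative.\<close>

lemma mono_conv:
  assumes "\<And>n. e n \<ge> 0"
  shows "mono (conv e p)" and "conv e p n \<ge> 0"
proof -
  show "conv e p n \<ge> 0" unfolding conv_def by (intro sum_nonneg mult_nonneg_nonneg assms p_nonneg)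
  show "mono (conv e p)"
  proof (rule monoI)
    fix n m :: nat assume "n \<le> m"
    have "(\<Sum>i\<le>n. e i * p (n - i)) \<le> (\<Sum>i\<le>n. e i * p (m - i))"
      by (intro sum_mono mult_left_mono assms monoD[OF mono_p]) (use \<open>n \<le> m\<close> in auto)
    also have "\<dots> \<le> (\<Sum>i\<le>m. e i * p (m - i))"
      by (rule sum_mono2) (use \<open>n \<le> m\<close> assms p_nonneg in auto)
    finally show "conv e p n \<le> conv e p m" by (simp add: conv_def)
  qed
qed

lemma weighted_asymp_aux:
  assumes sad: "saddle_sequence \<tau>" and N\<tau>: "eventually (\<lambda>n. N (\<tau> n) = real n) sequentially"
    and e: "doubling_weight e"
  shows "(\<lambda>n. conv e p n / (\<tau> n ^ J * (lap e (\<tau> n) * G n))) \<longlonglongrightarrow> 1"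
proof -
  interpret saddle_sequence \<tau> by (rule sad)
  have e_nn: "\<And>n. e n \<ge> 0" using e by (auto simp: doubling_weight_def)
  show ?thesis
    by (rule descend_iterated_partial_sums[OF mono_conv[OF e_nn]
        weighted_partial_sums_asymp(2)[OF sad N\<tau> e shifted_tendsto]
        weighted_partial_sums_asymp(1)[OF sad N\<tau> e shifted_tendsto]])
qed

theorem weighted_asymp:
  assumes sad: "saddle_sequence \<tau>" and N\<tau>: "eventually (\<lambda>n. N (\<tau> n) = real n) sequentially"
    and e: "doubling_weight e"
  shows "(\<lambda>n. conv e p n / (lap e (\<tau> n) * p n)) \<longlonglongrightarrow> 1"
proof -
  interpret saddle_sequence \<tau> by (rule sad)
  \<comment> \<open>The unit of convolution has \<open>lap d t = 1\<close> and reproduces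
    \<open>p\<close>, so the previous lemma also describes \<open>p\<close> itself, with the same
    factor \<open>\<tau> n ^ J * G n\<close>. This unevaluated factor cancels in the
    quotient.\<close>
  define d where "d n = (if n = 0 then 1 else 0 :: real)" for n :: nat
  have dt: "(\<lambda>n. d n * r ^ n) sums 1" for r :: real
  proof -
    have "(\<lambda>n. d n * r ^ n) = (\<lambda>n. if n = 0 then r ^ n else 0)" by (auto simp: d_def)
    then show ?thesis using sums_single[of 0 "\<lambda>n. r ^ n"] by simp
  qed
  have d_ds: "disc_summable d"
    unfolding disc_summable_def
  proof (intro allI impI)
    fix r :: real
    have "\<bar>d n\<bar> = d n" for n by (simp add: d_def)
    then show "summable (\<lambda>n. \<bar>d n\<bar> * r ^ n)" using dt[of r] by (simp add: sums_iff)
  qed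
  have lap_d: "lap d t = 1" for t using dt[of "exp (- t)"] by (simp add: lap_def gf_def sums_iff)
  have "doubling_weight d"
    unfolding doubling_weight_def lap_d using d_ds by (auto simp: d_def intro!: exI[of _ 1])
  from weighted_asymp_aux[OF sad N\<tau> this]
  have 1: "(\<lambda>n. conv d p n / (\<tau> n ^ J * G n)) \<longlonglongrightarrow> 1" by (simp add: lap_d)
  have "conv d p n = p n" for n
  proof -
    have "conv d p n = (\<Sum>i\<le>n. if i = 0 then p (n - i) else 0)"
      unfolding conv_def d_def by (intro sum.cong) auto
    then show ?thesis by (simp add: sum.delta)
  qed
  with 1 have 1: "(\<lambda>n. p n / (\<tau> n ^ J * G n)) \<longlonglongrightarrow> 1" by simp
  have G0: "eventually (\<lambda>n. lap d (\<tau> n) * G n > 0) sequentially"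
    by (rule weighted_partial_sums_asymp(2)[OF sad N\<tau> \<open>doubling_weight d\<close> shifted_tendsto])
  show ?thesis
  proof (rule Lim_transform_eventually)
    show "(\<lambda>n. (conv e p n / (\<tau> n ^ J * (lap e (\<tau> n) * G n))) / (p n / (\<tau> n ^ J * G n))) \<longlonglongrightarrow> 1"
      using tendsto_divide[OF weighted_asymp_aux[OF sad N\<tau> e] 1] by simp
    show "eventually (\<lambda>n. (conv e p n / (\<tau> n ^ J * (lap e (\<tau> n) * G n))) / (p n / (\<tau> n ^ J * G n))
        = conv e p n / (lap e (\<tau> n) * p n)) sequentially"
      using G0 tau_pos by eventually_elim (simp add: lap_d)
  qed
qed

end

section \<open>Counting partitions\<close>

locale positive_parts =
  fixes \<Lambda> :: "nat \<Rightarrow> nat"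
  assumes part_pos: "0 < \<Lambda> i" and finite_fibre: "finite {i. \<Lambda> i = l}"
begin

definition partitions :: "nat \<Rightarrow> nat multiset set" where
  "partitions n = {M. (\<Sum>i\<in>#M. \<Lambda> i) = n}"

definition pcount :: "nat \<Rightarrow> real" where
  "pcount n = real (card (partitions n))"

lemma dvd_div_pos: "\<Lambda> i dvd v \<Longrightarrow> v > 0 \<Longrightarrow> 0 < v div \<Lambda> i"
  using part_pos[of i] by (auto elim!: dvdE)

lemma finite_parts_le: "finite {i. \<Lambda> i \<le> n}"
proof -
  have "{i. \<Lambda> i \<le> n} = (\<Union>l\<le>n. {i. \<Lambda> i = l})" by auto
  then show ?thesis using finite_fibre by simp
qed

lemma size_le_weight: "size M \<le> (\<Sum>i\<in>#M. \<Lambda> i)"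
proof (induction M)
  case (add i M)
  then show ?case using part_pos[of i] by simp
qed simp

lemma part_le_weight: "i \<in># M \<Longrightarrow> \<Lambda> i \<le> (\<Sum>i\<in>#M. \<Lambda> i)"
  by (metis add_mset_add_single image_mset_add_mset insert_DiffM le_add1 sum_mset.add_mset)

lemma finite_partitions: "finite (partitions n)"
proof (rule finite_subset)
  show "partitions n \<subseteq> mset ` {xs. set xs \<subseteq> {i. \<Lambda> i \<le> n} \<and> length xs \<le> n}"
  proof
    fix M assume "M \<in> partitions n"
    then have M: "(\<Sum>i\<in>#M. \<Lambda> i) = n" by (simp add: partitions_def)
    obtain xs where xs: "mset xs = M" using ex_mset by blast
    have "set xs \<subseteq> {i. \<Lambda> i \<le> n}" using part_le_weight[of _ M] M xs by auto
    moreover have "length xs \<le> n" using size_le_weight[of M] M xs by auto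
    ultimately show "M \<in> mset ` {xs. set xs \<subseteq> {i. \<Lambda> i \<le> n} \<and> length xs \<le> n}" using xs by auto
  qed
  show "finite (mset ` {xs. set xs \<subseteq> {i. \<Lambda> i \<le> n} \<and> length xs \<le> n})"
    by (intro finite_imageI finite_lists_length_le finite_parts_le)
qed

lemma partition_moment_eq: "partition_moment \<Lambda> k n = (\<Sum>M\<in>partitions n. real (size M) ^ k)"
proof -
  have pc: "partition_count \<Lambda> n m = card {M \<in> partitions n. size M = m}" for m
    unfolding partition_count_def partitions_def by (intro arg_cong[of _ _ card]) auto
  have "partition_moment \<Lambda> k n = (\<Sum>m\<le>n. real m ^ k * real (partition_count \<Lambda> n m))"
    unfolding partition_moment_def
  proof (rule suminf_finite)
    fix m assume "m \<notin> {..n}"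
    then have e: "{M \<in> partitions n. size M = m} = {}"
      using size_le_weight by (fastforce simp: partitions_def)
    then show "real m ^ k * real (partition_count \<Lambda> n m) = 0" unfolding pc e by simp
  qed simp
  also have "\<dots> = (\<Sum>m\<le>n. \<Sum>M\<in>{M \<in> partitions n. size M = m}. real (size M) ^ k)"
    unfolding pc by (intro sum.cong) auto
  also have "\<dots> = (\<Sum>M\<in>partitions n. real (size M) ^ k)"
    by (rule sum.group) (use finite_partitions in \<open>auto simp: partitions_def size_le_weight\<close>)
  finally show ?thesis .
qed

text \<open>Removing \<open>r\<close> copies of the position \<open>i\<close> is a bijection onto
  the partitions of the remaining number.\<close>

lemma card_partitions_count_ge:
  "real (card {M \<in> partitions n. r \<le> count M i}) = (if r * \<Lambda> i \<le> n then pcount (n - r * \<Lambda> i) else 0)"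
proof (cases "r * \<Lambda> i \<le> n")
  case True
  have w: "(\<Sum>j\<in>#M + replicate_mset r i. \<Lambda> j) = (\<Sum>j\<in>#M. \<Lambda> j) + r * \<Lambda> i" for M
    by simp
  have "bij_betw (\<lambda>M. M + replicate_mset r i) (partitions (n - r * \<Lambda> i)) {M \<in> partitions n. r \<le> count M i}"
  proof (rule bij_betw_byWitness[where f' = "\<lambda>M. M - replicate_mset r i"])
    have sub: "M - replicate_mset r i + replicate_mset r i = M" if "r \<le> count M i" for M
      using that by (intro subset_mset.diff_add) (simp add: count_le_replicate_mset_subset_eq)
    show "\<forall>M\<in>partitions (n - r * \<Lambda> i). M + replicate_mset r i - replicate_mset r i = M" by simp
    show "\<forall>M\<in>{M \<in> partitions n. r \<le> count M i}. M - replicate_mset r i + replicate_mset r i = M"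
      using sub by simp
    show "(\<lambda>M. M + replicate_mset r i) ` partitions (n - r * \<Lambda> i) \<subseteq> {M \<in> partitions n. r \<le> count M i}"
      using True by (auto simp: partitions_def)
    show "(\<lambda>M. M - replicate_mset r i) ` {M \<in> partitions n. r \<le> count M i} \<subseteq> partitions (n - r * \<Lambda> i)"
    proof clarify
      fix M assume "M \<in> partitions n" "r \<le> count M i"
      then show "M - replicate_mset r i \<in> partitions (n - r * \<Lambda> i)"
        using w[of "M - replicate_mset r i"] sub[of M] by (simp add: partitions_def)
    qed
  qed
  then show ?thesis using True by (simp add: pcount_def bij_betw_same_card)
next
  case False
  have "\<not> r \<le> count M i" if "M \<in> partitions n" for M
  proof
    assume "r \<le> count M i"
    then obtain K where "M = replicate_mset r i + K"
      using count_le_replicate_mset_subset_eq subset_mset.le_iff_add by metis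
    then show False using that False by (simp add: partitions_def)
  qed
  then have "{M \<in> partitions n. r \<le> count M i} = {}" by auto
  then show ?thesis using False by (simp only: card.empty) simp
qed

lemma finite_dvd: "v > 0 \<Longrightarrow> finite {i. \<Lambda> i dvd v}"
  by (rule finite_subset[OF _ finite_parts_le[of v]]) (auto dest: dvd_imp_le)

text \<open>A multiplicity is the number of \<open>r \<ge> 1\<close> not exceeding it, so the sum
  runs over triples of a partition, a position and such an \<open>r\<close>. Removing the copies
  leaves \<open>pcount (n - v)\<close> with \<open>v = r * \<Lambda> i\<close>, and collecting by
  \<open>v\<close> yields sums over divisors.\<close>

lemma sum_partitions_weighted:
  fixes w :: "nat \<Rightarrow> real"
  shows "(\<Sum>M\<in>partitions n. \<Sum>i | \<Lambda> i \<le> n. w i * real (count M i)) =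
    (\<Sum>v\<le>n. (if v = 0 then 0 else \<Sum>i | \<Lambda> i dvd v. w i) * pcount (n - v))"
proof -
  let ?I = "{i. \<Lambda> i \<le> n}"
  have cnt: "real (count M i) = (\<Sum>r\<in>{1..n}. if r \<le> count M i then 1 else 0)" if "M \<in> partitions n" for M i
  proof -
    have "count M i \<le> n" using that count_le_size[of M i] size_le_weight[of M] by (simp add: partitions_def)
    then have "{r \<in> {1..n}. r \<le> count M i} = {1..count M i}" by auto
    then show ?thesis by (simp add: sum.inter_filter[symmetric])
  qed
  have "(\<Sum>M\<in>partitions n. \<Sum>i\<in>?I. w i * real (count M i))
      = (\<Sum>i\<in>?I. \<Sum>M\<in>partitions n. w i * (\<Sum>r\<in>{1..n}. if r \<le> count M i then 1 else 0))"
    by (subst sum.swap) (intro sum.cong refl, simp add: cnt)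
  also have "\<dots> = (\<Sum>i\<in>?I. w i * (\<Sum>r\<in>{1..n}. \<Sum>M\<in>partitions n. if r \<le> count M i then 1 else 0))"
    by (subst sum.swap) (simp add: sum_distrib_left)
  also have "\<dots> = (\<Sum>i\<in>?I. w i * (\<Sum>r\<in>{1..n}. if r * \<Lambda> i \<le> n then pcount (n - r * \<Lambda> i) else 0))"
    by (simp add: card_partitions_count_ge[symmetric] sum.inter_filter[symmetric] finite_partitions)
  also have "\<dots> = (\<Sum>i\<in>?I. w i * (\<Sum>v\<in>{1..n}. if \<Lambda> i dvd v then pcount (n - v) else 0))"
  proof -
    have "(\<Sum>r\<in>{1..n}. if r * \<Lambda> i \<le> n then pcount (n - r * \<Lambda> i) else 0)
      = (\<Sum>v\<in>{1..n}. if \<Lambda> i dvd v then pcount (n - v) else 0)" for i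
    proof -
    have "(\<Sum>r\<in>{1..n}. if r * \<Lambda> i \<le> n then pcount (n - r * \<Lambda> i) else 0) = (\<Sum>r\<in>{r\<in>{1..n}. r * \<Lambda> i \<le> n}. pcount (n - r * \<Lambda> i))"
      by (rule sum.inter_filter[symmetric]) simp
    also have "\<dots> = (\<Sum>v\<in>{v\<in>{1..n}. \<Lambda> i dvd v}. pcount (n - v))"
    proof (rule sum.reindex_bij_witness[of _ "\<lambda>v. v div \<Lambda> i" "\<lambda>r. r * \<Lambda> i"])
      fix r assume "r \<in> {r\<in>{1..n}. r * \<Lambda> i \<le> n}"
      then show "r * \<Lambda> i div \<Lambda> i = r" "r * \<Lambda> i \<in> {v\<in>{1..n}. \<Lambda> i dvd v}"
        using part_pos[of i] by auto
    next
      fix v assume v: "v \<in> {v\<in>{1..n}. \<Lambda> i dvd v}"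
      then show "v div \<Lambda> i * \<Lambda> i = v" by auto
      have "v div \<Lambda> i \<le> n" using v by (auto intro: order_trans[OF div_le_dividend])
      moreover have "v div \<Lambda> i \<ge> 1" using v dvd_div_pos[of i v] by auto
      ultimately show "v div \<Lambda> i \<in> {r\<in>{1..n}. r * \<Lambda> i \<le> n}" using v by auto
    qed auto
    also have "\<dots> = (\<Sum>v\<in>{1..n}. if \<Lambda> i dvd v then pcount (n - v) else 0)"
      by (rule sum.inter_filter) simp
    finally show ?thesis .
    qed
    then show ?thesis by simp
  qed
  also have "\<dots> = (\<Sum>v\<in>{1..n}. \<Sum>i\<in>?I. w i * (if \<Lambda> i dvd v then pcount (n - v) else 0))"
    unfolding sum_distrib_left by (rule sum.swap)
  also have "\<dots> = (\<Sum>v\<in>{1..n}. (if v = 0 then 0 else \<Sum>i | \<Lambda> i dvd v. w i) * pcount (n - v))"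
  proof (intro sum.cong refl)
    fix v assume v: "v \<in> {1..n}"
    have "(\<Sum>i\<in>?I. w i * (if \<Lambda> i dvd v then pcount (n - v) else 0)) = (\<Sum>i\<in>?I. if \<Lambda> i dvd v then w i * pcount (n - v) else 0)"
      by (intro sum.cong) auto
    also have "\<dots> = (\<Sum>i\<in>{i \<in> ?I. \<Lambda> i dvd v}. w i * pcount (n - v))"
      by (rule sum.inter_filter[symmetric]) (rule finite_parts_le)
    also have "{i \<in> ?I. \<Lambda> i dvd v} = {i. \<Lambda> i dvd v}"
    proof -
      have "\<Lambda> i \<le> n" if "\<Lambda> i dvd v" for i using dvd_imp_le[OF that] v by simp
      then show ?thesis by auto
    qed
    finally show "(\<Sum>i\<in>?I. w i * (if \<Lambda> i dvd v then pcount (n - v) else 0))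
        = (if v = 0 then 0 else \<Sum>i | \<Lambda> i dvd v. w i) * pcount (n - v)"
      using v by (simp add: sum_distrib_right)
  qed
  also have "\<dots> = (\<Sum>v\<le>n. (if v = 0 then 0 else \<Sum>i | \<Lambda> i dvd v. w i) * pcount (n - v))"
    by (rule sum.mono_neutral_left) auto
  finally show ?thesis .
qed

lemma sum_count_superset:
  fixes w :: "nat \<Rightarrow> real"
  assumes "M \<in> partitions n"
  shows "(\<Sum>i | \<Lambda> i \<le> n. w i * real (count M i)) = (\<Sum>i\<in>#M. w i)"
proof -
  have sub: "set_mset M \<subseteq> {i. \<Lambda> i \<le> n}"
    using part_le_weight[of _ M] assms by (auto simp: partitions_def)
  have "(\<Sum>i\<in>I. w i * real (count M i)) = (\<Sum>i\<in>#M. w i)" if "finite I" "set_mset M \<subseteq> I" for I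
    using that(2)
  proof (induction M)
    case (add j M)
    have "(\<Sum>i\<in>I. w i * real (count (add_mset j M) i)) = (\<Sum>i\<in>I. w i * real (count M i) + (if i = j then w i else 0))"
      by (intro sum.cong) (auto simp: algebra_simps)
    also have "\<dots> = (\<Sum>i\<in>#M. w i) + w j"
      using add that(1) by (simp add: sum.distrib sum.delta)
    finally show ?case by simp
  qed simp
  from this[OF finite_parts_le sub] show ?thesis .
qed

text \<open>
  The case \<open>\<sigma> = 1\<close> gives the logarithmic coefficients of the partition generating function, the
  case \<open>\<sigma> = 0\<close> counts divisors. At \<open>v = 0\<close> the terms \<open>0 powr (- \<sigma>)\<close> are \<open>0\<close>, even for \<open>\<sigma> = 0\<close>.
\<close>

definition divisor_weight :: "real \<Rightarrow> nat \<Rightarrow> real" where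
  "divisor_weight \<sigma> v = (\<Sum>i | \<Lambda> i dvd v. real (v div \<Lambda> i) powr (- \<sigma>))"

lemma divisor_weight_0_right [simp]: "divisor_weight \<sigma> 0 = 0"
  by (simp add: divisor_weight_def)

lemma divisor_weight_nonneg: "divisor_weight \<sigma> v \<ge> 0"
  by (simp add: divisor_weight_def sum_nonneg)

lemma divisor_weight_0: "divisor_weight 0 v = (if v = 0 then 0 else \<Sum>i | \<Lambda> i dvd v. 1)"
proof (cases "v = 0")
  case False
  have "v div \<Lambda> i > 0" if "\<Lambda> i dvd v" for i
    using that False dvd_div_pos[of i v] by simp
  then have "divisor_weight 0 v = (\<Sum>i | \<Lambda> i dvd v. 1)"
    unfolding divisor_weight_def by (intro sum.cong) auto
  then show ?thesis using False by simp
qed simp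

lemma divisor_weight_1: "real v * divisor_weight 1 v = (if v = 0 then 0 else \<Sum>i | \<Lambda> i dvd v. real (\<Lambda> i))"
proof (cases "v = 0")
  case False
  have "real v * real (v div \<Lambda> i) powr (- 1) = real (\<Lambda> i)" if "\<Lambda> i dvd v" for i
  proof -
    have "v div \<Lambda> i > 0" using that False dvd_div_pos[of i v] by simp
    moreover have "real v = real (v div \<Lambda> i) * real (\<Lambda> i)"
      using that by (simp add: of_nat_mult[symmetric])
    ultimately show ?thesis by (simp add: powr_minus field_simps)
  qed
  then show ?thesis using False by (simp add: divisor_weight_def sum_distrib_left)
qed simp

lemma pcount_0: "pcount 0 = 1"
proof -
  have "partitions 0 = {{#}}"
    using part_pos by (auto simp: partitions_def) (metis all_not_in_conv part_le_weight less_not_refl le_zero_eq set_mset_eq_empty_iff)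
  then show ?thesis by (simp add: pcount_def)
qed

text \<open>Double counting of the total weight of all partitions of \<open>Suc n\<close>: with
  \<open>w i = \<Lambda> i\<close> every partition contributes \<open>Suc n\<close>. This is
  logarithmic differentiation of the product in terms of coefficients.\<close>

lemma pcount_recurrence:
  "real (Suc n) * pcount (Suc n) = (\<Sum>i\<le>n. pcount i * (real (Suc (n - i)) * divisor_weight 1 (Suc (n - i))))"
proof -
  have "real (Suc n) * pcount (Suc n) = (\<Sum>M\<in>partitions (Suc n). real (Suc n))"
    by (simp add: pcount_def)
  also have "\<dots> = (\<Sum>M\<in>partitions (Suc n). \<Sum>i | \<Lambda> i \<le> Suc n. real (\<Lambda> i) * real (count M i))"
  proof (intro sum.cong refl)
    fix M assume M: "M \<in> partitions (Suc n)"
    have "(\<Sum>i\<in>#M. real (\<Lambda> i)) = real (\<Sum>i\<in>#M. \<Lambda> i)" by (induction M) auto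
    also have "(\<Sum>i\<in>#M. \<Lambda> i) = Suc n" using M by (simp add: partitions_def)
    finally show "real (Suc n) = (\<Sum>i | \<Lambda> i \<le> Suc n. real (\<Lambda> i) * real (count M i))"
      unfolding sum_count_superset[OF M] by (rule sym)
  qed
  also have "\<dots> = (\<Sum>v\<le>Suc n. (real v * divisor_weight 1 v) * pcount (Suc n - v))"
    unfolding sum_partitions_weighted divisor_weight_1 ..
  also have "\<dots> = (\<Sum>v\<le>n. (real (Suc v) * divisor_weight 1 (Suc v)) * pcount (n - v))"
    unfolding sum.atMost_Suc_shift by simp
  also have "\<dots> = (\<Sum>i\<le>n. (real (Suc (n - i)) * divisor_weight 1 (Suc (n - i))) * pcount (n - (n - i)))"
    by (rule sum.reindex_bij_witness[of _ "\<lambda>i. n - i" "\<lambda>i. n - i"]) auto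
  also have "\<dots> = (\<Sum>i\<le>n. pcount i * (real (Suc (n - i)) * divisor_weight 1 (Suc (n - i))))"
    by (intro sum.cong) auto
  finally show ?thesis .
qed

lemma expected_summands_eq:
  "expected_summands \<Lambda> n = conv (divisor_weight 0) pcount n / pcount n"
proof -
  have "partition_moment \<Lambda> 1 n = (\<Sum>M\<in>partitions n. \<Sum>i | \<Lambda> i \<le> n. 1 * real (count M i))"
    unfolding partition_moment_eq by (intro sum.cong refl) (subst sum_count_superset, auto)
  also have "\<dots> = conv (divisor_weight 0) pcount n"
    unfolding sum_partitions_weighted conv_def divisor_weight_0 ..
  finally show ?thesis
    by (simp add: expected_summands_def partition_moment_eq pcount_def)
qed

text \<open>Adding one copy of the part \<open>1\<close> injects the partitions of \<open>n\<close>
  into those of \<open>Suc n\<close>.\<close>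

lemma mono_pcount:
  assumes "\<Lambda> i = 1"
  shows "mono pcount"
proof (rule mono_iff_le_Suc[THEN iffD2], rule allI)
  fix n
  have "card (partitions n) \<le> card (partitions (Suc n))"
    by (rule card_inj_on_le[of "add_mset i"]) (auto simp: inj_on_def partitions_def assms finite_partitions[unfolded partitions_def])
  then show "pcount n \<le> pcount (Suc n)" by (simp add: pcount_def)
qed

end

section \<open>Asymptotics of divisor sums\<close>

lemma riemann_zeta_sums:
  assumes "s > 1"
  shows "(\<lambda>n. real (Suc n) powr (- s)) sums riemann_zeta s" and "riemann_zeta s > 0"
proof -
  have sm: "summable (\<lambda>n. real (Suc n) powr (- s))"
    using assms by (subst summable_Suc_iff) (simp add: summable_real_powr_iff)
  have eq: "1 / real (Suc n) powr s = real (Suc n) powr (- s)" for n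
    by (simp add: powr_minus_divide)
  show *: "(\<lambda>n. real (Suc n) powr (- s)) sums riemann_zeta s"
    unfolding riemann_zeta_def eq using sm by (rule summable_sums)
  have "0 < (\<Sum>n. real (Suc n) powr (- s))"
    by (rule suminf_pos[OF sm]) simp
  then show "riemann_zeta s > 0" using * by (simp add: sums_iff)
qed

lemma riemann_zeta_2: "riemann_zeta 2 = pi ^ 2 / 6"
proof -
  have "1 / real (Suc n) powr 2 = 1 / (real n + 1) ^ 2" for n
    by (simp add: powr_numeral add.commute)
  then show ?thesis
    using inverse_squares_sums by (simp add: riemann_zeta_def sums_iff)
qed

text \<open>Near \<open>0\<close> the product \<open>\<phi> t * lap e t\<close> stays between
  \<open>l / 2\<close> and \<open>2 * l\<close>, a ratio of \<open>4\<close>; the doubling of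
  \<open>lap e\<close> thus reduces to that of the explicit function \<open>\<phi>\<close>.\<close>

lemma doubling_weightI:
  assumes e: "disc_summable e" "\<And>n. e n \<ge> 0"
    and lim: "((\<lambda>t. \<phi> t * lap e t) \<longlongrightarrow> l) (at_right 0)" and l: "l > 0"
    and \<phi>: "eventually (\<lambda>t. \<phi> t > 0) (at_right 0)" "eventually (\<lambda>t. \<phi> t \<le> K * \<phi> (t / 2)) (at_right 0)"
    and K: "K > 0"
  shows "doubling_weight e"
proof -
  have half: "filterlim (\<lambda>t::real. t / 2) (at_right 0) (at_right 0)"
    using filterlim_mult_at_right_0[of "1 / 2"] by simp
  have up: "eventually (\<lambda>t. \<phi> t * lap e t < 2 * l) (at_right 0)"
    by (rule order_tendstoD(2)[OF lim]) (use l in simp)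
  have lo: "eventually (\<lambda>t. l / 2 < \<phi> t * lap e t) (at_right 0)"
    by (rule order_tendstoD(1)[OF lim]) (use l in simp)
  note half_ev = filterlim_iff[THEN iffD1, OF half, rule_format]
  have "eventually (\<lambda>t. 0 < lap e t \<and> lap e (t / 2) \<le> (4 * K) * lap e t) (at_right 0)"
    using half_ev[OF up] lo \<phi> half_ev[OF \<phi>(1)]
  proof eventually_elim
    case (elim t)
    have pos: "lap e t > 0"
    proof -
      have "0 < \<phi> t * lap e t" using elim l by linarith
      then show ?thesis using elim by (simp add: zero_less_mult_iff)
    qed
    have "\<phi> (t / 2) * lap e (t / 2) \<le> 4 * (\<phi> t * lap e t)" using elim by linarith
    also have "\<dots> \<le> 4 * (K * \<phi> (t / 2) * lap e t)"
      using elim pos by (intro mult_left_mono mult_right_mono) auto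
    also have "\<dots> = \<phi> (t / 2) * (4 * K * lap e t)" by simp
    finally show ?case using elim pos by (simp add: mult_le_cancel_left_pos)
  qed
  then show ?thesis using e by (auto simp: doubling_weight_def)
qed

section \<open>Uniform bounds for Theta and summation over divisors\<close>

locale theta_parts = positive_parts +
  fixes \<mu> A :: real
  assumes mono_parts: "mono \<Lambda>" and one_part: "1 \<in> range \<Lambda>"
    and mu_pos: "\<mu> > 0" and A_pos: "A > 0"
    and theta_summable: "\<And>t. t > 0 \<Longrightarrow> summable (\<lambda>i. exp (- real (\<Lambda> i) * t))"
    and theta_asymp: "((\<lambda>t. t powr \<mu> * Theta \<Lambda> t) \<longlongrightarrow> A) (at_right 0)"
begin

lemma theta_sums: "t > 0 \<Longrightarrow> (\<lambda>i. exp (- real (\<Lambda> i) * t)) sums Theta \<Lambda> t"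
  unfolding Theta_def by (rule summable_sums[OF theta_summable])

lemma theta_nonneg: "t > 0 \<Longrightarrow> Theta \<Lambda> t \<ge> 0"
  by (rule sums_le[OF _ sums_zero theta_sums]) auto

text \<open>All parts are at least \<open>1\<close>, so each exponential loses at least the factor
  \<open>exp (- (t - s))\<close>.\<close>

lemma theta_decay:
  assumes "0 < s" "s \<le> t"
  shows "Theta \<Lambda> t \<le> exp (- (t - s)) * Theta \<Lambda> s"
proof (rule sums_le[OF _ theta_sums sums_mult[OF theta_sums]])
  fix i
  have "1 * (t - s) \<le> real (\<Lambda> i) * (t - s)"
    using part_pos[of i] assms by (intro mult_right_mono) auto
  then show "exp (- real (\<Lambda> i) * t) \<le> exp (- (t - s)) * exp (- real (\<Lambda> i) * s)"
    unfolding exp_add[symmetric] by (simp add: algebra_simps)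
qed (use assms in auto)

text \<open>The asymptotics control only a neighbourhood of \<open>0\<close>, but dominating the
  terms \<open>Theta \<Lambda> (r * t)\<close> for all \<open>r\<close> takes a bound at every
  argument. Exponential decay covers large arguments and monotonicity the range between.\<close>

lemma theta_bound: "\<exists>C>0. \<forall>t>0. Theta \<Lambda> t \<le> C * t powr (- \<mu>)"
proof -
  have "eventually (\<lambda>t. t powr \<mu> * Theta \<Lambda> t < 2 * A) (at_right 0)"
    by (rule order_tendstoD(2)[OF theta_asymp]) (use A_pos in simp)
  then obtain b where b: "b > 0" "\<forall>t. 0 < t \<longrightarrow> t < b \<longrightarrow> t powr \<mu> * Theta \<Lambda> t < 2 * A"
    unfolding eventually_at_right_field by auto
  have "((\<lambda>t::real. t powr \<mu> * exp (- t)) \<longlongrightarrow> 0) at_top" using mu_pos by real_asymp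
  then have "eventually (\<lambda>t::real. t powr \<mu> * exp (- t) < 1) at_top"
    by (rule order_tendstoD) simp
  then have "eventually (\<lambda>t::real. t powr \<mu> * exp (- t) < 1 \<and> t > 0) at_top"
    using eventually_gt_at_top[of "0::real"] by eventually_elim auto
  then obtain T :: real where T: "\<forall>t\<ge>T. t powr \<mu> * exp (- t) < 1 \<and> t > 0"
    by (auto simp: eventually_at_top_linorder)
  define s where "s = b / 2"
  have s: "s > 0" "s < b" using b by (auto simp: s_def)
  define C where "C = 2 * A + Theta \<Lambda> s * (T powr \<mu> + exp s)"
  have Cs: "C \<ge> 2 * A" "C \<ge> Theta \<Lambda> s * T powr \<mu>" "C \<ge> exp s * Theta \<Lambda> s"
    using theta_nonneg[OF s(1)] A_pos by (auto simp: C_def distrib_left)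
  have "t powr \<mu> * Theta \<Lambda> t \<le> C" if t: "t > 0" for t
  proof -
    consider "t < b" | "b \<le> t" "t \<le> T" | "b \<le> t" "T \<le> t" by linarith
    then show ?thesis
    proof cases
      case 1
      then show ?thesis using b t Cs by fastforce
    next
      case 2
      have "Theta \<Lambda> t \<le> exp (- (t - s)) * Theta \<Lambda> s" using 2 s by (intro theta_decay) auto
      also have "\<dots> \<le> 1 * Theta \<Lambda> s"
        using 2 s theta_nonneg[OF s(1)] by (intro mult_right_mono) auto
      finally have "t powr \<mu> * Theta \<Lambda> t \<le> T powr \<mu> * Theta \<Lambda> s"
        using 2 t mu_pos theta_nonneg[OF t] by (intro mult_mono powr_mono2) auto
      then show ?thesis using Cs by (simp add: mult.commute)
    next
      case 3
      have "Theta \<Lambda> t \<le> exp (- (t - s)) * Theta \<Lambda> s" using 3 s by (intro theta_decay) auto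
      then have "t powr \<mu> * Theta \<Lambda> t \<le> t powr \<mu> * (exp (- (t - s)) * Theta \<Lambda> s)"
        by (intro mult_left_mono) auto
      also have "\<dots> = (t powr \<mu> * exp (- t)) * (exp s * Theta \<Lambda> s)"
        by (simp add: exp_diff exp_minus field_simps)
      also have "\<dots> \<le> 1 * (exp s * Theta \<Lambda> s)"
        using T 3 theta_nonneg[OF s(1)] by (intro mult_right_mono) (auto intro: less_imp_le)
      finally show ?thesis using Cs by simp
    qed
  qed
  then have "\<forall>t>0. Theta \<Lambda> t \<le> C * t powr (- \<mu>)"
    by (simp add: powr_minus field_simps)
  moreover have "C > 0" using Cs A_pos by linarith
  ultimately show ?thesis by blast
qed

lemma weighted_theta_summable:
  assumes "t > 0" "\<sigma> \<ge> 0"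
  shows "summable (\<lambda>n. real (Suc n) powr (- \<sigma>) * Theta \<Lambda> (real (Suc n) * t))"
proof (rule summable_comparison_test')
  show "summable (\<lambda>n. Theta \<Lambda> t * exp (- t) ^ n)"
    using assms by (intro summable_mult summable_geometric) simp
  fix n
  have "t \<le> real (Suc n) * t" using assms by (simp add: algebra_simps)
  then have "Theta \<Lambda> (real (Suc n) * t) \<le> exp (- (real (Suc n) * t - t)) * Theta \<Lambda> t"
    using assms by (intro theta_decay) auto
  also have "exp (- (real (Suc n) * t - t)) = exp (- t) ^ n"
    by (simp add: exp_of_nat_mult[symmetric] algebra_simps)
  finally have *: "Theta \<Lambda> (real (Suc n) * t) \<le> exp (- t) ^ n * Theta \<Lambda> t" .
  have "real (Suc n) powr (- \<sigma>) \<le> 1"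
    using assms powr_mono[of "- \<sigma>" 0 "real (Suc n)"] by simp
  then have "real (Suc n) powr (- \<sigma>) * Theta \<Lambda> (real (Suc n) * t) \<le> 1 * (exp (- t) ^ n * Theta \<Lambda> t)"
    using assms * theta_nonneg by (intro mult_mono) auto
  then show "norm (real (Suc n) powr (- \<sigma>) * Theta \<Lambda> (real (Suc n) * t)) \<le> Theta \<Lambda> t * exp (- t) ^ n"
    using theta_nonneg[of "real (Suc n) * t"] assms by (simp add: abs_mult mult.commute)
qed

lemma weighted_double_has_sum:
  assumes "t > 0" "\<sigma> \<ge> 0"
  shows "((\<lambda>(r, i). real r powr (- \<sigma>) * exp (- (real (r * \<Lambda> i) * t))) has_sum
    (\<Sum>n. real (Suc n) powr (- \<sigma>) * Theta \<Lambda> (real (Suc n) * t))) ({1..} \<times> UNIV)"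
proof -
  define h where "h r = real r powr (- \<sigma>) * Theta \<Lambda> (real r * t)" for r :: nat
  define S where "S = (\<Sum>n. real (Suc n) powr (- \<sigma>) * Theta \<Lambda> (real (Suc n) * t))"
  define f where "f = (\<lambda>(r, i). real r powr (- \<sigma>) * exp (- (real (r * \<Lambda> i) * t)))"
  have "(\<lambda>n. h (Suc n)) sums S"
    unfolding h_def S_def using weighted_theta_summable[OF assms] by (rule summable_sums)
  \<comment> \<open>Passing from index \<open>Suc n\<close> to \<open>n\<close> is free because
    \<open>h 0\<close> contains the factor \<open>0 powr (- \<sigma>) = 0\<close>.\<close>
  then have h: "h sums S" using sums_Suc_iff[of h S] by (simp add: h_def)
  have h_nn: "h n \<ge> 0" for n
    using theta_nonneg[of "real n * t"] assms by (cases "n = 0") (auto simp: h_def)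
  have "(h has_sum S) UNIV"
    using h h_nn by (intro norm_summable_imp_has_sum) (auto simp: sums_iff)
  then have hs: "(h has_sum S) {1..}"
    by (subst has_sum_cong_neutral[where g = h and T = UNIV]) (auto simp: h_def not_le)
  have inner: "((\<lambda>i. f (r, i)) has_sum h r) UNIV" if "r \<in> {1..}" for r
  proof (rule norm_summable_imp_has_sum)
    have "real r * t > 0" using that assms by simp
    from sums_mult[OF theta_sums[OF this], of "real r powr (- \<sigma>)"]
    show *: "(\<lambda>i. f (r, i)) sums h r" by (simp add: f_def h_def mult_ac)
    then show "summable (\<lambda>i. norm (f (r, i)))" by (simp add: f_def sums_iff)
  qed
  have "f summable_on ({1..} \<times> UNIV)"
    by (rule summable_on_SigmaI[OF inner]) (use hs in \<open>auto simp: f_def summable_on_def\<close>)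
  then have "(f has_sum S) ({1..} \<times> UNIV)"
    by (intro has_sum_SigmaI[OF inner hs])
  then show ?thesis by (simp add: f_def S_def)
qed

text \<open>The substitution \<open>v = r * \<Lambda> i\<close> identifies pairs
  \<open>(r, i)\<close> with pairs of a number \<open>v\<close> and a position whose entry divides
  it. The double series is unconditionally summable, so it may be grouped by \<open>r\<close> or by
  \<open>v\<close>.\<close>

lemma divisor_weight_sums:
  assumes "t > 0" "\<sigma> \<ge> 0"
  shows "(\<lambda>v. divisor_weight \<sigma> v * exp (- (real v * t))) sums
    (\<Sum>n. real (Suc n) powr (- \<sigma>) * Theta \<Lambda> (real (Suc n) * t))" (is "_ sums ?S")
proof -
  have "((\<lambda>(v, i). real (v div \<Lambda> i) powr (- \<sigma>) * exp (- (real v * t))) has_sum ?S) (Sigma {1..} (\<lambda>v. {i. \<Lambda> i dvd v}))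
    \<longleftrightarrow> ((\<lambda>(r, i). real r powr (- \<sigma>) * exp (- (real (r * \<Lambda> i) * t))) has_sum ?S) ({1..} \<times> UNIV)"
  proof (rule has_sum_reindex_bij_witness[of _ "\<lambda>(r, i). (r * \<Lambda> i, i)" "\<lambda>(v, i). (v div \<Lambda> i, i)"])
    fix b :: "nat \<times> nat" assume "b \<in> {1..} \<times> UNIV"
    then show "(case case b of (r, i) \<Rightarrow> (r * \<Lambda> i, i) of (v, i) \<Rightarrow> (v div \<Lambda> i, i)) = b"
      "(case b of (r, i) \<Rightarrow> (r * \<Lambda> i, i)) \<in> (SIGMA v:{1..}. {i. \<Lambda> i dvd v})"
      using part_pos by (auto simp: Suc_le_eq split: prod.splits)
  next
    fix a :: "nat \<times> nat" assume "a \<in> (SIGMA v:{1..}. {i. \<Lambda> i dvd v})"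
    then show "(case case a of (v, i) \<Rightarrow> (v div \<Lambda> i, i) of (r, i) \<Rightarrow> (r * \<Lambda> i, i)) = a"
      "(case a of (v, i) \<Rightarrow> (v div \<Lambda> i, i)) \<in> {1..} \<times> UNIV"
      "(case case a of (v, i) \<Rightarrow> (v div \<Lambda> i, i) of (r, i) \<Rightarrow> real r powr (- \<sigma>) * exp (- (real (r * \<Lambda> i) * t))) =
       (case a of (v, i) \<Rightarrow> real (v div \<Lambda> i) powr (- \<sigma>) * exp (- (real v * t)))"
      using dvd_div_pos by (auto simp: Suc_le_eq simp del: of_nat_mult split: prod.splits)
  qed auto
  with weighted_double_has_sum[OF assms]
  have *: "((\<lambda>(v, i). real (v div \<Lambda> i) powr (- \<sigma>) * exp (- (real v * t))) has_sum ?S) (Sigma {1..} (\<lambda>v. {i. \<Lambda> i dvd v}))"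
    by blast
  have "((\<lambda>v. divisor_weight \<sigma> v * exp (- (real v * t))) has_sum ?S) {1..}"
  proof (rule has_sum_SigmaD[OF *])
    fix v :: nat assume "v \<in> {1..}"
    then have fin: "finite {i. \<Lambda> i dvd v}" by (intro finite_dvd) auto
    show "((\<lambda>y. case (v, y) of (v, i) \<Rightarrow> real (v div \<Lambda> i) powr (- \<sigma>) * exp (- (real v * t))) has_sum
          divisor_weight \<sigma> v * exp (- (real v * t))) {i. \<Lambda> i dvd v}"
      using has_sum_finite[OF fin, of "\<lambda>i. real (v div \<Lambda> i) powr (- \<sigma>) * exp (- (real v * t))"]
      by (simp add: divisor_weight_def sum_distrib_right)
  qed
  then have "((\<lambda>v. divisor_weight \<sigma> v * exp (- (real v * t))) has_sum ?S) UNIV"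
    by (subst has_sum_cong_neutral[where g = "\<lambda>v. divisor_weight \<sigma> v * exp (- (real v * t))" and T = "{1..}"])
      (auto simp: not_le)
  then show ?thesis by (rule has_sum_imp_sums)
qed

lemma disc_summable_divisor_weight: "\<sigma> \<ge> 0 \<Longrightarrow> disc_summable (divisor_weight \<sigma>)"
  by (rule disc_summableI) (use divisor_weight_sums divisor_weight_nonneg in \<open>auto simp: sums_iff\<close>)

lemma lap_divisor_weight:
  assumes "t > 0" "\<sigma> \<ge> 0"
  shows "lap (divisor_weight \<sigma>) t = (\<Sum>n. real (Suc n) powr (- \<sigma>) * Theta \<Lambda> (real (Suc n) * t))"
  using divisor_weight_sums[OF assms] lap_sums[OF disc_summable_divisor_weight[OF assms(2)] assms(1)] sums_unique2
  by blast

text \<open>After scaling, the \<open>r\<close>-th term tends to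
  \<open>A * r powr (- (\<mu> + \<sigma>))\<close> and is dominated by a multiple of the same power.
  The case \<open>\<sigma> = 1\<close> feeds the saddle point, the case \<open>\<sigma> = 0\<close>
  the mean number of summands when \<open>\<mu> > 1\<close>.\<close>

lemma lap_divisor_weight_asymp:
  assumes "\<sigma> \<ge> 0" "\<mu> + \<sigma> > 1"
  shows "((\<lambda>t. t powr \<mu> * lap (divisor_weight \<sigma>) t) \<longlongrightarrow> A * riemann_zeta (\<mu> + \<sigma>)) (at_right 0)"
proof -
  obtain C where C: "C > 0" "\<forall>t>0. Theta \<Lambda> t \<le> C * t powr (- \<mu>)" using theta_bound by blast
  define a where "a n t = t powr \<mu> * (real (Suc n) powr (- \<sigma>) * Theta \<Lambda> (real (Suc n) * t))" for n :: nat and t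
  have aeq: "a n t = real (Suc n) powr (- (\<mu> + \<sigma>)) * ((real (Suc n) * t) powr \<mu> * Theta \<Lambda> (real (Suc n) * t))"
    if "t > 0" for n t
  proof -
    have "real (Suc n) powr (- (\<mu> + \<sigma>)) * (real (Suc n) * t) powr \<mu> = real (Suc n) powr (- (\<mu> + \<sigma>)) * real (Suc n) powr \<mu> * t powr \<mu>"
      using that by (simp only: powr_mult mult.assoc)
    also have "real (Suc n) powr (- (\<mu> + \<sigma>)) * real (Suc n) powr \<mu> = real (Suc n) powr (- \<sigma>)"
      unfolding powr_add[symmetric] by simp
    finally show ?thesis unfolding a_def by (simp add: mult_ac)
  qed
  have "((\<lambda>t. suminf (\<lambda>n. a n t)) \<longlongrightarrow> suminf (\<lambda>n. real (Suc n) powr (- (\<mu> + \<sigma>)) * A)) (at_right 0)"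
  proof (rule tannerys_theorem[THEN conjunct2, THEN conjunct2])
    fix n :: nat
    have "((\<lambda>t. real (Suc n) powr (- (\<mu> + \<sigma>)) * ((real (Suc n) * t) powr \<mu> * Theta \<Lambda> (real (Suc n) * t)))
       \<longlongrightarrow> real (Suc n) powr (- (\<mu> + \<sigma>)) * A) (at_right 0)"
      by (intro tendsto_mult tendsto_const filterlim_compose[OF theta_asymp filterlim_mult_at_right_0]) simp
    moreover have "eventually (\<lambda>t. real (Suc n) powr (- (\<mu> + \<sigma>)) * ((real (Suc n) * t) powr \<mu> * Theta \<Lambda> (real (Suc n) * t)) = a n t) (at_right 0)"
      using at_right_0_pos by eventually_elim (simp only: aeq)
    ultimately show "((\<lambda>t. a n t) \<longlongrightarrow> real (Suc n) powr (- (\<mu> + \<sigma>)) * A) (at_right 0)"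
      by (rule Lim_transform_eventually)
  next
    have "eventually (\<lambda>t::real. \<forall>n. norm (a n t) \<le> real (Suc n) powr (- (\<mu> + \<sigma>)) * C) (at_right 0)"
      using at_right_0_pos
    proof eventually_elim
      case (elim t)
      show ?case
      proof
        fix n :: nat
        have st: "real (Suc n) * t > 0" using elim by simp
        have "(real (Suc n) * t) powr \<mu> * Theta \<Lambda> (real (Suc n) * t) \<le> C"
          using C(2)[rule_format, OF st] st by (simp add: powr_minus field_simps)
        then show "norm (a n t) \<le> real (Suc n) powr (- (\<mu> + \<sigma>)) * C"
          unfolding aeq[OF elim] using theta_nonneg[OF st] by (simp add: abs_mult mult_left_mono)
      qed
    qed
    then show "eventually (\<lambda>(n, t). norm (a n t) \<le> real (Suc n) powr (- (\<mu> + \<sigma>)) * C) (at_top \<times>\<^sub>F at_right 0)"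
      by (subst (asm) eventually_prod2[of "at_top :: nat filter", symmetric]) (auto elim: eventually_mono)
    show "summable (\<lambda>n. real (Suc n) powr (- (\<mu> + \<sigma>)) * C)"
      using riemann_zeta_sums(1)[OF assms(2)] by (intro summable_mult2) (auto simp: sums_iff)
  qed simp
  moreover have "suminf (\<lambda>n. real (Suc n) powr (- (\<mu> + \<sigma>)) * A) = A * riemann_zeta (\<mu> + \<sigma>)"
    using sums_mult2[OF riemann_zeta_sums(1)[OF assms(2)], of A] by (simp add: sums_iff mult.commute)
  ultimately have "((\<lambda>t. suminf (\<lambda>n. a n t)) \<longlongrightarrow> A * riemann_zeta (\<mu> + \<sigma>)) (at_right 0)" by simp
  moreover have "eventually (\<lambda>t. suminf (\<lambda>n. a n t) = t powr \<mu> * lap (divisor_weight \<sigma>) t) (at_right 0)"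
    using at_right_0_pos
  proof eventually_elim
    case (elim t)
    show ?case unfolding lap_divisor_weight[OF elim assms(1)] a_def
      by (rule suminf_mult[OF weighted_theta_summable[OF elim assms(1)]])
  qed
  ultimately show ?thesis by (rule Lim_transform_eventually)
qed

text \<open>At \<open>t = 1 / \<Lambda> i\<close> each of the first \<open>i + 1\<close> terms of
  \<open>Theta\<close> is at least \<open>exp (- 1)\<close>, by monotonicity of
  \<open>\<Lambda>\<close>. With the upper bound on \<open>Theta\<close> this makes
  \<open>\<Lambda> i\<close> grow at least like \<open>i powr (1 / \<mu>)\<close>, with exponent
  above \<open>1\<close>.\<close>

lemma summable_inverse_parts:
  assumes "\<mu> < 1"
  shows "summable (\<lambda>i. 1 / real (\<Lambda> i))"
proof -
  obtain C where C: "C > 0" "\<forall>t>0. Theta \<Lambda> t \<le> C * t powr (- \<mu>)" using theta_bound by blast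
  have "summable (\<lambda>i. (exp 1 * C) powr (1 / \<mu>) * real (Suc i) powr (- (1 / \<mu>)))"
    using riemann_zeta_sums(1)[of "1 / \<mu>"] assms mu_pos by (intro summable_mult) (auto simp: sums_iff)
  then show ?thesis
  proof (rule summable_comparison_test')
    fix i
    define x where "x = real (\<Lambda> i)"
    have x: "x > 0" using part_pos[of i] by (simp add: x_def)
    have "(\<Sum>j\<le>i. exp (- 1)) \<le> (\<Sum>j\<le>i. exp (- real (\<Lambda> j) * (1 / x)))"
      using x monoD[OF mono_parts] by (intro sum_mono) (auto simp: x_def field_simps)
    also have "\<dots> \<le> Theta \<Lambda> (1 / x)"
      unfolding Theta_def using x by (intro sum_le_suminf theta_summable) auto
    also have "\<dots> \<le> C * (1 / x) powr (- \<mu>)" using C x by simp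
    also have "\<dots> = C * x powr \<mu>" using x by (simp add: powr_divide powr_minus)
    finally have "real (Suc i) \<le> exp 1 * C * x powr \<mu>" by (simp add: exp_minus field_simps)
    then have "real (Suc i) powr (1 / \<mu>) \<le> (exp 1 * C * x powr \<mu>) powr (1 / \<mu>)"
      using mu_pos by (intro powr_mono2) auto
    also have "\<dots> = (exp 1 * C) powr (1 / \<mu>) * x"
      using mu_pos C x by (simp add: powr_mult powr_powr)
    finally show "norm (1 / real (\<Lambda> i)) \<le> (exp 1 * C) powr (1 / \<mu>) * real (Suc i) powr (- (1 / \<mu>))"
      using x by (simp add: x_def powr_minus field_simps)
  qed
qed

text \<open>Summing the double series over \<open>r\<close> first gives a geometric series for each
  part.\<close>

lemma divisor_count_sums:
  assumes "t > 0"
  shows "(\<lambda>i. 1 / (exp (real (\<Lambda> i) * t) - 1)) sums lap (divisor_weight 0) t"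
proof -
  have "((\<lambda>(i, r). real r powr (- 0) * exp (- (real (r * \<Lambda> i) * t))) has_sum lap (divisor_weight 0) t) (UNIV \<times> {1..})"
    using weighted_double_has_sum[OF assms, of 0] has_sum_swap[where A = "{1..}" and B = UNIV
        and f = "\<lambda>(r, i). real r powr (- 0) * exp (- (real (r * \<Lambda> i) * t))" and S = "lap (divisor_weight 0) t"]
    unfolding lap_divisor_weight[OF assms order_refl] by (simp add: case_prod_unfold)
  then have "((\<lambda>i. 1 / (exp (real (\<Lambda> i) * t) - 1)) has_sum lap (divisor_weight 0) t) UNIV"
  proof (rule has_sum_SigmaD)
    fix i
    define q where "q = exp (- (real (\<Lambda> i) * t))"
    have q: "0 < q" "q < 1" using part_pos[of i] assms by (auto simp: q_def)
    have qn: "exp (- (real (r * \<Lambda> i) * t)) = q ^ r" for r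
      by (simp add: q_def exp_of_nat_mult[symmetric] mult_ac)
    have "(\<lambda>r. q ^ Suc r) sums (q * (1 / (1 - q)))"
      using sums_mult[OF geometric_sums[of q], of q] q by simp
    then have "(\<lambda>r. if r = 0 then 0 else q ^ r) sums (q * (1 / (1 - q)))"
      using sums_Suc_iff[of "\<lambda>r. if r = 0 then 0 else q ^ r" "q * (1 / (1 - q))"] by simp
    then have "((\<lambda>r. if r = 0 then 0 else q ^ r) has_sum (q * (1 / (1 - q)))) UNIV"
      using q by (intro norm_summable_imp_has_sum) (auto simp: sums_iff if_distrib cong: if_cong)
    then have "((\<lambda>r. real r powr (- 0) * q ^ r) has_sum (q * (1 / (1 - q)))) {1..}"
      by (subst has_sum_cong_neutral[where g = "\<lambda>r. if r = 0 then 0 else q ^ r" and T = UNIV]) auto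
    moreover have "q * (1 / (1 - q)) = 1 / (exp (real (\<Lambda> i) * t) - 1)"
      using part_pos[of i] assms by (simp add: q_def exp_minus field_simps)
    ultimately show "((\<lambda>y. case (i, y) of (i, r) \<Rightarrow> real r powr (- 0) * exp (- (real (r * \<Lambda> i) * t)))
        has_sum 1 / (exp (real (\<Lambda> i) * t) - 1)) {1..}"
      unfolding prod.case qn by simp
  qed
  then show ?thesis by (rule has_sum_imp_sums)
qed

text \<open>After multiplication by \<open>t\<close> each term tends to
  \<open>1 / \<Lambda> i\<close> and is dominated by it, since
  \<open>exp x - 1 \<ge> x\<close>.\<close>

lemma lap_divisor_count_sublinear:
  assumes "\<mu> < 1"
  shows "((\<lambda>t. t * lap (divisor_weight 0) t) \<longlongrightarrow> (\<Sum>i. 1 / real (\<Lambda> i))) (at_right 0)"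
proof -
  have "((\<lambda>t. suminf (\<lambda>i. t * (1 / (exp (real (\<Lambda> i) * t) - 1)))) \<longlongrightarrow> (\<Sum>i. 1 / real (\<Lambda> i))) (at_right 0)"
  proof (rule tannerys_theorem[THEN conjunct2, THEN conjunct2])
    fix i
    have "real (\<Lambda> i) > 0" using part_pos[of i] by simp
    then have "((\<lambda>t. t * (1 / (exp (real (\<Lambda> i) * t) - 1))) \<longlongrightarrow> inverse (real (\<Lambda> i))) (at_right 0)"
      by real_asymp
    then show "((\<lambda>t. t * (1 / (exp (real (\<Lambda> i) * t) - 1))) \<longlongrightarrow> 1 / real (\<Lambda> i)) (at_right 0)"
      by (simp only: inverse_eq_divide)
  next
    have "eventually (\<lambda>t::real. \<forall>i. norm (t * (1 / (exp (real (\<Lambda> i) * t) - 1))) \<le> 1 / real (\<Lambda> i)) (at_right 0)"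
      using at_right_0_pos
    proof eventually_elim
      case (elim t)
      show ?case
      proof
        fix i
        have "real (\<Lambda> i) * t \<le> exp (real (\<Lambda> i) * t) - 1"
          using exp_ge_add_one_self[of "real (\<Lambda> i) * t"] by linarith
        moreover have "0 < real (\<Lambda> i) * t" using elim part_pos[of i] by simp
        ultimately show "norm (t * (1 / (exp (real (\<Lambda> i) * t) - 1))) \<le> 1 / real (\<Lambda> i)"
          using elim part_pos[of i] by (simp add: field_simps)
      qed
    qed
    then show "eventually (\<lambda>(i, t). norm (t * (1 / (exp (real (\<Lambda> i) * t) - 1))) \<le> 1 / real (\<Lambda> i)) (at_top \<times>\<^sub>F at_right 0)"
      by (subst (asm) eventually_prod2[of "at_top :: nat filter", symmetric]) (auto elim: eventually_mono)
  qed (use summable_inverse_parts[OF assms] in auto)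
  then show ?thesis
  proof (rule Lim_transform_eventually)
    show "eventually (\<lambda>t. suminf (\<lambda>i. t * (1 / (exp (real (\<Lambda> i) * t) - 1))) = t * lap (divisor_weight 0) t) (at_right 0)"
      using at_right_0_pos
      by eventually_elim (use sums_mult[OF divisor_count_sums] in \<open>auto simp: sums_iff\<close>)
  qed
qed

text \<open>
  The comparison function \<open>A exp (- x) / x\<close> is chosen because its sum over the
  multiples of \<open>t\<close> is the closed form \<open>- (A / t) ln (1 - exp (- t))\<close>.
\<close>

lemma theta_comparison:
  assumes "\<mu> = 1" "\<epsilon> > 0"
  shows "\<exists>M. \<forall>x>0. \<bar>Theta \<Lambda> x - A * (exp (- x) / x)\<bar> \<le> \<epsilon> * (exp (- x) / x) + M * exp (- x)"
proof -
  have "((\<lambda>x. (x powr \<mu> * Theta \<Lambda> x) * exp x) \<longlongrightarrow> A * exp 0) (at_right 0)"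
    by (intro tendsto_intros theta_asymp)
  then have "((\<lambda>x. x powr \<mu> * Theta \<Lambda> x * exp x - A) \<longlongrightarrow> 0) (at_right 0)"
    by (simp add: Lim_null[symmetric])
  then have "eventually (\<lambda>x. \<bar>x powr \<mu> * Theta \<Lambda> x * exp x - A\<bar> < \<epsilon>) (at_right 0)"
    using order_tendstoD(2)[OF tendsto_rabs_zero assms(2)] by blast
  then obtain b where b: "b > 0" "\<forall>x. 0 < x \<longrightarrow> x < b \<longrightarrow> \<bar>x powr \<mu> * Theta \<Lambda> x * exp x - A\<bar> < \<epsilon>"
    unfolding eventually_at_right_field by auto
  define M where "M = exp b * Theta \<Lambda> b + A / b"
  have M: "M \<ge> 0" using theta_nonneg[OF b(1)] A_pos b by (simp add: M_def)
  have "\<bar>Theta \<Lambda> x - A * (exp (- x) / x)\<bar> \<le> \<epsilon> * (exp (- x) / x) + M * exp (- x)" if x: "x > 0" for x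
  proof (cases "x < b")
    case True
    have "Theta \<Lambda> x - A * (exp (- x) / x) = (x powr \<mu> * Theta \<Lambda> x * exp x - A) * (exp (- x) / x)"
      using x assms(1) by (simp add: exp_minus field_simps)
    also have "\<bar>\<dots>\<bar> = \<bar>x powr \<mu> * Theta \<Lambda> x * exp x - A\<bar> * (exp (- x) / x)"
      using x by (simp add: abs_mult)
    also have "\<dots> \<le> \<epsilon> * (exp (- x) / x)"
      using b(2) x True by (intro mult_right_mono less_imp_le) auto
    also have "\<dots> \<le> \<epsilon> * (exp (- x) / x) + M * exp (- x)" using M by simp
    finally show ?thesis .
  next
    case False
    have "Theta \<Lambda> x \<le> exp (- (x - b)) * Theta \<Lambda> b" using False b by (intro theta_decay) auto
    also have "\<dots> = exp b * Theta \<Lambda> b * exp (- x)" by (simp add: exp_diff exp_minus field_simps)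
    finally have 1: "Theta \<Lambda> x \<le> exp b * Theta \<Lambda> b * exp (- x)" .
    have "A * (exp (- x) / x) \<le> A * (exp (- x) / b)"
      using A_pos False b x by (intro mult_left_mono divide_left_mono) auto
    then have 2: "A * (exp (- x) / x) \<le> A / b * exp (- x)" by simp
    have "0 \<le> \<epsilon> * (exp (- x) / x)" "0 \<le> A * (exp (- x) / x)" "0 \<le> Theta \<Lambda> x"
      "0 \<le> A / b * exp (- x)" "0 \<le> exp b * Theta \<Lambda> b * exp (- x)"
      using assms x A_pos b theta_nonneg[OF x] theta_nonneg[OF b(1)] by auto
    then show ?thesis using 1 2 unfolding M_def distrib_right by linarith
  qed
  then show ?thesis by blast
qed

text \<open>Summing the comparison over the multiples of \<open>t\<close> leaves an error
  \<open>\<epsilon> * E t + M * G t\<close>. Here \<open>E t\<close> is of order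
  \<open>ln (1 / t) / t\<close> and \<open>G t\<close> of order \<open>1 / t\<close>, so the
  constant \<open>M\<close>, which depends on \<open>\<epsilon>\<close>, disappears in the limit
  before \<open>\<epsilon>\<close> tends to \<open>0\<close>.\<close>

lemma lap_divisor_count_critical:
  assumes "\<mu> = 1"
  shows "((\<lambda>t. t / ln (1 / t) * lap (divisor_weight 0) t) \<longlongrightarrow> A) (at_right 0)"
proof -
  define E where "E t = (- ln (1 - exp (- t))) / t" for t :: real
  define G where "G t = exp (- t) / (1 - exp (- t))" for t :: real
  have bound: "\<exists>M. \<forall>t>0. \<bar>lap (divisor_weight 0) t - A * E t\<bar> \<le> \<epsilon> * E t + M * G t" if \<epsilon>: "\<epsilon> > 0" for \<epsilon>
  proof -
    obtain M where M: "\<forall>x>0. \<bar>Theta \<Lambda> x - A * (exp (- x) / x)\<bar> \<le> \<epsilon> * (exp (- x) / x) + M * exp (- x)"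
      using theta_comparison[OF assms \<epsilon>] by blast
    have "\<bar>lap (divisor_weight 0) t - A * E t\<bar> \<le> \<epsilon> * E t + M * G t" if t: "t > 0" for t
    proof -
      define x where "x n = real (Suc n) * t" for n
      have x: "x n > 0" for n using t by (simp add: x_def)
      have Es: "(\<lambda>n. exp (- x n) / x n) sums E t"
      proof -
        have "(\<lambda>v. 1 / real v * exp (- (real v * t))) sums (- ln (1 - exp (- t)))"
          using lap_sums[OF disc_summable_harmonic[of 1] t] lap_harmonic[OF t, of 1] by simp
        then have "(\<lambda>v. 1 / real (Suc v) * exp (- (real (Suc v) * t))) sums (- ln (1 - exp (- t)))"
          using sums_Suc_iff[of "\<lambda>v. 1 / real v * exp (- (real v * t))"] by simp
        from sums_divide[OF this, of t] show ?thesis by (simp add: E_def x_def mult.commute)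
      qed
      have Gs: "(\<lambda>n. exp (- x n)) sums G t"
      proof -
        have "(\<lambda>n. exp (- t) * exp (- t) ^ n) sums (exp (- t) * (1 / (1 - exp (- t))))"
          using t by (intro sums_mult geometric_sums) simp
        moreover have "exp (- t) * exp (- t) ^ n = exp (- x n)" for n
          by (simp add: x_def exp_of_nat_mult[symmetric] exp_add[symmetric] algebra_simps)
        ultimately show ?thesis by (simp add: G_def)
      qed
      have "(\<lambda>n. Theta \<Lambda> (x n)) sums lap (divisor_weight 0) t"
        using weighted_theta_summable[OF t, of 0] lap_divisor_weight[OF t, of 0]
        by (simp add: x_def sums_iff)
      from sums_diff[OF this sums_mult[OF Es, of A]]
      have 1: "(\<lambda>n. Theta \<Lambda> (x n) - A * (exp (- x n) / x n)) sums (lap (divisor_weight 0) t - A * E t)" .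
      have 2: "(\<lambda>n. \<epsilon> * (exp (- x n) / x n) + M * exp (- x n)) sums (\<epsilon> * E t + M * G t)"
        by (intro sums_add sums_mult Es Gs)
      have "norm (\<Sum>n. Theta \<Lambda> (x n) - A * (exp (- x n) / x n)) \<le> (\<Sum>n. \<epsilon> * (exp (- x n) / x n) + M * exp (- x n))"
        by (rule norm_suminf_le) (use M x 2 in \<open>auto simp: sums_iff\<close>)
      then show ?thesis using 1 2 by (simp add: sums_iff)
    qed
    then show ?thesis by blast
  qed
  have E: "((\<lambda>t. t / ln (1 / t) * E t) \<longlongrightarrow> 1) (at_right 0)" unfolding E_def by real_asymp
  have G: "((\<lambda>t. t / ln (1 / t) * G t) \<longlongrightarrow> 0) (at_right 0)" unfolding G_def by real_asymp
  have pos: "eventually (\<lambda>t::real. 0 < t / ln (1 / t) \<and> 0 < t) (at_right 0)"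
    by (auto simp: eventually_at_right_field intro!: exI[of _ 1])
  have small: "eventually (\<lambda>h::real. 0 < h) (at_right 0)" by (simp add: eventually_at_right_less)
  show ?thesis
  proof (rule tendsto_squeeze_family[where u = "\<lambda>h. A + h" and l = "\<lambda>h. A - h"])
    show "eventually (\<lambda>h. \<exists>U. eventually (\<lambda>t. t / ln (1 / t) * lap (divisor_weight 0) t \<le> U t) (at_right 0) \<and> (U \<longlongrightarrow> A + h) (at_right 0)) (at_right 0)"
      using small
    proof eventually_elim
      case (elim h)
      obtain M where M: "\<forall>t>0. \<bar>lap (divisor_weight 0) t - A * E t\<bar> \<le> h * E t + M * G t"
        using bound[OF elim] by blast
      define U where "U t = (A + h) * (t / ln (1 / t) * E t) + M * (t / ln (1 / t) * G t)" for t
      have "(U \<longlongrightarrow> (A + h) * 1 + M * 0) (at_right 0)"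
        unfolding U_def by (intro tendsto_intros E G)
      moreover have "eventually (\<lambda>t. t / ln (1 / t) * lap (divisor_weight 0) t \<le> U t) (at_right 0)"
        using pos
      proof eventually_elim
        case (elim t)
        have "lap (divisor_weight 0) t \<le> A * E t + (h * E t + M * G t)" using M elim by (smt (verit))
        then have "t / ln (1 / t) * lap (divisor_weight 0) t \<le> t / ln (1 / t) * (A * E t + (h * E t + M * G t))"
          using elim by (intro mult_left_mono) auto
        also have "\<dots> = U t" unfolding U_def by (simp only: distrib_left distrib_right mult_ac add_ac)
        finally show ?case .
      qed
      ultimately show ?case by (intro exI[of _ U]) auto
    qed
    show "eventually (\<lambda>h. \<exists>U. eventually (\<lambda>t. U t \<le> t / ln (1 / t) * lap (divisor_weight 0) t) (at_right 0) \<and> (U \<longlongrightarrow> A - h) (at_right 0)) (at_right 0)"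
      using small
    proof eventually_elim
      case (elim h)
      obtain M where M: "\<forall>t>0. \<bar>lap (divisor_weight 0) t - A * E t\<bar> \<le> h * E t + M * G t"
        using bound[OF elim] by blast
      define U where "U t = (A - h) * (t / ln (1 / t) * E t) - M * (t / ln (1 / t) * G t)" for t
      have "(U \<longlongrightarrow> (A - h) * 1 - M * 0) (at_right 0)"
        unfolding U_def by (intro tendsto_intros E G)
      moreover have "eventually (\<lambda>t. U t \<le> t / ln (1 / t) * lap (divisor_weight 0) t) (at_right 0)"
        using pos
      proof eventually_elim
        case (elim t)
        have "A * E t - (h * E t + M * G t) \<le> lap (divisor_weight 0) t" using M elim by (smt (verit))
        then have "t / ln (1 / t) * (A * E t - (h * E t + M * G t)) \<le> t / ln (1 / t) * lap (divisor_weight 0) t"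
          using elim by (intro mult_left_mono) auto
        moreover have "t / ln (1 / t) * (A * E t - (h * E t + M * G t)) = U t"
          unfolding U_def by (simp only: right_diff_distrib left_diff_distrib distrib_left mult_ac)
        ultimately show ?case by simp
      qed
      ultimately show ?case by (intro exI[of _ U]) auto
    qed
  qed (auto intro!: tendsto_eq_intros)
qed

end

section \<open>The expected number of summands\<close>

context theta_parts
begin

lemma growth: "exp_growth (divisor_weight 1) \<mu> (A * riemann_zeta (\<mu> + 1))"
proof
  show "((\<lambda>t. t powr \<mu> * lap (divisor_weight 1) t) \<longlongrightarrow> A * riemann_zeta (\<mu> + 1)) (at_right 0)"
    using mu_pos by (intro lap_divisor_weight_asymp) auto
  show "0 < A * riemann_zeta (\<mu> + 1)" using A_pos riemann_zeta_sums(2)[of "\<mu> + 1"] mu_pos by simp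
qed (use divisor_weight_nonneg disc_summable_divisor_weight mu_pos in auto)

lemma expected_summands_asymp_aux:
  "\<exists>\<tau>. filterlim \<tau> (at_right 0) sequentially \<and>
     (\<lambda>n. real n * \<tau> n powr (\<mu> + 1)) \<longlonglongrightarrow> \<mu> * (A * riemann_zeta (\<mu> + 1)) \<and>
     (doubling_weight (divisor_weight 0) \<longrightarrow>
       (\<lambda>n. expected_summands \<Lambda> n / lap (divisor_weight 0) (\<tau> n)) \<longlonglongrightarrow> 1)"
proof -
  interpret exp_growth "divisor_weight 1" \<mu> "A * riemann_zeta (\<mu> + 1)" by (rule growth)
  obtain i where i: "\<Lambda> i = 1" using one_part by auto
  \<comment> \<open>Any integer above \<open>1 + \<mu> / 2\<close> can serve as the number of
    smoothings.\<close>
  interpret exp_gf "divisor_weight 1" \<mu> "A * riemann_zeta (\<mu> + 1)" pcount "nat \<lceil>\<mu>\<rceil> + 2"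
  proof
    show "1 + \<mu> / 2 < real (nat \<lceil>\<mu>\<rceil> + 2)" using mu_pos by linarith
  qed (use pcount_recurrence pcount_0 mono_pcount[OF i] in auto)
  obtain \<tau> where sad: "saddle_sequence \<tau>" and N\<tau>: "eventually (\<lambda>n. N (\<tau> n) = real n) sequentially"
    and lim: "(\<lambda>n. real n * \<tau> n powr (\<mu> + 1)) \<longlonglongrightarrow> \<mu> * (A * riemann_zeta (\<mu> + 1))"
    using saddle_exists by blast
  interpret saddle_sequence \<tau> by (rule sad)
  have "filterlim \<tau> (at_right 0) sequentially"
    using tau_0 tau_pos by (auto simp: filterlim_at elim: eventually_mono)
  moreover have "(\<lambda>n. expected_summands \<Lambda> n / lap (divisor_weight 0) (\<tau> n)) \<longlonglongrightarrow> 1"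
    if "doubling_weight (divisor_weight 0)"
    using weighted_asymp[OF sad N\<tau> that]
    by (simp add: expected_summands_eq mult.commute[of "lap (divisor_weight 0) _"])
  ultimately show ?thesis using lim by blast
qed

text \<open>Solving \<open>n = \<mu> A \<zeta>(\<mu> + 1) \<tau>\<^sup>-\<^sup>\<mu>\<^sup>-\<^sup>1\<close> for \<open>1 / \<tau>\<close>.\<close>

definition scale :: "nat \<Rightarrow> real" where
  "scale n = (real n / (riemann_zeta (\<mu> + 1) * \<mu> * A)) powr (1 / (\<mu> + 1))"

text \<open>The saddle point is defined only implicitly, so results are transferred through
  \<open>scale n * \<tau> n \<longlonglongrightarrow> 1\<close>. The three regimes differ only in
  the gauge function \<open>\<phi>\<close> that normalizes
  \<open>lap (divisor_weight 0)\<close>.\<close>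

lemma expected_summands_asymp:
  assumes lim: "((\<lambda>t. \<phi> t * lap (divisor_weight 0) t) \<longlongrightarrow> l) (at_right 0)" and l: "l > 0"
    and \<phi>: "eventually (\<lambda>t. \<phi> t > 0) (at_right 0)" "eventually (\<lambda>t. \<phi> t \<le> K * \<phi> (t / 2)) (at_right 0)"
    and K: "K > 0"
  shows "\<exists>\<tau>. filterlim \<tau> (at_right 0) sequentially \<and> (\<lambda>n. scale n * \<tau> n) \<longlonglongrightarrow> 1 \<and>
     (\<lambda>n. \<phi> (\<tau> n) * expected_summands \<Lambda> n) \<longlonglongrightarrow> l"
proof -
  have dw: "doubling_weight (divisor_weight 0)"
    by (rule doubling_weightI[OF disc_summable_divisor_weight[OF order_refl] divisor_weight_nonneg lim l \<phi> K])
  obtain \<tau> where \<tau>: "filterlim \<tau> (at_right 0) sequentially"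
    and n\<tau>: "(\<lambda>n. real n * \<tau> n powr (\<mu> + 1)) \<longlonglongrightarrow> \<mu> * (A * riemann_zeta (\<mu> + 1))"
    and m: "(\<lambda>n. expected_summands \<Lambda> n / lap (divisor_weight 0) (\<tau> n)) \<longlonglongrightarrow> 1"
    using expected_summands_asymp_aux dw by blast
  have \<tau>_pos: "eventually (\<lambda>n. \<tau> n > 0) sequentially"
    using \<tau> by (auto simp: filterlim_at elim: eventually_mono)
  define b where "b = riemann_zeta (\<mu> + 1) * \<mu> * A"
  have b: "b > 0" using A_pos riemann_zeta_sums(2)[of "\<mu> + 1"] mu_pos by (simp add: b_def)
  have "(\<lambda>n. (real n * \<tau> n powr (\<mu> + 1) / b) powr (1 / (\<mu> + 1))) \<longlonglongrightarrow> (b / b) powr (1 / (\<mu> + 1))"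
    using n\<tau> b by (intro tendsto_intros) (auto simp: b_def mult_ac)
  then have "(\<lambda>n. (real n * \<tau> n powr (\<mu> + 1) / b) powr (1 / (\<mu> + 1))) \<longlonglongrightarrow> 1" using b by simp
  moreover have "eventually (\<lambda>n. (real n * \<tau> n powr (\<mu> + 1) / b) powr (1 / (\<mu> + 1)) = scale n * \<tau> n) sequentially"
    using \<tau>_pos
  proof eventually_elim
    case (elim n)
    have "(real n * \<tau> n powr (\<mu> + 1) / b) powr (1 / (\<mu> + 1)) = (real n / b * \<tau> n powr (\<mu> + 1)) powr (1 / (\<mu> + 1))"
      by simp
    also have "\<dots> = (real n / b) powr (1 / (\<mu> + 1)) * (\<tau> n powr (\<mu> + 1)) powr (1 / (\<mu> + 1))"
      by (rule powr_mult)
    also have "(\<tau> n powr (\<mu> + 1)) powr (1 / (\<mu> + 1)) = \<tau> n"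
      using elim mu_pos by (simp add: powr_powr)
    finally show ?case by (simp add: scale_def b_def)
  qed
  ultimately have sc: "(\<lambda>n. scale n * \<tau> n) \<longlonglongrightarrow> 1" by (rule Lim_transform_eventually)
  have "(\<lambda>n. (expected_summands \<Lambda> n / lap (divisor_weight 0) (\<tau> n)) * (\<phi> (\<tau> n) * lap (divisor_weight 0) (\<tau> n))) \<longlonglongrightarrow> 1 * l"
    by (intro tendsto_mult m filterlim_compose[OF lim \<tau>])
  moreover have "eventually (\<lambda>n. (expected_summands \<Lambda> n / lap (divisor_weight 0) (\<tau> n)) * (\<phi> (\<tau> n) * lap (divisor_weight 0) (\<tau> n))
     = \<phi> (\<tau> n) * expected_summands \<Lambda> n) sequentially"
  proof -
    have "eventually (\<lambda>n. \<phi> (\<tau> n) * lap (divisor_weight 0) (\<tau> n) > 0) sequentially"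
      by (rule order_tendstoD(1)[OF filterlim_compose[OF lim \<tau>] l])
    then show ?thesis by eventually_elim auto
  qed
  ultimately have "(\<lambda>n. \<phi> (\<tau> n) * expected_summands \<Lambda> n) \<longlonglongrightarrow> l"
    using Lim_transform_eventually by fastforce
  with \<tau> sc show ?thesis by blast
qed

lemma expected_summands_sublinear:
  assumes "\<mu> < 1"
  shows "(\<lambda>n. expected_summands \<Lambda> n / ((\<Sum>i. 1 / real (\<Lambda> i)) * scale n)) \<longlonglongrightarrow> 1"
proof -
  define Z where "Z = (\<Sum>i. 1 / real (\<Lambda> i))"
  have Z: "Z > 0"
    unfolding Z_def by (rule suminf_pos[OF summable_inverse_parts[OF assms]]) (simp add: part_pos)
  obtain \<tau> where \<tau>: "filterlim \<tau> (at_right 0) sequentially" "(\<lambda>n. scale n * \<tau> n) \<longlonglongrightarrow> 1"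
     "(\<lambda>n. \<tau> n * expected_summands \<Lambda> n) \<longlonglongrightarrow> Z"
    using expected_summands_asymp[of "\<lambda>t. t" Z 2] lap_divisor_count_sublinear[OF assms] Z
    by (auto simp: Z_def eventually_at_right_less)
  have \<tau>_pos: "eventually (\<lambda>n. \<tau> n > 0) sequentially"
    using \<tau> by (auto simp: filterlim_at elim: eventually_mono)
  have "(\<lambda>n. (\<tau> n * expected_summands \<Lambda> n) / (Z * (scale n * \<tau> n))) \<longlonglongrightarrow> Z / (Z * 1)"
    using Z by (intro tendsto_intros \<tau>) auto
  then have "(\<lambda>n. (\<tau> n * expected_summands \<Lambda> n) / (Z * (scale n * \<tau> n))) \<longlonglongrightarrow> 1" using Z by simp
  then show ?thesis
    unfolding Z_def[symmetric] by (rule Lim_transform_eventually) (use \<tau>_pos in eventually_elim, simp)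
qed

lemma expected_summands_superlinear:
  assumes "\<mu> > 1"
  shows "(\<lambda>n. expected_summands \<Lambda> n / (A * riemann_zeta \<mu> * scale n powr \<mu>)) \<longlonglongrightarrow> 1"
proof -
  define Z where "Z = A * riemann_zeta \<mu>"
  have Z: "Z > 0" using A_pos riemann_zeta_sums(2)[OF assms] by (simp add: Z_def)
  have ev: "eventually (\<lambda>t::real. t powr \<mu> > 0) (at_right 0)"
    using at_right_0_pos by eventually_elim simp
  have ev2: "eventually (\<lambda>t::real. t powr \<mu> \<le> 2 powr \<mu> * (t / 2) powr \<mu>) (at_right 0)"
    using at_right_0_pos by eventually_elim (simp add: powr_divide)
  have lim: "((\<lambda>t. t powr \<mu> * lap (divisor_weight 0) t) \<longlongrightarrow> Z) (at_right 0)"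
    using lap_divisor_weight_asymp[of 0] assms by (simp add: Z_def)
  obtain \<tau> where \<tau>: "filterlim \<tau> (at_right 0) sequentially" "(\<lambda>n. scale n * \<tau> n) \<longlonglongrightarrow> 1"
     "(\<lambda>n. \<tau> n powr \<mu> * expected_summands \<Lambda> n) \<longlonglongrightarrow> Z"
    using expected_summands_asymp[OF lim Z ev ev2] by auto
  have \<tau>_pos: "eventually (\<lambda>n. \<tau> n > 0) sequentially"
    using \<tau> by (auto simp: filterlim_at elim: eventually_mono)
  have "(\<lambda>n. (\<tau> n powr \<mu> * expected_summands \<Lambda> n) / (Z * (scale n * \<tau> n) powr \<mu>)) \<longlonglongrightarrow> Z / (Z * 1 powr \<mu>)"
    using Z by (intro tendsto_intros \<tau>) auto
  then have "(\<lambda>n. (\<tau> n powr \<mu> * expected_summands \<Lambda> n) / (Z * (scale n * \<tau> n) powr \<mu>)) \<longlonglongrightarrow> 1" using Z by simp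
  then show ?thesis
    unfolding Z_def[symmetric]
  proof (rule Lim_transform_eventually)
    show "eventually (\<lambda>n. (\<tau> n powr \<mu> * expected_summands \<Lambda> n) / (Z * (scale n * \<tau> n) powr \<mu>)
       = expected_summands \<Lambda> n / (Z * scale n powr \<mu>)) sequentially"
      using \<tau>_pos
    proof eventually_elim
      case (elim n)
      have "(scale n * \<tau> n) powr \<mu> = scale n powr \<mu> * \<tau> n powr \<mu>"
        by (rule powr_mult)
      then show ?case using elim by simp
    qed
  qed
qed

text \<open>The additive constant \<open>c\<close> is absorbed by the logarithm.\<close>

lemma expected_summands_critical:
  fixes c :: complex
  assumes "\<mu> = 1"
  shows "(\<lambda>n. of_real (scale n) * (c + of_real (A * ln (scale n))) / of_real (expected_summands \<Lambda> n)) \<longlonglongrightarrow> 1"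
proof -
  define \<phi> where "\<phi> = (\<lambda>t::real. t / ln (1 / t))"
  have ev: "eventually (\<lambda>t::real. \<phi> t > 0) (at_right 0)"
    by (auto simp: \<phi>_def eventually_at_right_field intro!: exI[of _ 1])
  have "((\<lambda>t. \<phi> t / \<phi> (t / 2)) \<longlongrightarrow> 2) (at_right 0)"
    unfolding \<phi>_def by real_asymp
  then have "eventually (\<lambda>t. \<phi> t / \<phi> (t / 2) < 3) (at_right 0)" by (rule order_tendstoD) simp
  moreover have "eventually (\<lambda>t::real. \<phi> (t / 2) > 0) (at_right 0)"
    by (auto simp: \<phi>_def eventually_at_right_field intro!: exI[of _ 1])
  ultimately have ev2: "eventually (\<lambda>t. \<phi> t \<le> 3 * \<phi> (t / 2)) (at_right 0)"
    by eventually_elim (simp add: field_simps)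
  have lim: "((\<lambda>t. \<phi> t * lap (divisor_weight 0) t) \<longlongrightarrow> A) (at_right 0)"
    unfolding \<phi>_def by (rule lap_divisor_count_critical[OF assms])
  obtain \<tau> where \<tau>: "filterlim \<tau> (at_right 0) sequentially" and sc: "(\<lambda>n. scale n * \<tau> n) \<longlonglongrightarrow> 1"
     and m: "(\<lambda>n. \<phi> (\<tau> n) * expected_summands \<Lambda> n) \<longlonglongrightarrow> A"
    using expected_summands_asymp[OF lim A_pos ev ev2] by auto
  have \<tau>_pos: "eventually (\<lambda>n. \<tau> n > 0) sequentially"
    using \<tau> by (auto simp: filterlim_at elim: eventually_mono)
  have sc_pos: "eventually (\<lambda>n. scale n * \<tau> n > 0) sequentially"
    by (rule order_tendstoD(1)[OF sc]) simp
  have "filterlim (\<lambda>t::real. ln (1 / t)) at_top (at_right 0)" by real_asymp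
  from filterlim_compose[OF this \<tau>] have ln_top: "filterlim (\<lambda>n. ln (1 / \<tau> n)) at_top sequentially" .
  have ln_pos: "eventually (\<lambda>n. ln (1 / \<tau> n) > 0) sequentially"
    using filterlim_at_top_dense[THEN iffD1, OF ln_top] by blast
  have inv0: "(\<lambda>n. inverse (ln (1 / \<tau> n))) \<longlonglongrightarrow> 0"
    by (rule tendsto_inverse_0_at_top[OF ln_top])
  define L where "L n = ln (1 / \<tau> n)" for n
  \<comment> \<open>Eventually this is \<open>scale n * L n / expected_summands \<Lambda> n\<close>.
    Dividing the bracket by \<open>L n\<close> sends \<open>c\<close> to \<open>0\<close> and
    \<open>A * ln (scale n)\<close> to \<open>A\<close>, because
    \<open>ln (scale n) = L n + ln (scale n * \<tau> n)\<close> and the last term tends to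
    \<open>0\<close>.\<close>
  define q where "q n = (scale n * \<tau> n) / (\<phi> (\<tau> n) * expected_summands \<Lambda> n)" for n
  have q: "q \<longlonglongrightarrow> 1 / A"
    unfolding q_def using A_pos by (intro tendsto_intros sc m) auto
  have lnq: "(\<lambda>n. ln (scale n * \<tau> n) * inverse (L n) + 1) \<longlonglongrightarrow> ln 1 * 0 + 1"
    unfolding L_def by (intro tendsto_intros sc inv0) simp
  have "(\<lambda>n. of_real (q n) * (c * of_real (inverse (L n)) + of_real (A * (ln (scale n * \<tau> n) * inverse (L n) + 1)))) \<longlonglongrightarrow>
      of_real (1 / A) * (c * of_real 0 + of_real (A * (ln 1 * 0 + 1)))"
    by (intro tendsto_intros q lnq inv0[folded L_def])
  then have "(\<lambda>n. of_real (q n) * (c * of_real (inverse (L n)) + of_real (A * (ln (scale n * \<tau> n) * inverse (L n) + 1)))) \<longlonglongrightarrow> 1"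
    using A_pos by simp
  then show ?thesis
  proof (rule Lim_transform_eventually)
    show "eventually (\<lambda>n. of_real (q n) * (c * of_real (inverse (L n)) + of_real (A * (ln (scale n * \<tau> n) * inverse (L n) + 1)))
      = of_real (scale n) * (c + of_real (A * ln (scale n))) / of_real (expected_summands \<Lambda> n)) sequentially"
      using \<tau>_pos sc_pos ln_pos
    proof eventually_elim
      case (elim n)
      have L: "L n > 0" using elim by (simp add: L_def)
      have s: "scale n > 0" using elim by (simp add: zero_less_mult_iff)
      have qn: "q n = scale n * L n / expected_summands \<Lambda> n"
        using elim by (simp add: q_def \<phi>_def L_def)
      have "ln (scale n * \<tau> n) + L n = ln (scale n)"
        using elim s by (simp add: L_def ln_mult ln_div)
      then have "A * (ln (scale n * \<tau> n) * inverse (L n) + 1) = A * ln (scale n) * inverse (L n)"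
        using L by (simp add: field_simps)
      then have e1: "c * of_real (inverse (L n)) + of_real (A * (ln (scale n * \<tau> n) * inverse (L n) + 1))
         = (c + of_real (A * ln (scale n))) * of_real (inverse (L n))"
        by (simp only: of_real_mult distrib_right)
      have e2: "of_real (inverse (L n)) * of_real (q n) = complex_of_real (scale n / expected_summands \<Lambda> n)"
        unfolding qn of_real_mult[symmetric] using L by simp
      have "of_real (q n) * ((c + of_real (A * ln (scale n))) * of_real (inverse (L n)))
         = (of_real (inverse (L n)) * of_real (q n)) * (c + of_real (A * ln (scale n)))"
        by (simp only: mult_ac)
      then show ?case unfolding e1 e2 by simp
    qed
  qed
qed

text \<open>For \<open>\<mu> < 1\<close> the point \<open>1\<close> lies in the region of
  convergence, so the first branch of \<open>zeta_seq\<close> applies.\<close>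

lemma zeta_seq_1:
  assumes "\<mu> < 1"
  shows "zeta_seq \<Lambda> 1 = of_real (\<Sum>i. 1 / real (\<Lambda> i))"
proof -
  have eq: "of_nat (\<Lambda> i) powr (- 1) = complex_of_real (1 / real (\<Lambda> i))" for i
    using part_pos[of i] by (simp add: powr_minus field_simps)
  have "dirichlet_conv \<Lambda> 1"
    unfolding dirichlet_conv_def eq using summable_inverse_parts[OF assms] by (simp add: norm_divide)
  moreover have "dirichlet_sum \<Lambda> 1 = of_real (\<Sum>i. 1 / real (\<Lambda> i))"
    unfolding dirichlet_sum_def eq
    using suminf_of_real[OF summable_inverse_parts[OF assms], where ?'a = complex] by simp
  ultimately show ?thesis by (simp add: zeta_seq_def)
qed

end

section \<open>The leading coefficient and the admissibility conditions\<close>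

lemma theta_expansion_leading:
  assumes "theta_expansion \<Lambda> k A"
  shows "((\<lambda>t. t powr (- k 0) * Theta \<Lambda> t) \<longlongrightarrow> A (k 0)) (at_right 0)"
proof -
  have "(\<lambda>t. Theta \<Lambda> t - (\<Sum>i\<le>0. A (k i) * t powr k i)) \<in> o[at_right 0](\<lambda>t. t powr k 0)"
    using assms unfolding theta_expansion_def by blast
  then have "((\<lambda>t. (Theta \<Lambda> t - A (k 0) * t powr k 0) / t powr k 0) \<longlongrightarrow> 0) (at_right 0)"
    by (intro smalloD_tendsto) simp
  then have "((\<lambda>t. (Theta \<Lambda> t - A (k 0) * t powr k 0) / t powr k 0 + A (k 0)) \<longlongrightarrow> 0 + A (k 0)) (at_right 0)"
    by (intro tendsto_intros)
  then have "((\<lambda>t. (Theta \<Lambda> t - A (k 0) * t powr k 0) / t powr k 0 + A (k 0)) \<longlongrightarrow> A (k 0)) (at_right 0)" by simp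
  then show ?thesis
  proof (rule Lim_transform_eventually)
    show "eventually (\<lambda>t. (Theta \<Lambda> t - A (k 0) * t powr k 0) / t powr k 0 + A (k 0) = t powr (- k 0) * Theta \<Lambda> t) (at_right 0)"
      using at_right_0_pos
      by eventually_elim (simp add: powr_minus field_simps)
  qed
qed

text \<open>The sign of the leading coefficient has to be derived: it is a limit of nonnegative
  values and is nonzero, hence positive.\<close>

lemma theta_parts_admissible:
  assumes adm: "admissible_seq \<Lambda>" and exp: "theta_expansion \<Lambda> k A"
  shows "theta_parts \<Lambda> (- k 0) (A (k 0))"
proof -
  have a: "mono \<Lambda>" "\<And>i. 0 < \<Lambda> i" "\<And>l. finite {i. \<Lambda> i = l}" "1 \<in> range \<Lambda>"
     "\<And>t. t > 0 \<Longrightarrow> summable (\<lambda>i. exp (- real (\<Lambda> i) * t))"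
    using adm unfolding admissible_seq_def by blast+
  have k: "k 0 < 0" "A (k 0) \<noteq> 0" using exp unfolding theta_expansion_def by blast+
  note lim = theta_expansion_leading[OF exp]
  have "eventually (\<lambda>t. 0 \<le> t powr (- k 0) * Theta \<Lambda> t) (at_right 0)"
    using at_right_0_pos
    by eventually_elim (auto simp: Theta_def intro!: mult_nonneg_nonneg suminf_nonneg a(5)[simplified])
  then have "A (k 0) \<ge> 0" by (intro tendsto_lowerbound[OF lim]) auto
  then have "A (k 0) > 0" using k by simp
  then show ?thesis using a k lim by unfold_locales auto
qed

theorem corollary8:
  fixes \<Lambda> :: "nat \<Rightarrow> nat" and k :: "nat \<Rightarrow> real" and A :: "real \<Rightarrow> real" and \<mu> :: real
  assumes "admissible_seq \<Lambda>"
    and "theta_expansion \<Lambda> k A"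
    and "\<And>i. i > 0 \<Longrightarrow> k i \<ge> 0"
    and "\<mu> = - k 0"
  shows "(\<mu> < 1 \<longrightarrow>
      (\<lambda>n. complex_of_real (expected_summands \<Lambda> n)) \<sim>[sequentially]
      (\<lambda>n. zeta_seq \<Lambda> 1 *
        complex_of_real ((real n / (riemann_zeta (\<mu> + 1) * \<mu> * A (- \<mu>))) powr (1 / (\<mu> + 1)))))
    \<and> (\<mu> = 1 \<longrightarrow>
      (\<lambda>n. complex_of_real (expected_summands \<Lambda> n)) \<sim>[sequentially]
      (\<lambda>n. complex_of_real ((6 * real n / (pi\<^sup>2 * A (- 1))) powr (1 / 2)) *
        (finite_part (zeta_seq \<Lambda>) 1
          - complex_of_real (A (- 1) / 2 * ln (pi\<^sup>2 * A (- 1) / (6 * real n))))))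
    \<and> (\<mu> > 1 \<longrightarrow>
      expected_summands \<Lambda> \<sim>[sequentially]
      (\<lambda>n. riemann_zeta \<mu> * A (- \<mu>) powr (1 / (\<mu> + 1)) *
        (real n / (riemann_zeta (\<mu> + 1) * \<mu>)) powr (\<mu> / (\<mu> + 1))))"
proof -
  have k0: "k 0 = - \<mu>" using assms(4) by simp
  interpret theta_parts \<Lambda> \<mu> "A (- \<mu>)"
    using theta_parts_admissible[OF assms(1,2)] by (simp add: k0)
  show ?thesis
  proof (intro conjI impI)
    assume \<mu>: "\<mu> < 1"
    have "(\<lambda>n. complex_of_real (expected_summands \<Lambda> n / ((\<Sum>i. 1 / real (\<Lambda> i)) * scale n))) \<longlonglongrightarrow> of_real 1"
      by (intro tendsto_of_real expected_summands_sublinear[OF \<mu>])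
    then show "(\<lambda>n. complex_of_real (expected_summands \<Lambda> n)) \<sim>[sequentially]
      (\<lambda>n. zeta_seq \<Lambda> 1 *
        complex_of_real ((real n / (riemann_zeta (\<mu> + 1) * \<mu> * A (- \<mu>))) powr (1 / (\<mu> + 1))))"
      unfolding scale_def[symmetric] zeta_seq_1[OF \<mu>] by (intro asymp_equivI') simp
  next
    assume \<mu>: "\<mu> = 1"
    \<comment> \<open>For \<open>\<mu> = 1\<close> the scale contains
      \<open>riemann_zeta 2 = pi ^ 2 / 6\<close>, the origin of the constant in the claim.\<close>
    have scale: "scale n = (6 * real n / (pi\<^sup>2 * A (- 1))) powr (1 / 2)" for n
      unfolding scale_def unfolding \<mu> by (simp add: riemann_zeta_2 mult.commute[of 6])
    \<comment> \<open>The finite part takes the place of the additive constant \<open>c\<close>. The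
      quotient has the expected number in the denominator and is turned around at the end by
      symmetry of asymptotic equivalence.\<close>
    have "(\<lambda>n. of_real (scale n) * (finite_part (zeta_seq \<Lambda>) 1 + of_real (A (- \<mu>) * ln (scale n)))
        / of_real (expected_summands \<Lambda> n)) \<longlonglongrightarrow> 1"
      by (rule expected_summands_critical[OF \<mu>])
    then have "(\<lambda>n. complex_of_real (scale n) * (finite_part (zeta_seq \<Lambda>) 1
          - complex_of_real (A (- 1) / 2 * ln (pi\<^sup>2 * A (- 1) / (6 * real n)))) / of_real (expected_summands \<Lambda> n)) \<longlonglongrightarrow> 1"
    proof (rule Lim_transform_eventually)
      show "eventually (\<lambda>n. of_real (scale n) * (finite_part (zeta_seq \<Lambda>) 1 + of_real (A (- \<mu>) * ln (scale n))) / of_real (expected_summands \<Lambda> n)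
        = complex_of_real (scale n) * (finite_part (zeta_seq \<Lambda>) 1
          - complex_of_real (A (- 1) / 2 * ln (pi\<^sup>2 * A (- 1) / (6 * real n)))) / of_real (expected_summands \<Lambda> n)) sequentially"
        using eventually_gt_at_top[of 0]
      proof eventually_elim
        case (elim n)
        have pos: "A (- 1) > 0" using A_pos \<mu> by simp
        have "ln (scale n) = 1 / 2 * ln (6 * real n / (pi\<^sup>2 * A (- 1)))"
          unfolding scale using elim pos by (subst ln_powr) auto
        also have "\<dots> = - (1 / 2 * ln (pi\<^sup>2 * A (- 1) / (6 * real n)))"
          using elim pos by (simp add: ln_div field_simps)
        finally have "A (- \<mu>) * ln (scale n) = - (A (- 1) / 2 * ln (pi\<^sup>2 * A (- 1) / (6 * real n)))"
          by (simp add: \<mu>)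
        then show ?case by (simp only: of_real_minus) simp
      qed
    qed
    from asymp_equiv_symI[OF asymp_equivI'[OF this]]
    show "(\<lambda>n. complex_of_real (expected_summands \<Lambda> n)) \<sim>[sequentially]
      (\<lambda>n. complex_of_real ((6 * real n / (pi\<^sup>2 * A (- 1))) powr (1 / 2)) *
        (finite_part (zeta_seq \<Lambda>) 1
          - complex_of_real (A (- 1) / 2 * ln (pi\<^sup>2 * A (- 1) / (6 * real n)))))"
      unfolding scale .
  next
    assume \<mu>: "\<mu> > 1"
    \<comment> \<open>The exponents of the leading coefficient combine as
      \<open>1 - \<mu> / (\<mu> + 1) = 1 / (\<mu> + 1)\<close>.\<close>
    have target: "riemann_zeta \<mu> * A (- \<mu>) powr (1 / (\<mu> + 1)) * (real n / (riemann_zeta (\<mu> + 1) * \<mu>)) powr (\<mu> / (\<mu> + 1))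
       = A (- \<mu>) * riemann_zeta \<mu> * scale n powr \<mu>" for n
    proof -
      define b where "b = riemann_zeta (\<mu> + 1) * \<mu>"
      have b: "b > 0" using riemann_zeta_sums(2)[of "\<mu> + 1"] mu_pos by (simp add: b_def)
      have "scale n powr \<mu> = (real n / b / A (- \<mu>)) powr (\<mu> / (\<mu> + 1))"
        by (simp add: scale_def b_def powr_powr)
      also have "\<dots> = (real n / b) powr (\<mu> / (\<mu> + 1)) / A (- \<mu>) powr (\<mu> / (\<mu> + 1))"
        by (rule powr_divide)
      finally have "A (- \<mu>) * scale n powr \<mu> = A (- \<mu>) powr 1 * (real n / b) powr (\<mu> / (\<mu> + 1)) / A (- \<mu>) powr (\<mu> / (\<mu> + 1))"
        using A_pos by simp
      also have "\<dots> = A (- \<mu>) powr (1 - \<mu> / (\<mu> + 1)) * (real n / b) powr (\<mu> / (\<mu> + 1))"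
        by (simp add: powr_diff)
      also have "1 - \<mu> / (\<mu> + 1) = 1 / (\<mu> + 1)" using mu_pos by (simp add: field_simps)
      finally show ?thesis by (simp add: b_def mult_ac)
    qed
    show "expected_summands \<Lambda> \<sim>[sequentially]
      (\<lambda>n. riemann_zeta \<mu> * A (- \<mu>) powr (1 / (\<mu> + 1)) *
        (real n / (riemann_zeta (\<mu> + 1) * \<mu>)) powr (\<mu> / (\<mu> + 1)))"
      unfolding target by (rule asymp_equivI'[OF expected_summands_superlinear[OF \<mu>]])
  qed
qed

end
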